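(* Let $l_1,l_2,l_3\in\mathbb{R}$ be pairwise distinct, let $b_1,b_3\in\mathbb{R}\setminus\{0\}$, and let $k_3\in\mathbb{R}\setminus\{0\}$. For $q\in(0,1)$ consider the controlled fractional Stokes system on $\mathbb{R}^3$ $$\begin{cases} D_t^q u^1 = (l_2-l_3)u^2u^3 - b_3u^2 + k_3u^1,\\ D_t^q u^2 = (l_3-l_1)u^3u^1 + b_3u^1 - b_1u^3,\\ D_t^q u^3 = (l_1-l_2)u^1u^2 + b_1u^2 + k_3u^3,\end{cases}$$ and its equilibrium state $e_0=(0,0,0)$. Put $\beta_{03}=\sqrt{b_1^2+b_3^2}$ and $\Delta_{03}=k_3^2-4\beta_{03}^2$. 1. Let $\Delta_{03}<0$ and $q\in(0,1)$. (i) If $k_3<0$, then $e_0$ is asymptotically stable, for all $k_3\in(-2\beta_{03},0)$. (ii) If $k_3>0$, then $e_0$ is unstable, for all $k_3\in(0,2\beta_{03})$. 2. Let $\Delta_{03}\ge 0$ and $q\in(0,1)$. (i) If $k_3<0$, then $e_0$ is asymptotically stable, for all $k_3\in(-\infty,-2\beta_{03}]$. (ii) If $k_3>0$, then $e_0$ is unstable, for all $k_3\in[2\beta_{03},\infty)$.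
   Context: $u^1,u^2,u^3$ denote the components of $u$ (superscripts are indices, not powers). For $q\in(0,1)$, $D_t^q$ is the Caputo fractional derivative of order $q$: $D_t^q f(t)=\frac{1}{\Gamma(1-q)}\int_0^t (t-s)^{-q}f'(s)\,ds$. For a fractional system $D_t^q x^i(t)=f_i(x^1(t),\dots,x^n(t))$, $i=1,\dots,n$, with $f_i\in C^\infty(\mathbb{R}^n,\mathbb{R})$, a point $x_e\in\mathbb{R}^n$ is an equilibrium state if $f_i(x_e)=0$ for all $i$. The equilibrium state $x_e$ is (locally) stable if for every $\varepsilon>0$ there is $\delta>0$ such that every solution with $\|x(0)-x_e\|<\delta$ satisfies $\|x(t)-x_e\|<\varepsilon$ for all $t>0$; it is (locally) asymptotically stable if it is stable and $\lim_{t\to\infty}\|x(t)-x_e\|=0$ for all solutions starting sufficiently close to $x_e$; it is unstable if it is not stable. Here $\|\cdot\|$ is the Euclidean norm. *)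

theory Defs
  imports "HOL-Analysis.Analysis"
begin

definition caputo_integrable :: "real \<Rightarrow> (real \<Rightarrow> real) \<Rightarrow> real \<Rightarrow> bool" where
  "caputo_integrable q f t \<longleftrightarrow>
     (\<lambda>s. (t - s) powr (- q) * deriv f s) absolutely_integrable_on {0..t}"

definition caputo_deriv :: "real \<Rightarrow> (real \<Rightarrow> real) \<Rightarrow> real \<Rightarrow> real" where
  "caputo_deriv q f t =
     1 / Gamma (1 - q) * integral {0..t} (\<lambda>s. (t - s) powr (- q) * deriv f s)"

text \<open>
  A solution of \<open>D\<^sub>t\<^sup>q x\<^sup>i = F\<^sub>i (x)\<close> lives on \<open>[0, \<infinity>)\<close>; values at negative times are irrelevant.
  Nonconstant solutions behave like \<open>x(0) + c t\<^sup>q\<close> near \<open>0\<close>, so differentiability can only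
  be required for \<open>t > 0\<close>; likewise the equation itself, because the Caputo integral is void at
  \<open>t = 0\<close>. Integrability is required explicitly because \<open>integral\<close> is total.
\<close>

definition caputo_solution :: "real \<Rightarrow> (real^'n \<Rightarrow> real^'n) \<Rightarrow> (real \<Rightarrow> real^'n) \<Rightarrow> bool" where
  "caputo_solution q F x \<longleftrightarrow>
     continuous_on {0..} x \<and>
     (\<forall>i. \<forall>t>0. (\<lambda>s. x s $ i) differentiable (at t) \<and>
                caputo_integrable q (\<lambda>s. x s $ i) t \<and>
                caputo_deriv q (\<lambda>s. x s $ i) t = F (x t) $ i)"

definition equilibrium_state :: "(real^'n \<Rightarrow> real^'n) \<Rightarrow> real^'n \<Rightarrow> bool" where
  "equilibrium_state F xe \<longleftrightarrow> (\<forall>i. F xe $ i = 0)"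

text \<open>The stability notions are meant for an equilibrium state \<open>xe\<close> of a smooth \<open>F\<close>.\<close>

definition caputo_stable :: "real \<Rightarrow> (real^'n \<Rightarrow> real^'n) \<Rightarrow> real^'n \<Rightarrow> bool" where
  "caputo_stable q F xe \<longleftrightarrow>
     (\<forall>\<epsilon>>0. \<exists>\<delta>>0. \<forall>x. caputo_solution q F x \<and> norm (x 0 - xe) < \<delta> \<longrightarrow>
        (\<forall>t>0. norm (x t - xe) < \<epsilon>))"

definition caputo_asymptotically_stable ::
    "real \<Rightarrow> (real^'n \<Rightarrow> real^'n) \<Rightarrow> real^'n \<Rightarrow> bool" where
  "caputo_asymptotically_stable q F xe \<longleftrightarrow>
     caputo_stable q F xe \<and>
     (\<exists>\<eta>>0. \<forall>x. caputo_solution q F x \<and> norm (x 0 - xe) < \<eta> \<longrightarrow>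
        ((\<lambda>t. norm (x t - xe)) \<longlongrightarrow> 0) at_top)"

definition caputo_unstable :: "real \<Rightarrow> (real^'n \<Rightarrow> real^'n) \<Rightarrow> real^'n \<Rightarrow> bool" where
  "caputo_unstable q F xe \<longleftrightarrow> \<not> caputo_stable q F xe"

definition stokes_field ::
    "real \<Rightarrow> real \<Rightarrow> real \<Rightarrow> real \<Rightarrow> real \<Rightarrow> real \<Rightarrow> real^3 \<Rightarrow> real^3" where
  "stokes_field l1 l2 l3 b1 b3 k3 u = vector
     [(l2 - l3) * u$2 * u$3 - b3 * u$2 + k3 * u$1,
      (l3 - l1) * u$3 * u$1 + b3 * u$1 - b1 * u$3,
      (l1 - l2) * u$1 * u$2 + b1 * u$2 + k3 * u$3]"

end

theory Submission
  imports Defs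
begin

text \<open>
  Three features of the system drive the proof. The quadratic terms do no work, so
  \<open>u \<bullet> F u = k (u\<^sub>1\<^sup>2 + u\<^sub>3\<^sup>2)\<close>. If \<open>h\<close> attains its maximum over \<open>[0, t]\<close> at \<open>t\<close>, then
  \<open>D\<^sup>q h t \<ge> t\<^sup>-\<^sup>q (h t - h 0) / \<Gamma>(1 - q) \<ge> 0\<close>; and for a convex \<open>V\<close>, if \<open>V \<circ> u\<close> is maximal
  at \<open>t\<close>, so is the linear combination \<open>\<nabla>V(u t) \<bullet> u\<close> of the components of \<open>u\<close>, to which
  the equation applies.

  For \<open>k < 0\<close> this shows that the norm does not increase. With the strict Lyapunov function
  \<open>V u = |u|\<^sup>2 + 2 e u\<^sub>2 (b\<^sub>3 u\<^sub>1 - b\<^sub>1 u\<^sub>3)\<close>, maximising \<open>V (u s) + K s / T\<close> over \<open>[0, T]\<close>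
  gives the decay rate \<open>V (u T) = O(T\<^sup>-\<^sup>q)\<close>.

  For \<open>k > 0\<close> put \<open>m = k\<^sup>1\<^sup>/\<^sup>q\<close>. Comparison yields \<open>|u t| \<le> C |u 0| e\<^sup>m\<^sup>t\<close>, and, for \<open>u 0\<close> on the eigenline
  of \<open>k\<close> spanned by \<open>w = (b\<^sub>1, 0, b\<^sub>3)\<close>, also
  \<open>w \<bullet> u t \<ge> (w \<bullet> u 0) e\<^sup>m\<^sup>t / 2 - O(|u 0|\<^sup>2) e\<^sup>2\<^sup>m\<^sup>t\<close>. The right-hand side reaches a height
  independent of \<open>|u 0|\<close>. The exponent \<open>m\<close> in the upper bound must be exact: any larger one loses
  a power of \<open>|u 0|\<close>.

  Instability also needs solutions that exist for all times. In the variable \<open>\<tau> = t\<^sup>q\<close> the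
  integral equation reads \<open>U \<tau> = u\<^sub>0 + \<tau> / \<Gamma>(q + 1) \<integral>\<^sub>0\<^sup>1 f (\<tau> \<omega>(p)) dp\<close> with \<open>f s = F (U s)\<close> and
  \<open>\<omega>(p) = (1 - p\<^sup>1\<^sup>/\<^sup>q)\<^sup>q\<close>, so it has no singular kernel, and Picard iteration converges together with
  the derivatives. A cut-off that respects the energy identity makes the field Lipschitz, and
  the upper bound above shows that the cut-off is never active.
\<close>


section \<open>The Caputo derivative at a maximum\<close>

text \<open>The part of \<open>caputo_solution\<close> that does not mention the field. Since
  \<open>deriv\<close> and \<open>integral\<close> are total, the calculus of
  \<open>caputo_deriv\<close> is available only under such a condition.\<close>

definition caputo_regular :: "real \<Rightarrow> (real \<Rightarrow> real) \<Rightarrow> bool" where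
  "caputo_regular q f \<longleftrightarrow> continuous_on {0..} f \<and>
     (\<forall>t>0. f differentiable (at t) \<and> caputo_integrable q f t)"

text \<open>Integration by parts against h t - h s leaves, besides boundary terms, the integral of q
  (t - s)^(-q-1) (h t - h s), which is nonnegative at a maximum. The kernel is singular at t, so
  this is done on \<open>{0..r}\<close> with r < t, and then r tends to t.\<close>

lemma caputo_deriv_extremum:
  assumes q: "0 < q" "q < 1" and t: "0 < t" and reg: "caputo_regular q h"
    and mx: "\<And>s. 0 \<le> s \<Longrightarrow> s \<le> t \<Longrightarrow> h s \<le> h t"
  shows "t powr (- q) / Gamma (1 - q) * (h t - h 0) \<le> caputo_deriv q h t"
proof -
  have Gpos: "Gamma (1 - q) > 0" using q by (intro Gamma_real_pos) auto
  define f where "f = (\<lambda>s. (t - s) powr (- q) * deriv h s)"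
  define J where "J = (\<lambda>r. integral {0..r} f)"
  have cont: "continuous_on {0..} h" and diff: "\<And>s. s > 0 \<Longrightarrow> h differentiable (at s)"
    and int: "caputo_integrable q h t"
    using reg t by (auto simp: caputo_regular_def)
  have dh: "(h has_real_derivative deriv h s) (at s)" if "s > 0" for s
    using diff[OF that] by (metis DERIV_deriv_iff_real_differentiable)
  have fint: "f integrable_on {0..t}"
    using int unfolding caputo_integrable_def f_def using absolutely_integrable_on_def by blast
  have "continuous_on {0..t} J"
    unfolding J_def by (rule indefinite_integral_continuous_1[OF fint])
  hence "(J \<longlongrightarrow> J t) (at t within {0..t})"
    using t by (auto simp: continuous_on_def)
  hence Jlim: "(J \<longlongrightarrow> J t) (at_left t)"
    using t by (simp add: at_within_Icc_at_left)
  have lower: "t powr (- q) * (h t - h 0) - (t - r) powr (-q) * (h t - h r) \<le> J r"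
    if r: "0 < r" "r < t" for r
  proof -
    define \<Phi> where "\<Phi> = (\<lambda>s. - ((t - s) powr (- q) * (h t - h s)))"
    define g where "g = (\<lambda>s. q * (t - s) powr (- q - 1) * (h t - h s))"
    have ch: "continuous_on {0..r} h" using cont by (rule continuous_on_subset) auto
    have "((\<lambda>s. f s - g s) has_integral (\<Phi> r - \<Phi> 0)) {0..r}"
    proof (rule fundamental_theorem_of_calculus_interior)
      show "0 \<le> r" using r by simp
      show "continuous_on {0..r} \<Phi>" unfolding \<Phi>_def using r
        by (intro continuous_intros ch) auto
      fix s assume s: "s \<in> {0<..<r}"
      have "(\<Phi> has_real_derivative f s - g s) (at s)"
        unfolding \<Phi>_def f_def g_def using s r
        by (auto intro!: derivative_eq_intros dh simp: algebra_simps)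
      thus "(\<Phi> has_vector_derivative f s - g s) (at s)"
        by (simp add: has_real_derivative_iff_has_vector_derivative)
    qed
    moreover have gint: "g integrable_on {0..r}"
      unfolding g_def using r by (intro integrable_continuous_real continuous_intros ch) auto
    moreover have fr: "f integrable_on {0..r}"
      using fint by (rule integrable_on_subinterval) (use r in auto)
    ultimately have "J r - integral {0..r} g = \<Phi> r - \<Phi> 0"
      unfolding J_def by (metis integral_diff integral_unique)
    moreover have "0 \<le> integral {0..r} g"
      using r mx q unfolding g_def by (intro integral_nonneg gint[unfolded g_def] mult_nonneg_nonneg) auto
    ultimately show ?thesis unfolding \<Phi>_def by (simp add: algebra_simps)
  qed
  \<comment> \<open>The boundary term at r is (t - r)^(1-q) times a difference quotient, hence
    vanishes in the limit because q < 1.\<close>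
  have "((\<lambda>r. (t - r) powr (1 - q) * ((h r - h t) / (r - t))) \<longlongrightarrow> 0 * deriv h t) (at_left t)"
  proof (rule tendsto_mult)
    have "((\<lambda>r. t - r) \<longlongrightarrow> t - t) (at_left t)" by (intro tendsto_intros)
    hence "((\<lambda>r. (t - r) powr (1 - q)) \<longlongrightarrow> (t - t) powr (1 - q)) (at_left t)"
      by (rule tendsto_powr'; use q in \<open>auto intro!: tendsto_intros eventually_at_leftI[of 0] t\<close>)
    thus "((\<lambda>r. (t - r) powr (1 - q)) \<longlongrightarrow> 0) (at_left t)" using q by simp
    show "((\<lambda>r. (h r - h t) / (r - t)) \<longlongrightarrow> deriv h t) (at_left t)"
      using dh[OF t] unfolding has_field_derivative_iff
      by (rule filterlim_mono) (auto intro: at_le)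
  qed
  moreover have "\<forall>\<^sub>F r in at_left t. (t - r) powr (1 - q) * ((h r - h t) / (r - t))
      = (t - r) powr (-q) * (h t - h r)"
    using t by (intro eventually_at_leftI[of 0])
      (auto simp: powr_diff powr_minus field_simps)
  ultimately have "((\<lambda>r. (t - r) powr (-q) * (h t - h r)) \<longlongrightarrow> 0) (at_left t)"
    by (simp add: filterlim_cong)
  hence "((\<lambda>r. t powr (- q) * (h t - h 0) - (t - r) powr (-q) * (h t - h r))
      \<longlongrightarrow> t powr (- q) * (h t - h 0) - 0) (at_left t)"
    by (intro tendsto_intros)
  moreover have "\<forall>\<^sub>F r in at_left t. t powr (- q) * (h t - h 0) - (t - r) powr (-q) * (h t - h r) \<le> J r"
    using lower t by (intro eventually_at_leftI[of 0]) auto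
  ultimately have "t powr (- q) * (h t - h 0) \<le> J t"
    using tendsto_le[OF _ Jlim] by force
  thus ?thesis using Gpos unfolding caputo_deriv_def J_def f_def
    by (simp add: divide_right_mono)
qed

section \<open>Linearity of the Caputo derivative\<close>

text \<open>Differentiability is known only for s > 0, so the rule for \<open>deriv\<close> may fail
  at s = 0; the integrands agree off the null set \<open>{0}\<close>.\<close>

lemma caputo_regular_add:
  assumes "caputo_regular q f" "caputo_regular q g"
  shows "caputo_regular q (\<lambda>s. f s + g s)"
    and "t > 0 \<Longrightarrow> caputo_deriv q (\<lambda>s. f s + g s) t = caputo_deriv q f t + caputo_deriv q g t"
proof -
  have d: "deriv (\<lambda>s. f s + g s) s = deriv f s + deriv g s" if "s > 0" for s
    using assms that by (intro deriv_add) (auto simp: caputo_regular_def field_differentiable_def real_differentiable_def)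
  have eq: "(t - s) powr (- q) * (deriv f s) + (t - s) powr (- q) * deriv g s
      = (t - s) powr (- q) * deriv (\<lambda>s. f s + g s) s" if "s \<in> {0..t} - {0}" for s t
    using d[of s] that by (simp add: algebra_simps)
  have ai: "(\<lambda>s. (t - s) powr (- q) * (deriv f s) + (t - s) powr (- q) * deriv g s)
      absolutely_integrable_on {0..t}" if "t > 0" for t
    using assms that by (intro set_integral_add) (auto simp: caputo_regular_def caputo_integrable_def)
  have "caputo_integrable q (\<lambda>s. f s + g s) t" if "t > 0" for t
    unfolding caputo_integrable_def
    by (rule absolutely_integrable_spike[OF ai[OF that], of "{0}"]) (simp, simp only: eq)
  thus "caputo_regular q (\<lambda>s. f s + g s)"
    using assms by (auto simp: caputo_regular_def intro!: continuous_intros)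
  assume t: "t > 0"
  have "integral {0..t} (\<lambda>s. (t - s) powr (- q) * deriv (\<lambda>s. f s + g s) s)
      = integral {0..t} (\<lambda>s. (t - s) powr (- q) * (deriv f s) + (t - s) powr (- q) * deriv g s)"
    by (rule integral_spike[of "{0}"]) (simp, simp only: eq)
  also have "\<dots> = integral {0..t} (\<lambda>s. (t - s) powr (- q) * (deriv f s)) +
      integral {0..t} (\<lambda>s. (t - s) powr (- q) * deriv g s)"
    using assms t by (intro integral_add)
      (auto simp: caputo_regular_def caputo_integrable_def absolutely_integrable_on_def)
  finally show "caputo_deriv q (\<lambda>s. f s + g s) t = caputo_deriv q f t + caputo_deriv q g t"
    by (simp add: caputo_deriv_def algebra_simps)
qed

lemma caputo_regular_cmult:
  assumes "caputo_regular q f"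
  shows "caputo_regular q (\<lambda>s. c * f s)"
    and "t > 0 \<Longrightarrow> caputo_deriv q (\<lambda>s. c * f s) t = c * caputo_deriv q f t"
proof -
  have d: "deriv (\<lambda>s. c * f s) s = c * deriv f s" if "s > 0" for s
    using assms that by (intro deriv_cmult) (auto simp: caputo_regular_def field_differentiable_def real_differentiable_def)
  have eq: "c * ((t - s) powr (- q) * (deriv f s))
      = (t - s) powr (- q) * deriv (\<lambda>s. c * f s) s" if "s \<in> {0..t} - {0}" for s t
    using d[of s] that by (simp add: algebra_simps)
  have ai: "(\<lambda>s. c * ((t - s) powr (- q) * (deriv f s)))
      absolutely_integrable_on {0..t}" if "t > 0" for t
    using assms that by (intro set_integrable_mult_right) (auto simp: caputo_regular_def caputo_integrable_def)
  have "caputo_integrable q (\<lambda>s. c * f s) t" if "t > 0" for t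
    unfolding caputo_integrable_def
    by (rule absolutely_integrable_spike[OF ai[OF that], of "{0}"]) (simp, simp only: eq)
  thus "caputo_regular q (\<lambda>s. c * f s)"
    using assms by (auto simp: caputo_regular_def intro!: continuous_intros)
  have "integral {0..t} (\<lambda>s. (t - s) powr (- q) * deriv (\<lambda>s. c * f s) s)
      = integral {0..t} (\<lambda>s. c * ((t - s) powr (- q) * (deriv f s)))"
    by (rule integral_spike[of "{0}"]) (simp, simp only: eq)
  thus "caputo_deriv q (\<lambda>s. c * f s) t = c * caputo_deriv q f t"
    by (simp add: caputo_deriv_def)
qed

lemma caputo_regular_const: "caputo_regular q (\<lambda>s. c)"
  and caputo_deriv_const: "caputo_deriv q (\<lambda>s. c) t = 0"
  by (simp_all add: caputo_regular_def caputo_integrable_def caputo_deriv_def)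

text \<open>Makes the scalar extremum principle applicable to a linear functional of a vector-valued
  function. The induction runs over finite sets of coordinates.\<close>

lemma caputo_regular_inner:
  fixes x :: "real \<Rightarrow> real^'n"
  assumes "\<And>i. caputo_regular q (\<lambda>s. x s $ i)"
  shows "caputo_regular q (\<lambda>s. c \<bullet> x s)"
    and "t > 0 \<Longrightarrow> caputo_deriv q (\<lambda>s. c \<bullet> x s) t = c \<bullet> (\<chi> i. caputo_deriv q (\<lambda>s. x s $ i) t)"
proof -
  have "caputo_regular q (\<lambda>s. \<Sum>i\<in>I. c $ i * x s $ i) \<and>
    (t > 0 \<longrightarrow> caputo_deriv q (\<lambda>s. \<Sum>i\<in>I. c $ i * x s $ i) t =
       (\<Sum>i\<in>I. c $ i * caputo_deriv q (\<lambda>s. x s $ i) t))" if "finite I" for I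
    using that
    by (induction I) (auto simp: caputo_regular_const caputo_deriv_const
       intro!: caputo_regular_add caputo_regular_cmult assms simp: caputo_regular_add(2)[OF caputo_regular_cmult(1)] caputo_regular_cmult(2) assms)
  from this[of UNIV] show "caputo_regular q (\<lambda>s. c \<bullet> x s)"
    and "t > 0 \<Longrightarrow> caputo_deriv q (\<lambda>s. c \<bullet> x s) t = c \<bullet> (\<chi> i. caputo_deriv q (\<lambda>s. x s $ i) t)"
    by (auto simp: inner_vec_def)
qed

section \<open>Explicit Caputo derivatives and first touching times\<close>

lemma powr_kernel_integral:
  assumes q: "0 < q" "q < 1" and t: "0 < (t::real)"
  shows "((\<lambda>s. (t - s) powr (- q)) has_integral t powr (1 - q) / (1 - q)) {0..t}"
proof -
  have "((\<lambda>s. (t - s) powr (- q)) has_integral (- ((t - t) powr (1 - q) / (1 - q)) - - ((t - 0) powr (1 - q) / (1 - q)))) {0..t}"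
  proof (rule fundamental_theorem_of_calculus_interior)
    show "continuous_on {0..t} (\<lambda>s. - ((t - s) powr (1 - q) / (1 - q)))"
      using q by (intro continuous_intros continuous_on_powr') auto
    fix s assume "s \<in> {0<..<t}"
    thus "((\<lambda>s. - ((t - s) powr (1 - q) / (1 - q))) has_vector_derivative (t - s) powr (- q)) (at s)"
      unfolding has_real_derivative_iff_has_vector_derivative[symmetric] using q
      by (auto intro!: derivative_eq_intros)
  qed (use t in auto)
  thus ?thesis by simp
qed

text \<open>The kernel is integrable and the derivative is bounded and measurable on
  \<open>{0..t}\<close>, so their product is absolutely integrable.\<close>

lemma caputo_regular_C1:
  assumes q: "0 < q" "q < 1" and d: "\<And>s. (f has_real_derivative f' s) (at s)"
    and c: "continuous_on UNIV f'"
  shows "caputo_regular q f"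
    and "caputo_deriv q f t = 1 / Gamma (1 - q) * integral {0..t} (\<lambda>s. (t - s) powr (- q) * f' s)"
proof -
  have df: "deriv f = f'" using d by (auto intro!: DERIV_imp_deriv)
  have "caputo_integrable q f t" if t: "t > 0" for t
  proof -
    have "(\<lambda>s. (t - s) powr (- q)) absolutely_integrable_on {0..t}"
      by (rule nonnegative_absolutely_integrable_1) (use powr_kernel_integral[OF q t] in auto)
    moreover have "f' \<in> borel_measurable (lebesgue_on {0..t})"
      by (intro continuous_imp_measurable_on_sets_lebesgue continuous_on_subset[OF c]) auto
    moreover have "bounded (f' ` {0..t})"
      by (intro compact_imp_bounded compact_continuous_image continuous_on_subset[OF c]) auto
    ultimately have "(\<lambda>s. f' s * (t - s) powr (- q)) absolutely_integrable_on {0..t}"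
      by (intro absolutely_integrable_bounded_measurable_product_real) auto
    thus ?thesis by (simp add: caputo_integrable_def df mult.commute)
  qed
  thus "caputo_regular q f"
    using d unfolding caputo_regular_def
    by (auto simp: real_differentiable_def intro!: DERIV_continuous_on intro: has_field_derivative_at_within)
  show "caputo_deriv q f t = 1 / Gamma (1 - q) * integral {0..t} (\<lambda>s. (t - s) powr (- q) * f' s)"
    by (simp add: caputo_deriv_def df)
qed

text \<open>Supplies the derivative of the linear term \<open>K / T * s\<close> added in
  \<open>caputo_convex_lyapunov\<close>.\<close>

lemma caputo_regular_id:
  assumes q: "0 < q" "q < 1"
  shows "caputo_regular q (\<lambda>s. s)"
    and "t > 0 \<Longrightarrow> caputo_deriv q (\<lambda>s. s) t = t powr (1 - q) / ((1 - q) * Gamma (1 - q))"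
  using caputo_regular_C1[OF q, of "\<lambda>s. s" "\<lambda>_. 1"] powr_kernel_integral[OF q, of t]
  by (auto simp: integral_unique)

text \<open>\<open>r\<close> is the infimum of the closed set of times in \<open>{0..t}\<close>
  where f is nonnegative; the limit from the left forces f r = 0. Thus \<open>r\<close> is a maximum
  of f over \<open>{0..r}\<close>, as \<open>caputo_deriv_extremum\<close> requires.\<close>

lemma first_touch:
  fixes f :: "real \<Rightarrow> real"
  assumes c: "continuous_on {0..} f" and f0: "f 0 < 0" and t: "t > 0" "f t > 0"
  obtains r where "0 < r" "r \<le> t" "f r = 0" "\<And>s. 0 \<le> s \<Longrightarrow> s \<le> r \<Longrightarrow> f s \<le> 0"
proof -
  define S where "S = {0..t} \<inter> f -` {0..}"
  have "closed S" unfolding S_def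
    by (intro continuous_closed_preimage continuous_on_subset[OF c]) auto
  moreover have "t \<in> S" using t by (auto simp: S_def)
  hence "S \<noteq> {}" by blast
  moreover have bb: "bdd_below S" by (auto simp: S_def bdd_below_def)
  ultimately have I: "Inf S \<in> S" by (intro closed_contains_Inf)
  have lt: "f s < 0" if "0 \<le> s" "s < Inf S" for s
  proof (rule ccontr)
    assume "\<not> f s < 0"
    hence "s \<in> S" using that I by (auto simp: S_def)
    thus False using cInf_lower[OF _ bb, of s] that by simp
  qed
  have pos: "Inf S > 0" using I f0 by (cases "Inf S = 0") (auto simp: S_def)
  have "(f \<longlongrightarrow> f (Inf S)) (at_left (Inf S))"
  proof -
    have "continuous_on {0..Inf S} f" by (rule continuous_on_subset[OF c]) auto
    hence "(f \<longlongrightarrow> f (Inf S)) (at (Inf S) within {0..Inf S})"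
      using pos by (auto simp: continuous_on_def)
    thus ?thesis using pos by (simp add: at_within_Icc_at_left)
  qed
  hence "f (Inf S) \<le> 0"
    by (rule tendsto_upperbound) (use lt pos in \<open>auto intro!: eventually_at_leftI[of 0] less_imp_le\<close>)
  hence "f (Inf S) = 0" using I by (auto simp: S_def)
  thus ?thesis using that[of "Inf S"] pos lt I by (force simp: S_def)
qed

section \<open>Exponential comparison functions\<close>

text \<open>Euler's integral for Gamma at 1 - q after rescaling the variable by m.\<close>

lemma Gamma_kernel_integral:
  assumes q: "0 < q" "q < 1" and m: "0 < (m::real)"
  shows "(\<lambda>r. r powr (- q) * exp (- m * r)) absolutely_integrable_on {0..}"
    and "integral {0..} (\<lambda>r. r powr (- q) * exp (- m * r)) = Gamma (1 - q) * m powr (q - 1)"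
proof -
  let ?f = "\<lambda>r::real. r powr (- q) * exp (- r)"
  have "(?f has_integral Gamma (1 - q)) {0..}"
    using Gamma_integral_real[of "1 - q"] q by (simp add: exp_minus divide_inverse)
  moreover have img: "(\<lambda>x. m * x) ` {0..} = {0..}"
  proof -
    have "x \<in> (\<lambda>x. m * x) ` {0..}" if "x \<ge> 0" for x
      using that m by (intro image_eqI[of _ _ "x / m"]) auto
    thus ?thesis using m by auto
  qed
  ultimately have "?f absolutely_integrable_on (\<lambda>x. m * x) ` {0..} \<and> integral ((\<lambda>x. m * x) ` {0..}) ?f = Gamma (1 - q)"
    by (auto intro!: nonnegative_absolutely_integrable_1 simp: integral_unique)
  hence *: "(\<lambda>x. \<bar>m\<bar> *\<^sub>R ?f (m * x)) absolutely_integrable_on {0..} \<and> integral {0..} (\<lambda>x. \<bar>m\<bar> *\<^sub>R ?f (m * x)) = Gamma (1 - q)"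
    by (subst has_absolute_integral_change_of_variables_real)
       (use m in \<open>auto intro!: derivative_eq_intros simp: inj_on_def\<close>)
  have eq: "r powr (- q) * exp (- m * r) = m powr (q - 1) * (\<bar>m\<bar> *\<^sub>R ?f (m * r))" if "r \<in> {0..}" for r
    using m that by (simp add: powr_mult powr_diff powr_minus field_simps)
  show "(\<lambda>r. r powr (- q) * exp (- m * r)) absolutely_integrable_on {0..}"
    by (rule absolutely_integrable_spike[where f = "\<lambda>r. m powr (q - 1) * (\<bar>m\<bar> *\<^sub>R ?f (m * r))" and S = "{}"])
       (use * eq in \<open>auto intro!: set_integrable_mult_right\<close>)
  have "integral {0..} (\<lambda>r. r powr (- q) * exp (- m * r)) = m powr (q - 1) * integral {0..} (\<lambda>x. \<bar>m\<bar> *\<^sub>R ?f (m * x))"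
    unfolding integral_mult_right[symmetric] by (rule integral_cong) (rule eq)
  thus "integral {0..} (\<lambda>r. r powr (- q) * exp (- m * r)) = Gamma (1 - q) * m powr (q - 1)"
    using * by simp
qed

text \<open>The integral over \<open>{0..}\<close> is split at t and the tail is shifted back to the
  origin. The bound \<open>T \<le> t powr (- q) / m\<close> comes from monotonicity of the power;
  the last one comes from AM-GM and carries the factor 2^(-q) on which the growth bound
  depends.\<close>

lemma Gamma_kernel_tail:
  assumes q: "0 < q" "q < 1" and m: "0 < (m::real)" and t: "0 < t"
  defines "T \<equiv> integral {0..} (\<lambda>x. (t + x) powr (- q) * exp (- m * x))"
  shows "integral {0..t} (\<lambda>r. r powr (- q) * exp (- m * r)) =
      Gamma (1 - q) * m powr (q - 1) - exp (- m * t) * T" (is ?A)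
    and "0 \<le> T" "T \<le> t powr (- q) / m"
    and "T \<le> 2 powr (- q) / 2 * (t powr (- q) / m + Gamma (1 - q) * m powr (q - 1))"
proof -
  let ?f = "\<lambda>r. r powr (- q) * exp (- m * r)"
  let ?g = "\<lambda>x. (t + x) powr (- q) * exp (- m * x)"
  note f = Gamma_kernel_integral[OF q m]
  have fi: "?f absolutely_integrable_on {0..t}" "?f absolutely_integrable_on {t..}"
    by (rule set_integrable_subset[OF f(1)]; use t in auto)+
  have img: "(\<lambda>x. t + x) ` {0..} = {t..}"
  proof -
    have "x \<in> (\<lambda>x. t + x) ` {0..}" if "x \<ge> t" for x
      using that t by (intro image_eqI[of _ _ "x - t"]) auto
    thus ?thesis using t by auto
  qed
  have "(\<lambda>x. \<bar>1\<bar> *\<^sub>R ?f (t + x)) absolutely_integrable_on {0..} \<and> integral {0..} (\<lambda>x. \<bar>1\<bar> *\<^sub>R ?f (t + x)) = integral {t..} ?f"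
    using fi by (subst has_absolute_integral_change_of_variables_real)
       (use img in \<open>auto intro!: derivative_eq_intros simp: inj_on_def\<close>)
  moreover have "(\<lambda>x. \<bar>1\<bar> *\<^sub>R ?f (t + x)) = (\<lambda>x. exp (- m * t) * ?g x)"
    by (auto simp: exp_diff exp_minus field_simps exp_add)
  ultimately have *: "(\<lambda>x. exp (- m * t) * ?g x) absolutely_integrable_on {0..}" "integral {t..} ?f = exp (- m * t) * T"
    by (auto simp: T_def)
  have "(\<lambda>x. exp (m * t) * (exp (- m * t) * ?g x)) absolutely_integrable_on {0..}"
    using *(1) by (rule set_integrable_mult_right)
  also have "(\<lambda>x. exp (m * t) * (exp (- m * t) * ?g x)) = ?g"
    by (auto simp: exp_minus field_simps)
  finally have gi: "?g integrable_on {0..}" by (simp add: absolutely_integrable_on_def)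
  have "integral ({0..t} \<union> {t..}) ?f = integral {0..t} ?f + integral {t..} ?f"
  proof (rule integral_Un)
    have "{0..t} \<inter> {t..} = {t}" using t by auto
    thus "negligible ({0..t} \<inter> {t..})" by simp
  qed (use fi in \<open>auto simp: absolutely_integrable_on_def\<close>)
  moreover have "{0..t} \<union> {t..} = {0..}" using t by auto
  ultimately show ?A using f(2) *(2) by simp
  have e: "((\<lambda>x. exp (- m * x)) has_integral 1 / m) {0..}"
    using has_integral_exp_minus_to_infinity[OF m, of 0] by simp
  hence e': "((\<lambda>x. t powr (- q) * exp (- m * x)) has_integral t powr (- q) * (1 / m)) {0..}"
    by (rule has_integral_mult_right)
  show "0 \<le> T" unfolding T_def by (intro integral_nonneg gi) auto
  have "T \<le> t powr (- q) * (1 / m)"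
    unfolding T_def
    by (rule has_integral_le[OF integrable_integral[OF gi] e']) (use t q in \<open>auto intro!: powr_mono2'\<close>)
  thus "T \<le> t powr (- q) / m" by simp
  have fi0: "(?f has_integral Gamma (1 - q) * m powr (q - 1)) {0..}"
    using f by (metis absolutely_integrable_on_def has_integral_integral)
  \<comment> \<open>AM-GM twice: t + x is at least twice the geometric mean of t and x, and the
    geometric mean of t^(-q) and x^(-q) is at most their arithmetic mean.\<close>
  have amgm: "(t + x) powr (- q) \<le> 2 powr (- q) / 2 * (t powr (- q) + x powr (- q))" if "x > 0" for x
  proof -
    have "2 * sqrt (t * x) \<le> t + x" using arith_geo_mean_sqrt[of t x] t that by simp
    hence "(t + x) powr (- q) \<le> (2 * sqrt (t * x)) powr (- q)"
      using t that q by (intro powr_mono2') auto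
    also have "\<dots> = 2 powr (- q) * sqrt (t powr (- q) * x powr (- q))"
      using t that by (simp add: powr_mult powr_half_sqrt[symmetric] powr_powr real_sqrt_mult mult.commute)
    also have "sqrt (t powr (- q) * x powr (- q)) \<le> (t powr (- q) + x powr (- q)) / 2"
      by (rule arith_geo_mean_sqrt) auto
    finally show ?thesis by (simp add: mult_left_mono)
  qed
  have "T \<le> 2 powr (- q) / 2 * (t powr (- q) * (1 / m) + Gamma (1 - q) * m powr (q - 1))"
    
  proof (rule has_integral_le)
    \<comment> \<open>The point x = 0 is removed because \<open>0 powr (- q)\<close> is 0, where the
      AM-GM bound fails.\<close>
    show "(?g has_integral T) {0<..}" unfolding T_def
      by (rule has_integral_spike_set_eq[THEN iffD1, OF _ _ integrable_integral[OF gi]])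
        (auto intro: negligible_subset[of "{0}"])
    have "((\<lambda>x. 2 powr (- q) / 2 * (t powr (- q) * exp (- m * x) + ?f x)) has_integral
      2 powr (- q) / 2 * (t powr (- q) * (1 / m) + Gamma (1 - q) * m powr (q - 1))) {0..}"
      by (intro has_integral_mult_right has_integral_add e' fi0)
    thus "((\<lambda>x. 2 powr (- q) / 2 * (t powr (- q) * exp (- m * x) + ?f x)) has_integral
      2 powr (- q) / 2 * (t powr (- q) * (1 / m) + Gamma (1 - q) * m powr (q - 1))) {0<..}"
      by (rule has_integral_spike_set_eq[THEN iffD1, rotated 2]) (auto intro: negligible_subset[of "{0}"])
  next
    fix x :: real assume "x \<in> {0<..}"
    thus "?g x \<le> 2 powr (- q) / 2 * (t powr (- q) * exp (- m * x) + ?f x)"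
      using mult_right_mono[OF amgm, of x "exp (- m * x)"] by (simp add: algebra_simps)
  qed
  thus "T \<le> 2 powr (- q) / 2 * (t powr (- q) / m + Gamma (1 - q) * m powr (q - 1))" by simp
qed

text \<open>Reversing time in the Caputo integral gives m e^(mt) times an incomplete Gamma integral.
  The derivative is therefore m^q e^(mt) minus m T / Gamma(1 - q), where T is the tail of
  \<open>Gamma_kernel_tail\<close>; the three estimates are those of T.\<close>

lemma caputo_deriv_exp:
  assumes q: "0 < q" "q < 1" and m: "0 < (m::real)"
  shows "caputo_regular q (\<lambda>s. exp (m * s))"
    and "t > 0 \<Longrightarrow> caputo_deriv q (\<lambda>s. exp (m * s)) t \<le> m powr q * exp (m * t)"
    and "t > 0 \<Longrightarrow> m powr q * exp (m * t) - t powr (- q) / Gamma (1 - q)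
           \<le> caputo_deriv q (\<lambda>s. exp (m * s)) t"
    and "t > 0 \<Longrightarrow> m powr q * exp (m * t) -
           2 powr (- q) / 2 * (t powr (- q) / Gamma (1 - q) + m powr q)
           \<le> caputo_deriv q (\<lambda>s. exp (m * s)) t"
proof -
  have Gpos: "Gamma (1 - q) > 0" using q by (intro Gamma_real_pos) auto
  have d: "((\<lambda>s. exp (m * s)) has_real_derivative m * exp (m * s)) (at s)" for s
    by (auto intro!: derivative_eq_intros)
  note C = caputo_regular_C1[OF q d, OF continuous_on_mult_left, OF continuous_on_exp, OF continuous_on_mult_left, OF continuous_on_id]
  show "caputo_regular q (\<lambda>s. exp (m * s))" by (rule C)
  define T where "T = integral {0..} (\<lambda>x. (t + x) powr (- q) * exp (- m * x))"
  have mp: "m * m powr (q - 1) = m powr q" using m by (simp add: powr_diff)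
  have D: "caputo_deriv q (\<lambda>s. exp (m * s)) t = m powr q * exp (m * t) - m * T / Gamma (1 - q)"
    if t: "t > 0"
  proof -
    let ?f = "\<lambda>r. r powr (- q) * exp (- m * r)"
    have "?f absolutely_integrable_on {0..t}"
      by (rule set_integrable_subset[OF Gamma_kernel_integral(1)[OF q m]]) auto
    hence "(?f has_integral integral {0..t} ?f) {0..t}"
      by (simp add: absolutely_integrable_on_def integrable_integral)
    hence "((\<lambda>r. ?f (- r)) has_integral integral {0..t} ?f) {- t..0}"
      using has_integral_reflect_real[of ?f "integral {0..t} ?f" t 0] by simp
    hence "((\<lambda>s. (t - s) powr (- q) * exp (- m * (t - s))) has_integral integral {0..t} ?f) {0..t}"
      using has_integral_shift_Icc_real[of "\<lambda>r. ?f (- r)" "- t" "integral {0..t} ?f" 0 t] by (simp add: o_def algebra_simps)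
    hence "((\<lambda>s. m * exp (m * t) * ((t - s) powr (- q) * exp (- m * (t - s)))) has_integral
        m * exp (m * t) * integral {0..t} (\<lambda>r. r powr (- q) * exp (- m * r))) {0..t}"
      by (rule has_integral_mult_right)
    also have "(\<lambda>s. m * exp (m * t) * ((t - s) powr (- q) * exp (- m * (t - s))))
        = (\<lambda>s. (t - s) powr (- q) * (m * exp (m * s)))"
      by (auto simp: algebra_simps exp_diff exp_minus)
    finally have "caputo_deriv q (\<lambda>s. exp (m * s)) t =
       1 / Gamma (1 - q) * (m * exp (m * t) * integral {0..t} (\<lambda>r. r powr (- q) * exp (- m * r)))"
      unfolding C(2) by (simp add: integral_unique)
    also have "\<dots> = m * m powr (q - 1) * exp (m * t) - m * T / Gamma (1 - q)"
      unfolding Gamma_kernel_tail(1)[OF q m t] T_def[symmetric] using Gpos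
      by (simp add: field_simps exp_minus)
    finally show ?thesis using mp by simp
  qed
  assume t: "t > 0"
  note TT = Gamma_kernel_tail(2-4)[OF q m t, folded T_def]
  show "caputo_deriv q (\<lambda>s. exp (m * s)) t \<le> m powr q * exp (m * t)"
    using D[OF t] TT(1) Gpos m by simp
  show "m powr q * exp (m * t) - t powr (- q) / Gamma (1 - q) \<le> caputo_deriv q (\<lambda>s. exp (m * s)) t"
    using D[OF t] TT(2) Gpos m by (simp add: field_simps)
  have "m * T / Gamma (1 - q) \<le> m * (2 powr (- q) / 2 * (t powr (- q) / m + Gamma (1 - q) * m powr (q - 1))) / Gamma (1 - q)"
    using TT(3) Gpos m by (intro divide_right_mono mult_left_mono) auto
  also have "\<dots> = 2 powr (- q) / 2 * (t powr (- q) / Gamma (1 - q) + m * m powr (q - 1))"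
    using Gpos m by (simp add: field_simps)
  finally show "m powr q * exp (m * t) -
           2 powr (- q) / 2 * (t powr (- q) / Gamma (1 - q) + m powr q)
           \<le> caputo_deriv q (\<lambda>s. exp (m * s)) t"
    using D[OF t] mp by simp
qed

section \<open>A growth bound with the exact exponent\<close>

text \<open>The solution C of \<open>C * 2 powr (- q) / 2 = C / 2 - 1\<close>, the balance that
  closes the comparison in \<open>caputo_growth_bound\<close>.\<close>

definition growth_const :: "real \<Rightarrow> real" where
  "growth_const q = 2 / (1 - 2 powr (- q))"

lemma growth_const: "0 < q \<Longrightarrow> 2 < growth_const q"
  "0 < q \<Longrightarrow> growth_const q * 2 powr (-q) / 2 = growth_const q / 2 - 1"
proof -
  assume "0 < q"
  hence "2 powr (-q) < (1::real)" by (intro powr_less_one) auto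
  then show "2 < growth_const q"  "growth_const q * 2 powr (-q) / 2 = growth_const q / 2 - 1"
    unfolding growth_const_def by (simp_all only: divide_simps) auto
qed

text \<open>
  The supersolution is \<open>C e\<^sup>m\<^sup>t - C/2\<close>. The defect \<open>m\<^sup>q e\<^sup>m\<^sup>t - D\<^sup>q e\<^sup>m\<^sup>t\<close> is absorbed
  partly by the constant and partly by the gap at \<open>t = 0\<close>, which the extremum principle
  turns into a multiple of \<open>t\<^sup>-\<^sup>q\<close>; the factor \<open>2\<^sup>-\<^sup>q < 1\<close> from AM-GM leaves room for this.
\<close>

lemma caputo_growth_bound:
  fixes x :: "real \<Rightarrow> real^'n"
  assumes q: "0 < q" "q < 1" and k: "0 < k" and \<delta>: "0 < \<delta>"
    and reg: "\<And>i. caputo_regular q (\<lambda>s. x s $ i)"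
    and diss: "\<And>t. t > 0 \<Longrightarrow> x t \<bullet> (\<chi> i. caputo_deriv q (\<lambda>s. x s $ i) t) \<le> k * (norm (x t))\<^sup>2"
    and x0: "norm (x 0) \<le> \<delta>" and t: "0 \<le> t"
  shows "norm (x t) \<le> growth_const q * \<delta> * exp (k powr (1 / q) * t)"
proof -
  define m where "m = k powr (1 / q)"
  define C where "C = growth_const q"
  define w where "w = (\<lambda>s. C * exp (m * s) + - (C / 2))"
  have mpos: "m > 0" and mq: "m powr q = k" using k q by (auto simp: m_def powr_powr)
  have C2: "C > 2" and Cq: "C * 2 powr (-q) / 2 = C / 2 - 1"
    using growth_const q by (auto simp: C_def)
  have Gpos: "Gamma (1 - q) > 0" using q by (intro Gamma_real_pos) auto
  have cx: "continuous_on {0..} x"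
    using reg unfolding caputo_regular_def by (intro continuous_on_vec_lambda[of "{0..}" "\<lambda>i s. x s $ i", simplified]) auto
  have ereg: "caputo_regular q (\<lambda>s. exp (m * s))" by (rule caputo_deriv_exp[OF q mpos])
  have wreg: "caputo_regular q w" unfolding w_def
    by (intro caputo_regular_add caputo_regular_cmult caputo_regular_const ereg)
  have wD: "caputo_deriv q w r = C * caputo_deriv q (\<lambda>s. exp (m * s)) r" if "r > 0" for r
    unfolding w_def using that
    by (simp only: caputo_regular_add(2)[OF caputo_regular_cmult(1)[OF ereg] caputo_regular_const]
       caputo_regular_cmult(2)[OF ereg] caputo_deriv_const)
  have "norm (x t) \<le> \<delta> * w t"
  proof (rule ccontr)
    define f where "f = (\<lambda>s. norm (x s) - \<delta> * w s)"
    assume "\<not> norm (x t) \<le> \<delta> * w t"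
    hence ft: "f t > 0" by (simp add: f_def)
    have "\<delta> * 1 < \<delta> * w 0" using \<delta> C2 by (intro mult_strict_left_mono) (auto simp: w_def)
    hence f0: "f 0 < 0" using x0 by (simp add: f_def)
    with ft t have "t > 0" by (cases "t = 0") auto
    moreover have "continuous_on {0..} f" unfolding f_def w_def
      by (intro continuous_intros cx)
    ultimately obtain r where r: "0 < r" "f r = 0" "\<And>s. 0 \<le> s \<Longrightarrow> s \<le> r \<Longrightarrow> f s \<le> 0"
      using first_touch[of f t] f0 ft by metis
    have "C * 1 < C * exp (m * r)" using C2 mpos r(1) by (intro mult_strict_left_mono) auto
    hence wr: "w r > 0" unfolding w_def using C2 by linarith
    have kw: "k * w r = C * (k * exp (m * r)) - k * (C / 2)" by (simp add: w_def algebra_simps)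
    have xr: "norm (x r) = \<delta> * w r" using r(2) by (simp add: f_def)
    hence xpos: "norm (x r) > 0" using wr \<delta> by simp
    define c where "c = (1 / norm (x r)) *\<^sub>R x r"
    have nc: "norm c = 1" using xpos by (simp add: c_def)
    \<comment> \<open>With c the unit vector along x r, the inner product replaces the norm: h is
      linear in the components of x, lies below f, and equals f at r. So h is maximal at r.\<close>
    define h where "h = (\<lambda>s. c \<bullet> x s + (- \<delta>) * w s)"
    have hreg: "caputo_regular q h" unfolding h_def
      by (intro caputo_regular_add caputo_regular_inner caputo_regular_cmult reg wreg)
    have hf: "h s \<le> f s" for s using norm_cauchy_schwarz[of c "x s"] nc by (simp add: h_def f_def)
    have hr: "h r = 0"
      using xr xpos by (simp add: h_def c_def power2_norm_eq_inner[symmetric] power2_eq_square)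
    have "r powr (- q) / Gamma (1 - q) * (h r - h 0) \<le> caputo_deriv q h r"
      by (rule caputo_deriv_extremum[OF q r(1) hreg]) (metis hf hr r(3) order_trans)
    moreover have "h 0 \<le> \<delta> - \<delta> * (C / 2)"
      using norm_cauchy_schwarz[of c "x 0"] nc x0 by (simp add: h_def w_def)
    hence "r powr (- q) / Gamma (1 - q) * (\<delta> * (C / 2 - 1)) \<le> r powr (- q) / Gamma (1 - q) * (h r - h 0)"
      using Gpos hr by (intro mult_left_mono) (auto simp: algebra_simps)
    moreover have "caputo_deriv q h r = c \<bullet> (\<chi> i. caputo_deriv q (\<lambda>s. x s $ i) r) - \<delta> * caputo_deriv q w r"
      unfolding h_def
      by (simp only: caputo_regular_add(2)[OF caputo_regular_inner(1)[OF reg] caputo_regular_cmult(1)[OF wreg] r(1)]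
          caputo_regular_inner(2)[OF reg r(1)] caputo_regular_cmult(2)[OF wreg r(1)])
    moreover have "c \<bullet> (\<chi> i. caputo_deriv q (\<lambda>s. x s $ i) r) \<le> k * norm (x r)"
      using diss[OF r(1)] xpos by (simp add: c_def field_simps power2_eq_square)
    moreover have "C * (k * exp (m * r) - 2 powr (- q) / 2 * (r powr (- q) / Gamma (1 - q) + k)) \<le> caputo_deriv q w r"
      unfolding wD[OF r(1)] using caputo_deriv_exp(4)[OF q mpos r(1)] mq C2 by (intro mult_left_mono) auto
    hence "k * w r + k * (C / 2) - (C * 2 powr (- q) / 2) * (r powr (- q) / Gamma (1 - q) + k) \<le> caputo_deriv q w r"
      by (simp only: kw) (simp add: algebra_simps add_divide_distrib)
    hence "k * w r + k - (C / 2 - 1) * (r powr (- q) / Gamma (1 - q)) \<le> caputo_deriv q w r"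
      unfolding Cq by (simp add: algebra_simps)
    hence "\<delta> * (k * w r + k - (C / 2 - 1) * (r powr (- q) / Gamma (1 - q))) \<le> \<delta> * caputo_deriv q w r"
      using \<delta> by (intro mult_left_mono) auto
    \<comment> \<open>The gap at time 0 and the defect of the exponential contribute the same
      multiple C/2 - 1 of r^(-q) / Gamma(1 - q); these terms cancel.\<close>
    ultimately have "\<delta> * k \<le> 0" unfolding xr by (simp add: algebra_simps)
    thus False using \<delta> k by (simp add: mult_le_0_iff)
  qed
  also have "\<dots> \<le> \<delta> * (C * exp (m * t))" using \<delta> C2 by (intro mult_left_mono) (auto simp: w_def)
  finally show ?thesis by (simp add: C_def m_def mult_ac)
qed

section \<open>Asymptotic stability\<close>

lemma caputo_solution_regular:
  assumes "caputo_solution q F x"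
  shows "caputo_regular q (\<lambda>s. x s $ i)"
    and "t > 0 \<Longrightarrow> (\<chi> i. caputo_deriv q (\<lambda>s. x s $ i) t) = F (x t)"
  using assms by (auto simp: caputo_solution_def caputo_regular_def vec_eq_iff intro!: continuous_intros)

lemma caputo_solution_inner:
  assumes "caputo_solution q F x"
  shows "caputo_regular q (\<lambda>s. c \<bullet> x s)"
    and "t > 0 \<Longrightarrow> caputo_deriv q (\<lambda>s. c \<bullet> x s) t = c \<bullet> F (x t)"
  using caputo_regular_inner[of q x] caputo_solution_regular[OF assms] by auto

text \<open>Let r maximise V (x s) + K s / T over \<open>{0..T}\<close>. If r = 0, the first
  alternative holds. Otherwise the subgradient inequality makes the linear function G (x r)
  \<bullet> x s + K s / T maximal at r over \<open>{0..r}\<close> too, and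
  \<open>caputo_deriv_extremum\<close> applies to it.\<close>

lemma caputo_convex_lyapunov:
  fixes x :: "real \<Rightarrow> real^'n" and V :: "real^'n \<Rightarrow> real"
  assumes q: "0 < q" "q < 1" and sol: "caputo_solution q F x"
    and conv: "\<And>y z. V z + G z \<bullet> (y - z) \<le> V y" and contV: "continuous_on UNIV V"
    and K: "0 \<le> K" and T: "0 < T"
  obtains "V (x T) \<le> V (x 0) - K"
  | r where "0 < r" "r \<le> T" "V (x T) \<le> V (x r)" "0 \<le> V (x r) - V (x 0) + K / T * r"
      "r powr (- q) / Gamma (1 - q) * (V (x r) - V (x 0) + K / T * r)
        \<le> G (x r) \<bullet> F (x r) + K / T * (r powr (1 - q) / ((1 - q) * Gamma (1 - q)))"
proof -
  have cx: "continuous_on {0..T} x"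
    using sol by (auto simp: caputo_solution_def intro: continuous_on_subset)
  have "continuous_on {0..T} (\<lambda>s. V (x s) + K / T * s)"
    by (intro continuous_intros continuous_on_compose2[OF contV cx]) auto
  then obtain r where r: "0 \<le> r" "r \<le> T"
    and mx: "\<And>s. 0 \<le> s \<Longrightarrow> s \<le> T \<Longrightarrow> V (x s) + K / T * s \<le> V (x r) + K / T * r"
    using continuous_attains_sup[of "{0..T}" "\<lambda>s. V (x s) + K / T * s"] T by auto
  have mT: "V (x T) + K \<le> V (x r) + K / T * r" using mx[of T] T by simp
  show thesis
  proof (cases "r = 0")
    case True
    thus thesis using that(1) mT by simp
  next
    case False
    hence r0: "0 < r" using r by simp
    define h where "h = (\<lambda>s. G (x r) \<bullet> x s + K / T * s)"
    have hreg: "caputo_regular q h" unfolding h_def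
      by (intro caputo_regular_add caputo_regular_cmult caputo_solution_inner[OF sol] caputo_regular_id q)
    have hD: "caputo_deriv q h r = G (x r) \<bullet> F (x r) + K / T * (r powr (1 - q) / ((1 - q) * Gamma (1 - q)))"
      unfolding h_def
      by (simp only: caputo_regular_add(2)[OF caputo_solution_inner(1)[OF sol] caputo_regular_cmult(1)[OF caputo_regular_id(1)[OF q]] r0]
          caputo_solution_inner(2)[OF sol r0] caputo_regular_cmult(2)[OF caputo_regular_id(1)[OF q] r0] caputo_regular_id(2)[OF q r0])
    have hh: "V (x r) + K / T * r - (V (x s) + K / T * s) \<le> h r - h s" for s
      using conv[of "x r" "x s"] by (simp add: h_def inner_diff_right)
    have "r powr (- q) / Gamma (1 - q) * (h r - h 0) \<le> caputo_deriv q h r"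
      by (rule caputo_deriv_extremum[OF q r0 hreg]) (use hh mx r in \<open>smt (verit)\<close>)
    moreover have "r powr (- q) / Gamma (1 - q) * (V (x r) - V (x 0) + K / T * r)
        \<le> r powr (- q) / Gamma (1 - q) * (h r - h 0)"
      using hh[of 0] q by (intro mult_left_mono divide_nonneg_nonneg Gamma_real_nonneg) auto
    moreover have "K / T * r \<le> K" using r K T by (simp add: field_simps mult_left_mono)
    ultimately show thesis using that(2)[OF r0 r(2)] mT mx[of 0] T hD by auto
  qed
qed

section \<open>Energy identity and Lyapunov function of the Stokes field\<close>

text \<open>The coefficients of the cubic monomial sum to zero, and the terms in b1 and b3 are
  skew.\<close>

lemma stokes_energy:
  "u \<bullet> stokes_field l1 l2 l3 b1 b3 k u = k * ((u$1)\<^sup>2 + (u$3)\<^sup>2)"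
  by (simp add: stokes_field_def inner_vec_def sum_3 power2_eq_square algebra_simps)

lemma norm_vec3: "(norm (u::real^3))\<^sup>2 = (u$1)\<^sup>2 + (u$2)\<^sup>2 + (u$3)\<^sup>2"
  unfolding power2_norm_eq_inner inner_vec_def sum_3 by (simp add: power2_eq_square)

text \<open>\<open>caputo_convex_lyapunov\<close> with V = |u|^2, G = 2 u and K = 0, the last fixed
  by \<open>order_refl\<close>. Exceeding the initial norm would make the left side of its
  inequality positive, while the energy identity makes the right side nonpositive.\<close>

lemma stokes_norm_nonincreasing:
  assumes q: "0 < q" "q < 1" and k: "k < 0"
    and sol: "caputo_solution q (stokes_field l1 l2 l3 b1 b3 k) x" and T: "0 < T"
  shows "norm (x T) \<le> norm (x 0)"
proof (rule ccontr)
  assume *: "\<not> norm (x T) \<le> norm (x 0)"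
  have conv: "(norm z)\<^sup>2 + (2 *\<^sub>R z) \<bullet> (y - z) \<le> (norm y)\<^sup>2" for y z :: "real^3"
    using inner_ge_zero[of "y - z"] by (simp add: power2_norm_eq_inner inner_diff_left inner_diff_right inner_commute)
  have lt: "(norm (x 0))\<^sup>2 < (norm (x T))\<^sup>2" using * by (intro power_strict_mono) auto
  have "continuous_on UNIV (\<lambda>u::real^3. (norm u)\<^sup>2)" by (intro continuous_intros)
  from q sol conv this order_refl T show False
  proof (cases rule: caputo_convex_lyapunov)
    case 1
    thus False using lt by linarith
  next
    case (2 r)
    have "0 < r powr (- q) / Gamma (1 - q) * ((norm (x r))\<^sup>2 - (norm (x 0))\<^sup>2)"
      using 2(1) order_less_le_trans[OF lt 2(3)] q by (intro mult_pos_pos divide_pos_pos Gamma_real_pos) auto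
    also have "\<dots> \<le> 2 * (k * ((x r$1)\<^sup>2 + (x r$3)\<^sup>2))" using 2(5) by (simp add: stokes_energy)
    also have "\<dots> \<le> 0" using k by (simp add: mult_nonpos_nonneg)
    finally show False by simp
  qed
qed

text \<open>The vector is the gradient of |u|^2 + 2 e u2 z with z = b3 u1 - b1 u3. The energy alone
  dissipates only u1 and u3; the linear part of D^q z is k z - B u2 with B = b1^2 + b3^2, so the
  cross term adds -2 e B u2^2.\<close>

lemma stokes_lyapunov:
  assumes k: "k < 0" and b: "b1 \<noteq> 0"
  obtains e c \<eta> where "0 < e" "0 < c" "0 < \<eta>" "e * (1 + b1\<^sup>2 + b3\<^sup>2) \<le> 1 / 2"
    "\<And>u. norm u \<le> \<eta> \<Longrightarrow>
       (vector [2 * u$1 + 2 * e * b3 * u$2, 2 * u$2 + 2 * e * (b3 * u$1 - b1 * u$3), 2 * u$3 - 2 * e * b1 * u$2] :: real^3)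
         \<bullet> stokes_field l1 l2 l3 b1 b3 k u \<le> - c * (norm u)\<^sup>2"
proof -
  define B where "B = b1\<^sup>2 + b3\<^sup>2"
  have B: "B > 0" using b by (simp add: B_def sum_power2_gt_zero_iff)
  \<comment> \<open>The first entry keeps the cross term below half of |u|^2. The second lets the
    damping in u1 and u3 absorb what the cross term adds there.\<close>
  define e where "e = min (1 / (2 * (1 + B))) (\<bar>k\<bar> / (2 * B + k\<^sup>2))"
  have den: "2 * B + k\<^sup>2 > 0" using B by (intro add_pos_nonneg) auto
  hence "\<bar>k\<bar> / (2 * B + k\<^sup>2) > 0" using k by (intro divide_pos_pos) auto
  hence e: "e > 0" using B by (simp add: e_def)
  have "e \<le> 1 / (2 * (1 + B))" by (simp add: e_def)
  hence e1: "e * (1 + B) \<le> 1 / 2" using B by (simp add: field_simps)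
  have "e \<le> (- k) / (2 * B + k\<^sup>2)" using k by (simp add: e_def)
  with den have e2: "e * (2 * B + k\<^sup>2) \<le> - k" using pos_le_divide_eq by blast
  define c0 where "c0 = min (- k) (e * B)"
  have c0: "c0 > 0" using e B k by (simp add: c0_def)
  define Q where "Q = \<bar>b3 * (l2 - l3)\<bar> + \<bar>b1 * (l1 - l2)\<bar> + \<bar>b3 * (l3 - l1)\<bar> + \<bar>b1 * (l3 - l1)\<bar>"
  have Q: "Q \<ge> 0" by (simp add: Q_def)
  \<comment> \<open>Radius at which the cubic remainder 2 e C uses up at most half of the
    dissipation c0 |u|^2.\<close>
  define \<eta> where "\<eta> = c0 / (4 * e * (Q + 1))"
  have \<eta>: "\<eta> > 0" using c0 e Q by (simp add: \<eta>_def)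
  show thesis
  proof (rule that[OF e _ \<eta>])
    show "0 < c0 / 2" using c0 by simp
    show "e * (1 + b1\<^sup>2 + b3\<^sup>2) \<le> 1 / 2" using e1 by (simp add: B_def add_ac)
    fix u :: "real^3" assume u: "norm u \<le> \<eta>"
    define a1 a2 a3 where "a1 = u$1" and "a2 = u$2" and "a3 = u$3"
    define z where "z = b3 * a1 - b1 * a3"
    define C where "C = a2 * (b3 * (l2 - l3) * a2 * a3 - b1 * (l1 - l2) * a1 * a2) + z * (l3 - l1) * a1 * a3"
    define n where "n = norm u"
    have n: "0 \<le> n" by (simp add: n_def)
    have comp: "\<bar>a1\<bar> \<le> n" "\<bar>a2\<bar> \<le> n" "\<bar>a3\<bar> \<le> n"
      unfolding a1_def a2_def a3_def n_def by (rule component_le_norm_cart)+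
    have eq: "(vector [2 * u$1 + 2 * e * b3 * u$2, 2 * u$2 + 2 * e * (b3 * u$1 - b1 * u$3), 2 * u$3 - 2 * e * b1 * u$2] :: real^3)
         \<bullet> stokes_field l1 l2 l3 b1 b3 k u
       = 2 * k * (a1\<^sup>2 + a3\<^sup>2) + 2 * e * z\<^sup>2 + 2 * e * (k * a2 * z - B * a2\<^sup>2) + 2 * e * C"
      by (simp add: stokes_field_def inner_vec_def sum_3 z_def C_def B_def a1_def a2_def a3_def power2_eq_square algebra_simps)
    have p2: "\<bar>x * y\<bar> \<le> n\<^sup>2" if "\<bar>x\<bar> \<le> n" "\<bar>y\<bar> \<le> n" for x y
      unfolding abs_mult power2_eq_square using that n by (intro mult_mono) auto
    have p3: "\<bar>w * (x * y * v)\<bar> \<le> \<bar>w\<bar> * (n\<^sup>2 * n)" if "\<bar>x\<bar> \<le> n" "\<bar>y\<bar> \<le> n" "\<bar>v\<bar> \<le> n" for w x y v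
      using p2[OF that(1,2)] that(3) n unfolding abs_mult[of w] abs_mult[of "x * y"]
      by (intro mult_left_mono mult_mono) auto
    have "C = b3 * (l2 - l3) * (a2 * a2 * a3) + (- (b1 * (l1 - l2))) * (a1 * a2 * a2)
        + (b3 * (l3 - l1)) * (a1 * a1 * a3) + (- (b1 * (l3 - l1))) * (a1 * a3 * a3)"
      by (simp add: C_def z_def algebra_simps)
    also have "\<dots> \<le> \<bar>b3 * (l2 - l3)\<bar> * (n\<^sup>2 * n) + \<bar>- (b1 * (l1 - l2))\<bar> * (n\<^sup>2 * n)
       + \<bar>b3 * (l3 - l1)\<bar> * (n\<^sup>2 * n) + \<bar>- (b1 * (l3 - l1))\<bar> * (n\<^sup>2 * n)"
      by (intro add_mono order_trans[OF abs_ge_self p3] comp)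
    also have "\<dots> = Q * n * n\<^sup>2" unfolding Q_def abs_minus_cancel by algebra
    also have "\<dots> \<le> Q * \<eta> * n\<^sup>2" using u Q \<eta> by (intro mult_mono mult_left_mono) (auto simp: n_def)
    finally have "2 * e * C \<le> 2 * e * (Q * \<eta>) * n\<^sup>2" using e by simp
    also have "2 * e * (Q * \<eta>) \<le> 2 * e * ((Q + 1) * \<eta>)" using e \<eta> by (intro mult_left_mono) auto
    also have "\<dots> = (4 * e * (Q + 1) * \<eta>) / 2" by simp
    also have "4 * e * (Q + 1) * \<eta> = c0" using e Q by (simp add: \<eta>_def)
    finally have C: "2 * e * C \<le> c0 / 2 * n\<^sup>2" by (simp add: mult_right_mono)
    have "B * (a1\<^sup>2 + a3\<^sup>2) - z\<^sup>2 = (b1 * a1 + b3 * a3)\<^sup>2" by (simp add: B_def z_def power2_eq_square algebra_simps)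
    hence z2: "z\<^sup>2 \<le> B * (a1\<^sup>2 + a3\<^sup>2)" by (smt (verit) zero_le_power2)
    \<comment> \<open>Young's inequality for the mixed term k a2 z, weighted so that the bound z^2
      \<le> B (a1^2 + a3^2) leaves a common factor B to cancel.\<close>
    have "0 \<le> (B * a2 - k * z)\<^sup>2" by simp
    hence "B * (2 * (k * a2 * z)) \<le> B * (B * a2\<^sup>2) + k\<^sup>2 * z\<^sup>2" by (simp add: power2_eq_square algebra_simps)
    also have "\<dots> \<le> B * (B * a2\<^sup>2) + k\<^sup>2 * (B * (a1\<^sup>2 + a3\<^sup>2))" using z2 by (intro add_left_mono mult_left_mono) auto
    also have "\<dots> = B * (B * a2\<^sup>2 + k\<^sup>2 * (a1\<^sup>2 + a3\<^sup>2))" by (simp add: algebra_simps)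
    finally have "2 * (k * a2 * z) \<le> B * a2\<^sup>2 + k\<^sup>2 * (a1\<^sup>2 + a3\<^sup>2)" using B by simp
    hence kz: "e * (2 * (k * a2 * z)) \<le> e * (B * a2\<^sup>2 + k\<^sup>2 * (a1\<^sup>2 + a3\<^sup>2))" using e by (intro mult_left_mono) auto
    have ez: "2 * e * z\<^sup>2 \<le> 2 * e * (B * (a1\<^sup>2 + a3\<^sup>2))" using e z2 by (intro mult_left_mono) auto
    have ea: "e * (2 * B + k\<^sup>2) * (a1\<^sup>2 + a3\<^sup>2) \<le> - k * (a1\<^sup>2 + a3\<^sup>2)" using e2 by (intro mult_right_mono) auto
    have "c0 * n\<^sup>2 = c0 * (a1\<^sup>2 + a3\<^sup>2) + c0 * a2\<^sup>2"
      by (simp add: n_def norm_vec3 a1_def a2_def a3_def algebra_simps)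
    also have "\<dots> \<le> (- k) * (a1\<^sup>2 + a3\<^sup>2) + e * B * a2\<^sup>2"
      by (intro add_mono mult_right_mono) (auto simp: c0_def)
    finally have "c0 * n\<^sup>2 \<le> (- k) * (a1\<^sup>2 + a3\<^sup>2) + e * B * a2\<^sup>2" .
    with kz ez ea C show "(vector [2 * u$1 + 2 * e * b3 * u$2, 2 * u$2 + 2 * e * (b3 * u$1 - b1 * u$3), 2 * u$3 - 2 * e * b1 * u$2] :: real^3)
         \<bullet> stokes_field l1 l2 l3 b1 b3 k u \<le> - (c0 / 2) * (norm u)\<^sup>2"
      unfolding eq n_def[symmetric] by (simp add: algebra_simps)
  qed
qed

theorem stokes_asymptotically_stable:
  assumes q: "0 < q" "q < 1" and k: "k < 0" and b: "b1 \<noteq> 0"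
  shows "caputo_asymptotically_stable q (stokes_field l1 l2 l3 b1 b3 k) 0"
proof -
  let ?F = "stokes_field l1 l2 l3 b1 b3 k"
  obtain e c \<eta> where e: "0 < e" "0 < c" "0 < \<eta>" "e * (1 + b1\<^sup>2 + b3\<^sup>2) \<le> 1 / 2"
    and lyap: "\<And>u. norm u \<le> \<eta> \<Longrightarrow>
       (vector [2 * u$1 + 2 * e * b3 * u$2, 2 * u$2 + 2 * e * (b3 * u$1 - b1 * u$3), 2 * u$3 - 2 * e * b1 * u$2] :: real^3)
         \<bullet> ?F u \<le> - c * (norm u)\<^sup>2"
    using stokes_lyapunov[OF k b, of b3 l1 l2 l3] by metis
  define V where "V = (\<lambda>u::real^3. (norm u)\<^sup>2 + 2 * e * u$2 * (b3 * u$1 - b1 * u$3))"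
  define G where "G = (\<lambda>u::real^3. vector [2 * u$1 + 2 * e * b3 * u$2, 2 * u$2 + 2 * e * (b3 * u$1 - b1 * u$3), 2 * u$3 - 2 * e * b1 * u$2] :: real^3)"
  have cross: "\<bar>2 * e * u$2 * (b3 * u$1 - b1 * u$3)\<bar> \<le> 1 / 2 * (norm u)\<^sup>2" for u :: "real^3"
  proof -
    define z where "z = b3 * u$1 - b1 * u$3"
    have "(b1\<^sup>2 + b3\<^sup>2) * ((u$1)\<^sup>2 + (u$3)\<^sup>2) - z\<^sup>2 = (b1 * u$1 + b3 * u$3)\<^sup>2"
      by (simp add: z_def power2_eq_square algebra_simps)
    hence "z\<^sup>2 \<le> (b1\<^sup>2 + b3\<^sup>2) * ((u$1)\<^sup>2 + (u$3)\<^sup>2)" by (smt (verit) zero_le_power2)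
    also have "\<dots> \<le> (b1\<^sup>2 + b3\<^sup>2) * (norm u)\<^sup>2" by (intro mult_left_mono) (auto simp: norm_vec3)
    finally have "z\<^sup>2 + (u$2)\<^sup>2 \<le> (1 + b1\<^sup>2 + b3\<^sup>2) * (norm u)\<^sup>2"
      by (simp add: norm_vec3 algebra_simps) (smt (verit) zero_le_power2)
    moreover have "\<bar>2 * (u$2 * z)\<bar> \<le> z\<^sup>2 + (u$2)\<^sup>2"
      using zero_le_power2[of "z - u$2"] zero_le_power2[of "z + u$2"]
      by (auto simp: power2_sum power2_diff abs_le_iff algebra_simps)
    ultimately have "e * \<bar>2 * (u$2 * z)\<bar> \<le> e * ((1 + b1\<^sup>2 + b3\<^sup>2) * (norm u)\<^sup>2)"
      using e by (intro mult_left_mono) auto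
    also have "\<dots> \<le> 1 / 2 * (norm u)\<^sup>2" unfolding mult.assoc[symmetric] using e by (intro mult_right_mono) auto
    finally show ?thesis using e by (simp add: abs_mult z_def)
  qed
  have Vlow: "1 / 2 * (norm u)\<^sup>2 \<le> V u" and Vup: "V u \<le> 3 / 2 * (norm u)\<^sup>2" for u
    using cross[of u] by (auto simp: V_def)
  have conv: "V z + G z \<bullet> (y - z) \<le> V y" for y z
  proof -
    \<comment> \<open>V is a quadratic form, so its Taylor remainder is V itself; positivity of V is
      thus convexity.\<close>
    have "V y - V z - G z \<bullet> (y - z) = V (y - z)"
      unfolding V_def G_def norm_vec3 by (simp add: inner_vec_def sum_3 power2_eq_square algebra_simps)
    thus ?thesis using Vlow[of "y - z"] zero_le_power2[of "norm (y - z)"] by linarith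
  qed
  have contV: "continuous_on UNIV V" unfolding V_def by (intro continuous_intros)
  define A where "A = (1 - q) * Gamma (1 - q)"
  have A: "A > 0" using q by (auto simp: A_def intro!: Gamma_real_pos)
  have decay: "(norm (x T))\<^sup>2 \<le> 6 * (norm (x 0))\<^sup>2 / (A * c) * T powr (- q)"
    if sol: "caputo_solution q ?F x" and x0: "norm (x 0) \<le> \<eta>" and T: "0 < T" for x T
  proof -
    \<comment> \<open>At least V (x 0), which is at most 3/2 |x 0|^2: the alternative V (x T) \<le>
      V (x 0) - K then forces x T = 0.\<close>
    define K where "K = 2 * (norm (x 0))\<^sup>2"
    have K: "0 \<le> K" by (simp add: K_def)
    from q sol conv contV K T show ?thesis
    proof (cases rule: caputo_convex_lyapunov)
      case 1
      hence "1 / 2 * (norm (x T))\<^sup>2 \<le> 0" using Vlow[of "x T"] Vup[of "x 0"] zero_le_power2[of "norm (x 0)"] unfolding K_def by linarith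
      thus ?thesis using A e by simp
    next
      case (2 r)
      \<comment> \<open>Monotonicity relative to time 0 keeps the maximiser in the ball where the
        dissipation estimate holds.\<close>
      have "norm (x r) \<le> \<eta>" using stokes_norm_nonincreasing[OF q k sol 2(1)] x0 by simp
      hence "G (x r) \<bullet> ?F (x r) \<le> - c * (norm (x r))\<^sup>2" unfolding G_def by (rule lyap)
      moreover have "0 \<le> r powr (- q) / Gamma (1 - q) * (V (x r) - V (x 0) + K / T * r)"
        using 2(4) q by (intro mult_nonneg_nonneg divide_nonneg_nonneg Gamma_real_nonneg) auto
      ultimately have "c * (norm (x r))\<^sup>2 \<le> K / T * (r powr (1 - q) / A)" using 2(5) by (simp add: A_def)
      also have "\<dots> \<le> K / T * (T powr (1 - q) / A)"
        using 2 q K A T by (intro mult_left_mono divide_right_mono powr_mono2) auto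
      also have "\<dots> = K / A * T powr (- q)" using T by (simp add: powr_diff powr_minus field_simps)
      finally have "(norm (x r))\<^sup>2 \<le> K / A * T powr (- q) / c" using e(2) by (simp only: pos_le_divide_eq mult.commute)
      moreover have "1 / 2 * (norm (x T))\<^sup>2 \<le> 3 / 2 * (norm (x r))\<^sup>2"
        using Vlow[of "x T"] Vup[of "x r"] 2(3) by simp
      ultimately have "(norm (x T))\<^sup>2 \<le> 3 * (K / A * T powr (- q) / c)" by simp
      thus ?thesis by (simp add: K_def mult_ac)
    qed
  qed
  have "caputo_stable q ?F 0"
    unfolding caputo_stable_def using stokes_norm_nonincreasing[OF q k] by (metis diff_zero le_less_trans)
  moreover have "((\<lambda>t. norm (x t - 0)) \<longlongrightarrow> 0) at_top"
    if sol: "caputo_solution q ?F x" and x0: "norm (x 0 - 0) < \<eta>" for x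
  proof -
    have "((\<lambda>t. 6 * (norm (x 0))\<^sup>2 / (A * c) * t powr (- q)) \<longlongrightarrow> 6 * (norm (x 0))\<^sup>2 / (A * c) * 0) at_top"
      using q by (intro tendsto_mult tendsto_const tendsto_neg_powr filterlim_ident) auto
    hence "((\<lambda>t. (norm (x t))\<^sup>2) \<longlongrightarrow> 0) at_top"
      by (intro tendsto_sandwich[of "\<lambda>_. 0" "\<lambda>t. (norm (x t))\<^sup>2" at_top])
        (use decay[OF sol] x0 in \<open>auto intro!: eventually_at_top_linorderI[of 1]\<close>)
    thus ?thesis using tendsto_real_sqrt[of "\<lambda>t. (norm (x t))\<^sup>2" 0 at_top] by simp
  qed
  ultimately show ?thesis unfolding caputo_asymptotically_stable_def using e(3) by blast
qed

section \<open>Volterra equations after the substitution \<open>\<tau> = t\<^sup>q\<close>\<close>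

text \<open>The function \<omega> of the substitution p = (1 - s/t)^q, under which s^q = t^q
  \<omega>(p) and the kernel (t - s)^(q-1) becomes constant.\<close>

definition stretch :: "real \<Rightarrow> real \<Rightarrow> real" where
  "stretch q p = (1 - p powr (1 / q)) powr q"

text \<open>The Riemann-Liouville integral of order q of g(s^q) at time t equals t^q / Gamma(q + 1)
  times this average at \<tau> = t^q.\<close>

definition stretch_avg :: "real \<Rightarrow> (real \<Rightarrow> 'a::euclidean_space) \<Rightarrow> real \<Rightarrow> 'a" where
  "stretch_avg q g \<tau> = integral {0..1} (\<lambda>p. g (\<tau> * stretch q p))"

lemma stretch_continuous:
  assumes "0 < q" shows "continuous_on {0..1} (stretch q)"
proof -
  have "0 \<le> 1 - p powr (1 / q)" if "p \<in> {0..1}" for p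
    using that assms by (auto intro!: powr_le1)
  thus ?thesis unfolding stretch_def using assms by (intro continuous_intros continuous_on_powr') auto
qed

lemma stretch_nonneg: "0 \<le> stretch q p"
  by (simp add: stretch_def)

lemma stretch_antimono:
  assumes "0 < q" "0 \<le> a" "a \<le> b" "b \<le> 1" shows "stretch q b \<le> stretch q a"
  unfolding stretch_def using assms
  by (intro powr_mono2) (auto intro!: powr_le1 powr_mono2)

lemma stretch_le_1: "0 < q \<Longrightarrow> p \<in> {0..1} \<Longrightarrow> stretch q p \<le> 1"
  using stretch_antimono[of q 0 p] by (simp add: stretch_def)

text \<open>Strictness away from p = 0 is the source of the contraction in
  \<open>stretch_weight\<close>.\<close>

lemma stretch_less_1:
  assumes "0 < q" "0 < p" "p \<le> 1" shows "stretch q p < 1"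
proof -
  have "p powr (1 / q) \<le> 1" "p powr (1 / q) > 0" using assms by (auto intro!: powr_le1)
  thus ?thesis using assms powr_less_mono2[of q "1 - p powr (1 / q)" 1] by (simp add: stretch_def)
qed

lemma stretch_mem:
  assumes "0 < q" "p \<in> {0..1}" "0 \<le> \<tau>" "\<tau> \<le> \<Theta>"
  shows "\<tau> * stretch q p \<in> {0..\<Theta>}" "0 \<le> \<tau> * stretch q p" "\<tau> * stretch q p \<le> \<tau>"
proof -
  show "\<tau> * stretch q p \<le> \<tau>" "0 \<le> \<tau> * stretch q p"
    using stretch_le_1[of q p] stretch_nonneg[of q p] assms mult_left_mono[of "stretch q p" 1 \<tau>] by auto
  thus "\<tau> * stretch q p \<in> {0..\<Theta>}" using assms by simp
qed

lemma stretch_comp_continuous: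
  fixes g :: "real \<Rightarrow> 'a::topological_space"
  assumes "0 < q" "0 \<le> \<tau>" "\<tau> \<le> \<Theta>" "continuous_on {0..\<Theta>} g"
  shows "continuous_on {0..1} (\<lambda>p. g (\<tau> * stretch q p))"
  by (rule continuous_on_compose2[OF assms(4)])
     (use assms stretch_mem[of q _ \<tau> \<Theta>] in \<open>auto intro!: continuous_intros stretch_continuous\<close>)

lemma stretch_avg_continuous:
  fixes g :: "real \<Rightarrow> 'a::euclidean_space"
  assumes q: "0 < q" and g: "continuous_on {0..} g"
  shows "continuous_on {0..} (stretch_avg q g)"
proof -
  have "continuous_on ({0..} \<times> cbox 0 1) (\<lambda>(\<tau>, p). g (\<tau> * stretch q p))"
    unfolding split_beta
    by (rule continuous_on_compose2[OF g])
       (use stretch_nonneg in \<open>auto intro!: continuous_intros continuous_on_compose2[OF stretch_continuous[OF q]]\<close>)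
  from integral_continuous_on_param[OF this] show ?thesis
    by (simp add: stretch_avg_def[abs_def] cbox_interval)
qed

lemma stretch_avg_diff:
  fixes g h :: "real \<Rightarrow> 'a::euclidean_space"
  assumes "0 < q" "0 \<le> \<tau>" "continuous_on {0..\<tau>} g" "continuous_on {0..\<tau>} h"
  shows "stretch_avg q g \<tau> - stretch_avg q h \<tau> = stretch_avg q (\<lambda>s. g s - h s) \<tau>"
  unfolding stretch_avg_def using assms
  by (intro integral_diff[symmetric] integrable_continuous_real stretch_comp_continuous[of q \<tau> \<tau>]) auto

lemma stretch_avg_norm_le:
  fixes g :: "real \<Rightarrow> 'a::euclidean_space"
  assumes "0 < q" "0 \<le> \<tau>" "continuous_on {0..\<tau>} g" "continuous_on {0..\<tau>} h"
    and "\<And>s. s \<in> {0..\<tau>} \<Longrightarrow> norm (g s) \<le> h s"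
  shows "norm (stretch_avg q g \<tau>) \<le> stretch_avg q h \<tau>"
  unfolding stretch_avg_def using assms stretch_mem[of q _ \<tau> \<tau>]
  by (intro integral_norm_bound_integral integrable_continuous_real stretch_comp_continuous[of q \<tau> \<tau>]) auto

lemma stretch_avg_const: "stretch_avg q (\<lambda>_. c) \<tau> = c"
  by (simp add: stretch_avg_def)

lemma stretch_avg_cmult: "stretch_avg q (\<lambda>s. c * g s) \<tau> = c * stretch_avg q g \<tau>" for c :: real
  by (simp add: stretch_avg_def)

lemma stretch_avg_norm_bound:
  fixes g :: "real \<Rightarrow> 'a::euclidean_space"
  assumes "0 < q" "0 \<le> \<tau>" "continuous_on {0..\<tau>} g"
    and "\<And>s. s \<in> {0..\<tau>} \<Longrightarrow> norm (g s) \<le> c"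
  shows "norm (stretch_avg q g \<tau>) \<le> c"
  using stretch_avg_norm_le[of q \<tau> g "\<lambda>_. c"] assms by (simp add: stretch_avg_const)

section \<open>Contraction in an exponentially weighted norm\<close>

text \<open>A Bielecki weight: against e^(\<mu> \<tau>) the operator K \<tau>
  \<open>stretch_avg\<close> halves upper bounds. For p \<ge> \<eta> the argument \<tau> \<omega>(p)
  stays below \<tau> by a fixed factor, so the weight gains e^(-\<mu> c \<tau>); the range p \<le>
  \<eta> is short.\<close>

lemma stretch_weight:
  assumes q: "0 < q" and K: "0 \<le> K" and \<Theta>: "0 \<le> \<Theta>"
  shows "\<exists>\<mu>\<ge>0. \<forall>d B. continuous_on {0..\<Theta>} d \<longrightarrow> (\<forall>s\<in>{0..\<Theta>}. d s \<le> B * exp (\<mu> * s)) \<longrightarrow> 0 \<le> B \<longrightarrow>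
       (\<forall>\<tau>\<in>{0..\<Theta>}. K * \<tau> * stretch_avg q d \<tau> \<le> B / 2 * exp (\<mu> * \<tau>))"
proof -
  \<comment> \<open>Makes the share of \<open>{0..\<eta>}\<close> at most 1/4. The choice of \<mu>
    below gives the other 1/4, through x e^(-x) \<le> 1 at x = \<mu> c \<tau>.\<close>
  define \<eta> where "\<eta> = 1 / (4 * (K * \<Theta> + 1))"
  have K\<Theta>: "0 \<le> K * \<Theta>" using K \<Theta> by simp
  hence \<eta>: "0 < \<eta>" "\<eta> \<le> 1" "K * \<Theta> * \<eta> \<le> 1 / 4" by (auto simp: \<eta>_def field_simps)
  define c where "c = 1 - stretch q \<eta>"
  have c: "c > 0" using stretch_less_1[OF q \<eta>(1,2)] by (simp add: c_def)
  define \<mu> where "\<mu> = 4 * (K + 1) / c"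
  have \<mu>: "\<mu> > 0" using c K by (simp add: \<mu>_def)
  show ?thesis
  proof (intro exI[of _ \<mu>] conjI allI impI ballI)
    show "0 \<le> \<mu>" using \<mu> by simp
    fix d B \<tau>
    assume d: "continuous_on {0..\<Theta>} d" and dB: "\<forall>s\<in>{0..\<Theta>}. d s \<le> B * exp (\<mu> * s)"
      and B: "0 \<le> B" and \<tau>: "\<tau> \<in> {0..\<Theta>}"
    let ?e = "\<lambda>p. exp (\<mu> * (\<tau> * stretch q p))"
    have ce: "continuous_on {0..1} ?e" by (intro continuous_intros stretch_continuous q)
    have ei: "?e integrable_on {0..1}" by (rule integrable_continuous_real[OF ce])
    have "integral {0..1} ?e = integral {0..\<eta>} ?e + integral {\<eta>..1} ?e"
      using \<eta> ei by (simp add: Henstock_Kurzweil_Integration.integral_combine)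
    also have "integral {0..\<eta>} ?e \<le> integral {0..\<eta>} (\<lambda>_. exp (\<mu> * \<tau>))"
      using \<eta> \<mu> \<tau> stretch_mem(3)[OF q, of _ \<tau> \<Theta>]
      by (intro integral_le integrable_on_subinterval[OF ei]) (auto intro!: mult_left_mono)
    also have "integral {\<eta>..1} ?e \<le> integral {\<eta>..1} (\<lambda>_. exp (\<mu> * (\<tau> * stretch q \<eta>)))"
      using \<eta> \<mu> \<tau> stretch_antimono[OF q, of \<eta>]
      by (intro integral_le integrable_on_subinterval[OF ei]) (auto intro!: mult_left_mono)
    also have "\<dots> \<le> exp (\<mu> * (\<tau> * stretch q \<eta>))" using \<eta> by simp
    also have "\<dots> = exp (\<mu> * \<tau>) * exp (- (\<mu> * c * \<tau>))"
      by (simp add: exp_add[symmetric] c_def algebra_simps)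
    finally have e: "integral {0..1} ?e \<le> exp (\<mu> * \<tau>) * (\<eta> + exp (- (\<mu> * c * \<tau>)))"
      using \<eta> by (simp add: algebra_simps)
    have "\<mu> * c * \<tau> \<le> exp (\<mu> * c * \<tau>)" using exp_ge_add_one_self[of "\<mu> * c * \<tau>"] by linarith
    hence "\<mu> * c * \<tau> * exp (- (\<mu> * c * \<tau>)) \<le> 1" by (simp add: exp_minus field_simps)
    hence "4 * (K + 1) * (\<tau> * exp (- (\<mu> * c * \<tau>))) \<le> 1" using c by (simp add: \<mu>_def)
    moreover have "0 \<le> \<tau> * exp (- (\<mu> * c * \<tau>))" using \<tau> by simp
    ultimately have k1: "K * \<tau> * exp (- (\<mu> * c * \<tau>)) \<le> 1 / 4" by (simp add: algebra_simps)
    have "K * \<tau> * \<eta> \<le> K * \<Theta> * \<eta>" using \<tau> K \<eta> by (intro mult_right_mono mult_left_mono) auto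
    hence k2: "K * \<tau> * (\<eta> + exp (- (\<mu> * c * \<tau>))) \<le> 1 / 2" using \<eta>(3) k1 by (simp add: algebra_simps)
    have "stretch_avg q d \<tau> \<le> integral {0..1} (\<lambda>p. B * ?e p)"
      unfolding stretch_avg_def using \<tau> stretch_mem(1)[OF q, of _ \<tau> \<Theta>]
      by (intro integral_le integrable_continuous_real stretch_comp_continuous[OF q _ _ d]
          continuous_on_mult_left ce dB[rule_format]) auto
    also have "\<dots> \<le> B * (exp (\<mu> * \<tau>) * (\<eta> + exp (- (\<mu> * c * \<tau>))))"
      using e B by (simp add: mult_left_mono)
    finally have "K * \<tau> * stretch_avg q d \<tau> \<le> K * \<tau> * (B * (exp (\<mu> * \<tau>) * (\<eta> + exp (- (\<mu> * c * \<tau>)))))"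
      using K \<tau> by (intro mult_left_mono) auto
    also have "\<dots> = B * exp (\<mu> * \<tau>) * (K * \<tau> * (\<eta> + exp (- (\<mu> * c * \<tau>))))" by (simp add: algebra_simps)
    also have "\<dots> \<le> B * exp (\<mu> * \<tau>) * (1 / 2)" using k2 B by (intro mult_left_mono) auto
    finally show "K * \<tau> * stretch_avg q d \<tau> \<le> B / 2 * exp (\<mu> * \<tau>)" by simp
  qed
qed

text \<open>A discrete Gronwall argument with vanishing errors: each step replaces the weighted
  bound B by B/2 + e', whose fixed point is 2 e'. It is needed for the derivatives of the Picard
  iterates, whose recursion contracts only up to an error.\<close>

lemma stretch_gronwall_limit:
  fixes d :: "nat \<Rightarrow> real \<Rightarrow> real"
  assumes q: "0 < q" and K: "0 \<le> K" and \<Theta>: "0 \<le> \<Theta>"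
    and cont: "\<And>n. continuous_on {0..\<Theta>} (d n)"
    and step: "\<And>e. 0 < e \<Longrightarrow> \<forall>\<^sub>F n in sequentially. \<forall>\<tau>\<in>{0..\<Theta>}. d (Suc n) \<tau> \<le> K * \<tau> * stretch_avg q (d n) \<tau> + e"
    and e: "0 < e"
  shows "\<forall>\<^sub>F n in sequentially. \<forall>\<tau>\<in>{0..\<Theta>}. d n \<tau> < e"
proof -
  obtain \<mu> where \<mu>: "0 \<le> \<mu>" and w: "\<And>d B \<tau>. continuous_on {0..\<Theta>} d \<Longrightarrow>
      \<forall>s\<in>{0..\<Theta>}. d s \<le> B * exp (\<mu> * s) \<Longrightarrow> 0 \<le> B \<Longrightarrow>
       \<tau> \<in> {0..\<Theta>} \<Longrightarrow> K * \<tau> * stretch_avg q d \<tau> \<le> B / 2 * exp (\<mu> * \<tau>)"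
    using stretch_weight[OF q K \<Theta>] by blast
  define e' where "e' = e / (4 * exp (\<mu> * \<Theta>))"
  have e': "e' > 0" using e by (simp add: e'_def)
  obtain N where N: "\<And>n \<tau>. n \<ge> N \<Longrightarrow> \<tau> \<in> {0..\<Theta>} \<Longrightarrow> d (Suc n) \<tau> \<le> K * \<tau> * stretch_avg q (d n) \<tau> + e'"
    using step[OF e'] unfolding eventually_sequentially by blast
  have "bounded (d N ` {0..\<Theta>})" by (intro compact_imp_bounded compact_continuous_image cont) auto
  then obtain D where D: "D > 0" "\<And>\<tau>. \<tau> \<in> {0..\<Theta>} \<Longrightarrow> \<bar>d N \<tau>\<bar> \<le> D"
    by (auto simp: bounded_pos)
  have bound: "\<forall>\<tau>\<in>{0..\<Theta>}. d (N + m) \<tau> \<le> (D / 2 ^ m + 2 * e') * exp (\<mu> * \<tau>)" for m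
  proof (induction m)
    case 0
    show ?case
    proof
      fix \<tau> assume \<tau>: "\<tau> \<in> {0..\<Theta>}"
      have "d N \<tau> \<le> (D + 2 * e') * 1" using D(2)[OF \<tau>] e' by simp
      also have "\<dots> \<le> (D + 2 * e') * exp (\<mu> * \<tau>)" using D e' \<mu> \<tau> by (intro mult_left_mono) auto
      finally show "d (N + 0) \<tau> \<le> (D / 2 ^ 0 + 2 * e') * exp (\<mu> * \<tau>)" by simp
    qed
  next
    case (Suc m)
    show ?case
    proof
      fix \<tau> assume \<tau>: "\<tau> \<in> {0..\<Theta>}"
      have "d (N + Suc m) \<tau> \<le> K * \<tau> * stretch_avg q (d (N + m)) \<tau> + e'" using N[of "N + m" \<tau>] \<tau> by simp
      moreover have "K * \<tau> * stretch_avg q (d (N + m)) \<tau> \<le> (D / 2 ^ m + 2 * e') / 2 * exp (\<mu> * \<tau>)"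
        by (rule w[OF cont]) (use Suc \<tau> D e' in auto)
      moreover have "e' \<le> e' * exp (\<mu> * \<tau>)" using e' \<mu> \<tau> by simp
      moreover have "(D / 2 ^ m + 2 * e') / 2 * exp (\<mu> * \<tau>) + e' * exp (\<mu> * \<tau>)
          = (D / 2 ^ Suc m + 2 * e') * exp (\<mu> * \<tau>)" by (simp add: algebra_simps add_divide_distrib)
      ultimately show "d (N + Suc m) \<tau> \<le> (D / 2 ^ Suc m + 2 * e') * exp (\<mu> * \<tau>)" by linarith
    qed
  qed
  have "(\<lambda>m. D / 2 ^ m) \<longlonglongrightarrow> 0"
    using tendsto_mult[OF tendsto_const LIMSEQ_power_zero[of "1/2 :: real"], of D] by (simp add: power_divide)
  hence "\<forall>\<^sub>F m in sequentially. D / 2 ^ m < e'" using e' by (rule order_tendstoD)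
  then obtain M where M: "\<And>m. m \<ge> M \<Longrightarrow> D / 2 ^ m < e'" by (auto simp: eventually_sequentially)
  show ?thesis unfolding eventually_sequentially
  proof (intro exI[of _ "N + M"] allI impI ballI)
    fix n \<tau> assume n: "N + M \<le> n" and \<tau>: "\<tau> \<in> {0..\<Theta>}"
    define m where "m = n - N"
    have m: "n = N + m" "m \<ge> M" using n by (auto simp: m_def)
    have "d n \<tau> \<le> (D / 2 ^ m + 2 * e') * exp (\<mu> * \<tau>)" using bound \<tau> m by blast
    also have "\<dots> \<le> (3 * e') * exp (\<mu> * \<Theta>)" using M[OF m(2)] e' D \<mu> \<tau>
      by (intro mult_mono) (auto intro!: mult_left_mono)
    also have "\<dots> < e" using e by (simp add: e'_def)
    finally show "d n \<tau> < e" .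
  qed
qed

lemma continuous_on_atLeast_0I:
  fixes f :: "real \<Rightarrow> 'a::topological_space"
  assumes "\<And>\<Theta>. 0 \<le> \<Theta> \<Longrightarrow> continuous_on {0..\<Theta>} f"
  shows "continuous_on {0..} f"
  unfolding continuous_on_eq_continuous_within
proof
  fix t :: real assume t: "t \<in> {0..}"
  have "continuous (at t within {0..t + 1}) f"
    using assms[of "t + 1"] t by (auto simp: continuous_on_eq_continuous_within)
  moreover have "at t within {0..t + 1} = at t within {0..}"
    by (rule at_within_nhd[of _ "{t - 1<..<t + 1}"]) (use t in auto)
  ultimately show "continuous (at t within {0..}) f" by simp
qed

text \<open>Successive differences of the iterates halve in the weighted norm, so the telescoping
  series converges by the Weierstrass test. The constants depend on \<Theta>, hence convergence is
  uniform on each \<open>{0..\<Theta>}\<close>.\<close>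

lemma stretch_fixpoint:
  fixes T :: "(real \<Rightarrow> 'a::euclidean_space) \<Rightarrow> real \<Rightarrow> 'a"
  assumes q: "0 < q"
    and cont: "\<And>U. continuous_on {0..} U \<Longrightarrow> continuous_on {0..} (T U)"
    and lip: "\<And>\<Theta>. 0 \<le> \<Theta> \<Longrightarrow> \<exists>K\<ge>0. \<forall>U V. continuous_on {0..} U \<longrightarrow> continuous_on {0..} V \<longrightarrow>
       (\<forall>\<tau>\<in>{0..\<Theta>}. norm (T U \<tau> - T V \<tau>) \<le> K * \<tau> * stretch_avg q (\<lambda>s. norm (U s - V s)) \<tau>)"
    and U0: "continuous_on {0..} U0"
  obtains U where "continuous_on {0..} U" "\<And>\<tau>. 0 \<le> \<tau> \<Longrightarrow> T U \<tau> = U \<tau>"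
    "\<And>\<Theta>. 0 \<le> \<Theta> \<Longrightarrow> uniform_limit {0..\<Theta>} (\<lambda>n. (T ^^ n) U0) U sequentially"
proof -
  define X where "X = (\<lambda>n. (T ^^ n) U0)"
  have XS: "X (Suc n) = T (X n)" for n by (simp add: X_def)
  have Xc: "continuous_on {0..} (X n)" for n
    by (induction n) (auto simp: X_def U0 cont)
  have Xc': "continuous_on {0..\<Theta>} (X n)" for n \<Theta> by (rule continuous_on_subset[OF Xc]) auto
  \<comment> \<open>A pointwise series, so that one limit function serves every \<Theta>.\<close>
  define U where "U = (\<lambda>\<tau>. X 0 \<tau> + (\<Sum>i. X (Suc i) \<tau> - X i \<tau>))"
  have lim: "uniform_limit {0..\<Theta>} X U sequentially" if \<Theta>: "0 \<le> \<Theta>" for \<Theta>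
  proof -
    obtain K where K: "K \<ge> 0" and L: "\<And>U V \<tau>. continuous_on {0..} U \<Longrightarrow> continuous_on {0..} V \<Longrightarrow> \<tau> \<in> {0..\<Theta>} \<Longrightarrow>
       norm (T U \<tau> - T V \<tau>) \<le> K * \<tau> * stretch_avg q (\<lambda>s. norm (U s - V s)) \<tau>"
      using lip[OF \<Theta>] by blast
    obtain \<mu> where \<mu>: "0 \<le> \<mu>" and w: "\<And>d B \<tau>. continuous_on {0..\<Theta>} d \<Longrightarrow>
        \<forall>s\<in>{0..\<Theta>}. d s \<le> B * exp (\<mu> * s) \<Longrightarrow> 0 \<le> B \<Longrightarrow>
         \<tau> \<in> {0..\<Theta>} \<Longrightarrow> K * \<tau> * stretch_avg q d \<tau> \<le> B / 2 * exp (\<mu> * \<tau>)"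
      using stretch_weight[OF q K \<Theta>] by blast
    have "bounded ((\<lambda>\<tau>. X 1 \<tau> - X 0 \<tau>) ` {0..\<Theta>})"
      by (intro compact_imp_bounded compact_continuous_image continuous_intros Xc') auto
    then obtain D where D: "D > 0" "\<And>\<tau>. \<tau> \<in> {0..\<Theta>} \<Longrightarrow> norm (X 1 \<tau> - X 0 \<tau>) \<le> D"
      by (auto simp: bounded_pos)
    have bound: "\<forall>\<tau>\<in>{0..\<Theta>}. norm (X (Suc n) \<tau> - X n \<tau>) \<le> D / 2 ^ n * exp (\<mu> * \<tau>)" for n
    proof (induction n)
      case 0
      show ?case
      proof
        fix \<tau> assume \<tau>: "\<tau> \<in> {0..\<Theta>}"
        have "D * 1 \<le> D * exp (\<mu> * \<tau>)" using \<tau> D \<mu> by (intro mult_left_mono) auto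
        thus "norm (X (Suc 0) \<tau> - X 0 \<tau>) \<le> D / 2 ^ 0 * exp (\<mu> * \<tau>)" using D(2)[OF \<tau>] by simp
      qed
    next
      case (Suc n)
      show ?case
      proof
        fix \<tau> assume \<tau>: "\<tau> \<in> {0..\<Theta>}"
        have "norm (X (Suc (Suc n)) \<tau> - X (Suc n) \<tau>) \<le> K * \<tau> * stretch_avg q (\<lambda>s. norm (X (Suc n) s - X n s)) \<tau>"
          unfolding XS[of "Suc n"] using L[OF Xc Xc \<tau>, of "Suc n" n] XS[of n] by simp
        also have "\<dots> \<le> D / 2 ^ n / 2 * exp (\<mu> * \<tau>)"
          by (rule w) (use Suc D \<tau> in \<open>auto intro!: continuous_intros Xc'\<close>)
        finally show "norm (X (Suc (Suc n)) \<tau> - X (Suc n) \<tau>) \<le> D / 2 ^ Suc n * exp (\<mu> * \<tau>)" by simp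
      qed
    qed
    have "uniform_limit {0..\<Theta>} (\<lambda>n \<tau>. \<Sum>i<n. X (Suc i) \<tau> - X i \<tau>) (\<lambda>\<tau>. \<Sum>i. X (Suc i) \<tau> - X i \<tau>) sequentially"
    proof (rule Weierstrass_m_test)
      fix n \<tau> assume \<tau>: "\<tau> \<in> {0..\<Theta>}"
      have "norm (X (Suc n) \<tau> - X n \<tau>) \<le> D / 2 ^ n * exp (\<mu> * \<tau>)" using bound \<tau> by blast
      also have "\<dots> \<le> D / 2 ^ n * exp (\<mu> * \<Theta>)" using D \<mu> \<tau> by (intro mult_left_mono) (auto intro!: mult_left_mono)
      finally show "norm (X (Suc n) \<tau> - X n \<tau>) \<le> D * exp (\<mu> * \<Theta>) * (1 / 2) ^ n" by (simp add: power_divide)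
    next
      show "summable (\<lambda>n. D * exp (\<mu> * \<Theta>) * (1 / 2) ^ n)" by (intro summable_mult summable_geometric) auto
    qed
    hence "uniform_limit {0..\<Theta>} (\<lambda>n \<tau>. X 0 \<tau> + (\<Sum>i<n. X (Suc i) \<tau> - X i \<tau>)) U sequentially"
      unfolding U_def by (intro uniform_limit_add uniform_limit_const)
    moreover have "X 0 \<tau> + (\<Sum>i<n. X (Suc i) \<tau> - X i \<tau>) = X n \<tau>" for n \<tau>
      by (induction n) (simp_all add: add.assoc[symmetric])
    ultimately show ?thesis by simp
  qed
  have Uc': "continuous_on {0..\<Theta>} U" if "0 \<le> \<Theta>" for \<Theta>
    by (rule uniform_limit_theorem[OF _ lim[OF that]]) (auto intro!: always_eventually Xc')
  hence Uc: "continuous_on {0..} U" by (rule continuous_on_atLeast_0I)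
  have "T U \<tau> = U \<tau>" if \<tau>: "0 \<le> \<tau>" for \<tau>
  proof -
    obtain K where K: "K \<ge> 0" and L: "\<And>U V \<sigma>. continuous_on {0..} U \<Longrightarrow> continuous_on {0..} V \<Longrightarrow> \<sigma> \<in> {0..\<tau>} \<Longrightarrow>
       norm (T U \<sigma> - T V \<sigma>) \<le> K * \<sigma> * stretch_avg q (\<lambda>s. norm (U s - V s)) \<sigma>"
      using lip[OF \<tau>] by blast
    have "(\<lambda>n. X (Suc n) \<tau>) \<longlonglongrightarrow> T U \<tau>"
    proof (rule LIMSEQ_I)
      fix e :: real assume e: "e > 0"
      define e' where "e' = e / (K * \<tau> + 1)"
      have pos: "K * \<tau> + 1 > 0" using K \<tau> by (intro add_nonneg_pos) auto
      hence e': "e' > 0" using e by (simp add: e'_def)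
      obtain N where N: "\<And>n s. n \<ge> N \<Longrightarrow> s \<in> {0..\<tau>} \<Longrightarrow> dist (X n s) (U s) < e'"
        using uniform_limitD[OF lim[OF \<tau>] e'] unfolding eventually_sequentially by blast
      show "\<exists>N. \<forall>n\<ge>N. norm (X (Suc n) \<tau> - T U \<tau>) < e"
      proof (intro exI[of _ N] allI impI)
        fix n assume n: "n \<ge> N"
        have "norm (stretch_avg q (\<lambda>s. norm (X n s - U s)) \<tau>) \<le> e'"
          using N[OF n] \<tau> q by (intro stretch_avg_norm_bound continuous_intros Xc' Uc')
            (auto simp: dist_norm less_imp_le)
        hence "K * \<tau> * stretch_avg q (\<lambda>s. norm (X n s - U s)) \<tau> \<le> K * \<tau> * e'"
          using K \<tau> by (intro mult_left_mono) auto
        also have "\<dots> < (K * \<tau> + 1) * e'" using e' by (simp add: algebra_simps)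
        also have "\<dots> = e" using pos by (simp add: e'_def)
        finally show "norm (X (Suc n) \<tau> - T U \<tau>) < e"
          using L[OF Xc Uc, of \<tau> n] \<tau> XS by simp
      qed
    qed
    moreover have "(\<lambda>n. X (Suc n) \<tau>) \<longlonglongrightarrow> U \<tau>"
      using tendsto_uniform_limitI[OF lim[OF \<tau>], of \<tau>] \<tau> by (intro LIMSEQ_Suc) auto
    ultimately show ?thesis by (rule LIMSEQ_unique)
  qed
  thus thesis using that[OF Uc] lim by (simp add: X_def)
qed

section \<open>Inverting the Abel operator\<close>

lemma powr_continuous_on_nonneg: "0 < q \<Longrightarrow> A \<subseteq> {0..} \<Longrightarrow> continuous_on A (\<lambda>s::real. s powr q)"
  by (rule continuous_on_powr') (auto intro!: continuous_intros)

lemma Beta_kernel_integral: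
  assumes q: "0 < q" "q < 1" and a: "0 < a" and t: "0 < (t::real)"
  shows "((\<lambda>s. (t - s) powr (- q) * s powr (a - 1)) has_integral t powr (a - q) * Beta a (1 - q)) {0..t}"
proof -
  let ?f = "\<lambda>s::real. s powr (a - 1) * (1 - s) powr (- q)"
  have img: "(\<lambda>x. x / (1 / t)) ` {0..1} = {0..t}"
  proof -
    have "x \<in> (\<lambda>x. x / (1 / t)) ` {0..1}" if "x \<in> {0..t}" for x
      using that t by (intro image_eqI[of _ _ "x / t"]) auto
    thus ?thesis using t by (auto simp: mult_left_le_one_le)
  qed
  have "(?f has_integral Beta a (1 - q)) {0..1}"
    using has_integral_Beta_real[of a "1 - q"] q a by simp
  from has_integral_stretch_real[OF this, of "1 / t"]
  have "((\<lambda>s. ?f (1 / t * s)) has_integral t * Beta a (1 - q)) {0..t}"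
    using t unfolding img by simp
  hence A: "((\<lambda>s. t powr (a - 1 - q) * ?f (1 / t * s)) has_integral t powr (a - 1 - q) * (t * Beta a (1 - q))) {0..t}"
    by (rule has_integral_mult_right)
  have C: "t powr (a - 1 - q) * (t * Beta a (1 - q)) = t powr (a - q) * Beta a (1 - q)"
    using powr_add[of t "a - 1 - q" 1] t by simp
  have B: "t powr (a - 1 - q) * ?f (1 / t * s) = (t - s) powr (- q) * s powr (a - 1)" if "s \<in> {0..t}" for s
  proof -
    have "1 - 1 / t * s = (t - s) / t" using t by (simp add: field_simps)
    hence "?f (1 / t * s) = (s powr (a - 1) / t powr (a - 1)) * ((t - s) powr (- q) / t powr (- q))"
      using that t by (simp add: powr_divide)
    moreover have "t powr (a - 1 - q) = t powr (a - 1) * t powr (- q)" by (simp add: powr_add[symmetric])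
    ultimately show ?thesis using t by simp
  qed
  show ?thesis using has_integral_eq[OF B A] unfolding C .
qed

text \<open>The substitution p = y^q turns the average into a Beta integral.\<close>

lemma stretch_avg_power:
  assumes q: "0 < q"
  shows "stretch_avg q (\<lambda>s. s ^ n) \<tau> = \<tau> ^ n * (q * Beta q (real n * q + 1))"
proof -
  let ?f = "\<lambda>p. stretch q p ^ n"
  have A: "((\<lambda>y. (q * y powr (q - 1)) *\<^sub>R ?f (y powr q)) has_integral (integral {0 powr q..1 powr q} ?f)) {0..1}"
  proof (rule has_integral_substitution_strong[where s = "{0}" and c = 0 and d = 1])
    show "continuous_on {0..1} (\<lambda>y. y powr q)" using q by (intro continuous_on_powr' continuous_intros) auto
    show "(\<lambda>y. y powr q) ` {0..1} \<subseteq> {0..1}" using q by (auto intro!: powr_le1)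
    show "continuous_on {0..1} ?f" by (intro continuous_intros stretch_continuous q)
    fix y :: real assume "y \<in> {0..1} - {0}"
    thus "((\<lambda>y. y powr q) has_real_derivative q * y powr (q - 1)) (at y within {0..1})"
      by (auto intro!: derivative_eq_intros)
  qed auto
  \<comment> \<open>The point y = 1 is excluded because for n = 0 the left side contains
    \<open>0 powr 0\<close>, which is 0, and the right side \<open>0 ^ 0\<close>, which is
    1.\<close>
  have B: "q * (y powr (q - 1) * (1 - y) powr (real n * q)) = (q * y powr (q - 1)) *\<^sub>R ?f (y powr q)"
    if "y \<in> {0..1} - {1}" for y
    using that q by (simp add: stretch_def powr_powr powr_power mult.commute)
  have "((\<lambda>y. q * (y powr (q - 1) * (1 - y) powr (real n * q))) has_integral
      integral {0 powr q..1 powr q} ?f) {0..1}"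
    by (rule has_integral_spike[where S = "{1}", OF _ B A]) simp
  hence "((\<lambda>y. q * (y powr (q - 1) * (1 - y) powr (real n * q))) has_integral integral {0..1} ?f) {0..1}"
    using q by simp
  moreover have "((\<lambda>y. q * (y powr (q - 1) * (1 - y) powr (real n * q))) has_integral q * Beta q (real n * q + 1)) {0..1}"
    using has_integral_mult_right[OF has_integral_Beta_real[of q "real n * q + 1"], of q] q
    by (simp add: add_nonneg_pos)
  ultimately have "integral {0..1} ?f = q * Beta q (real n * q + 1)" by (rule has_integral_unique)
  thus ?thesis by (simp add: stretch_avg_def power_mult_distrib)
qed

text \<open>
  Abel's inversion. Both sides are linear in \<open>M\<close> and continuous for the supremum norm, so
  it suffices to compare them on monomials, where they are Beta integrals.
\<close>

lemma Beta_kernel_stretch_avg: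
  fixes M :: "real \<Rightarrow> real"
  assumes q: "0 < q" "q < 1" and t: "0 < t" and M: "continuous_on {0..} M"
  defines "k \<equiv> \<lambda>s. (t - s) powr (- q) * s powr (q - 1)"
  shows "(\<lambda>s. stretch_avg q M (s powr q) * k s) absolutely_integrable_on {0..t}"
    and "integral {0..t} (\<lambda>s. stretch_avg q M (s powr q) * k s)
      = Gamma (1 - q) * Gamma q * t powr (- q) * integral {0..t powr q} M"
proof -
  define G where "G = Gamma (1 - q) * Gamma q"
  have G: "G > 0" using q by (auto simp: G_def intro!: mult_pos_pos Gamma_real_pos)
  define \<Theta> where "\<Theta> = t powr q"
  have \<Theta>: "\<Theta> > 0" using t by (simp add: \<Theta>_def)
  have k0: "(k has_integral G) {0..t}"
    using Beta_kernel_integral[OF q q(1) t] t by (simp add: k_def Beta_def G_def mult.commute[of "Gamma q"])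
  have knn: "k s \<ge> 0" for s by (simp add: k_def)
  have ka: "k absolutely_integrable_on {0..t}"
    by (rule nonnegative_absolutely_integrable_1) (use k0 knn in auto)
  have mem: "s powr q \<in> {0..\<Theta>}" if "s \<in> {0..t}" for s
    using that q by (auto simp: \<Theta>_def intro!: powr_mono2)
  have ai: "(\<lambda>s. stretch_avg q g (s powr q) * k s) absolutely_integrable_on {0..t}"
    if g: "continuous_on {0..} g" for g :: "real \<Rightarrow> real"
  proof -
    have c: "continuous_on {0..t} (\<lambda>s. stretch_avg q g (s powr q))"
      by (rule continuous_on_compose2[OF stretch_avg_continuous[OF q(1) g]])
         (use q in \<open>auto intro!: powr_continuous_on_nonneg\<close>)
    show ?thesis
      by (intro absolutely_integrable_bounded_measurable_product_real ka
            continuous_imp_measurable_on_sets_lebesgue[OF c]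
            compact_imp_bounded[OF compact_continuous_image[OF c]]) auto
  qed
  show "(\<lambda>s. stretch_avg q M (s powr q) * k s) absolutely_integrable_on {0..t}" by (rule ai[OF M])
  have mono: "((\<lambda>s. stretch_avg q (\<lambda>s. s ^ n) (s powr q) * k s) has_integral
      G * t powr (- q) * (\<Theta> ^ Suc n / real (Suc n))) {0..t}" for n
  proof -
    define a where "a = real n * q + q"
    have a: "a > 0" using q by (simp add: a_def add_nonneg_pos)
    have A: "((\<lambda>s. q * Beta q (real n * q + 1) * ((t - s) powr (- q) * s powr (a - 1))) has_integral
        q * Beta q (real n * q + 1) * (t powr (a - q) * Beta a (1 - q))) {0..t}"
      by (intro has_integral_mult_right Beta_kernel_integral q a t)
    have B: "q * Beta q (real n * q + 1) * ((t - s) powr (- q) * s powr (a - 1))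
        = stretch_avg q (\<lambda>s. s ^ n) (s powr q) * k s" if "s \<in> {0..t}" for s
    proof (cases "s = 0")
      case False
      hence "(s powr q) ^ n * s powr (q - 1) = s powr (a - 1)"
        using that by (simp add: powr_power a_def powr_add[symmetric] algebra_simps)
      thus ?thesis by (simp add: stretch_avg_power[OF q(1)] k_def)
    qed (simp add: k_def)
    \<comment> \<open>In the product of the two Beta values Gamma(n q + 1) cancels, and Gamma(a + 1)
      = a Gamma(a) leaves G / a with a = q (n + 1).\<close>
    have C: "q * Beta q (real n * q + 1) * (t powr (a - q) * Beta a (1 - q))
       = G * t powr (- q) * (\<Theta> ^ Suc n / real (Suc n))"
    proof -
      have n: "real n * q + 1 > 0" using q by (intro add_nonneg_pos) auto
      have "Gamma (a + 1) = a * Gamma a" using a by (intro Gamma_plus1) (auto elim: nonpos_Ints_cases)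
      moreover have "Gamma (real n * q + 1) \<noteq> 0" using Gamma_real_pos[OF n] by (metis less_irrefl)
      moreover have "Gamma a \<noteq> 0" using Gamma_real_pos[OF a] by (metis less_irrefl)
      ultimately have "q * Beta q (real n * q + 1) * Beta a (1 - q) = q * G / a"
        using a by (simp add: Beta_def G_def a_def add_ac)
      also have "\<dots> = G / real (Suc n)"
      proof -
        have "a = q * real (Suc n)" by (simp add: a_def algebra_simps)
        thus ?thesis using q by simp
      qed
      finally have "q * Beta q (real n * q + 1) * Beta a (1 - q) = G / real (Suc n)" .
      moreover have "t powr (a - q) = t powr (- q) * \<Theta> ^ Suc n"
      proof -
        have "\<Theta> ^ Suc n = t powr (real (Suc n) * q)" unfolding \<Theta>_def by (rule powr_power) (use t in simp)
        moreover have "a - q = - q + real (Suc n) * q" by (simp add: a_def algebra_simps)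
        ultimately show ?thesis by (simp only: powr_add)
      qed
      moreover have "q * Beta q (real n * q + 1) * (t powr (a - q) * Beta a (1 - q))
          = t powr (a - q) * (q * Beta q (real n * q + 1) * Beta a (1 - q))" by (simp only: mult_ac)
      ultimately show ?thesis by (simp only: times_divide_eq_right mult_ac)
    qed
    show ?thesis using has_integral_eq[OF B A] unfolding C .
  qed
  have poly: "integral {0..t} (\<lambda>s. stretch_avg q P (s powr q) * k s) = G * t powr (- q) * integral {0..\<Theta>} P"
    if "P = (\<lambda>x. \<Sum>i\<le>n. a i * x ^ i)" for P :: "real \<Rightarrow> real" and a and n :: nat
  proof -
    have "((\<lambda>s. \<Sum>i\<le>n. a i * (stretch_avg q (\<lambda>s. s ^ i) (s powr q) * k s)) has_integral
      (\<Sum>i\<le>n. a i * (G * t powr (- q) * (\<Theta> ^ Suc i / real (Suc i))))) {0..t}"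
      by (intro has_integral_sum has_integral_mult_right mono) auto
    moreover have "stretch_avg q P \<tau> = (\<Sum>i\<le>n. a i * stretch_avg q (\<lambda>s. s ^ i) \<tau>)" for \<tau>
    proof -
      have "stretch_avg q P \<tau> = (\<Sum>i\<le>n. integral {0..1} (\<lambda>p. a i * (\<tau> * stretch q p) ^ i))"
        unfolding stretch_avg_def that using q
        by (intro integral_sum integrable_continuous_real continuous_intros stretch_continuous) auto
      thus ?thesis by (simp add: stretch_avg_def)
    qed
    moreover have "(P has_integral (\<Sum>i\<le>n. a i * (\<Theta> ^ Suc i / real (Suc i)))) {0..\<Theta>}"
      unfolding that
    proof (intro has_integral_sum has_integral_mult_right)
      fix i
      have "((\<lambda>x. x ^ i) has_integral (\<Theta> ^ Suc i / real (Suc i) - 0 ^ Suc i / real (Suc i))) {0..\<Theta>}"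
      proof (rule fundamental_theorem_of_calculus)
        fix x assume "x \<in> {0..\<Theta>}"
        show "((\<lambda>x. x ^ Suc i / real (Suc i)) has_vector_derivative x ^ i) (at x within {0..\<Theta>})"
          unfolding has_real_derivative_iff_has_vector_derivative[symmetric]
          by (rule derivative_eq_intros refl | simp)+
      qed (use \<Theta> in simp)
      thus "((\<lambda>x. x ^ i) has_integral \<Theta> ^ Suc i / real (Suc i)) {0..\<Theta>}" by simp
    qed auto
    ultimately show ?thesis
      by (simp add: integral_unique sum_distrib_left sum_distrib_right mult_ac)
  qed
  define D where "D = integral {0..t} (\<lambda>s. stretch_avg q M (s powr q) * k s) - G * t powr (- q) * integral {0..\<Theta>} M"
  \<comment> \<open>Replacing M by a polynomial within e changes each term of D by at most e G: the
    kernel k has mass G, and t^(-q) \<Theta> = 1.\<close>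
  have "\<bar>D\<bar> \<le> e * (2 * G)" if e: "0 < e" for e
  proof -
    have M\<Theta>: "continuous_on {0..\<Theta>} M" by (rule continuous_on_subset[OF M]) auto
    obtain P where P: "real_polynomial_function P" and PM: "\<And>x. x \<in> {0..\<Theta>} \<Longrightarrow> \<bar>M x - P x\<bar> < e"
      using Stone_Weierstrass_real_polynomial_function[OF _ M\<Theta> e] by auto
    obtain a n where P': "P = (\<lambda>x. \<Sum>i\<le>n. a i * x ^ i)"
      using P unfolding real_polynomial_function_iff_sum by blast
    have cP: "continuous_on A P" for A unfolding P' by (intro continuous_intros)
    have "norm (integral {0..t} (\<lambda>s. stretch_avg q M (s powr q) * k s - stretch_avg q P (s powr q) * k s))
        \<le> integral {0..t} (\<lambda>s. e * k s)"
    proof (rule integral_norm_bound_integral)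
      show "(\<lambda>s. stretch_avg q M (s powr q) * k s - stretch_avg q P (s powr q) * k s) integrable_on {0..t}"
        using ai[OF M] ai[OF cP] by (intro integrable_diff) (auto simp: absolutely_integrable_on_def)
      show "(\<lambda>s. e * k s) integrable_on {0..t}" using k0 by (intro integrable_on_mult_right) auto
      fix s assume s: "s \<in> {0..t}"
      have sq: "0 \<le> s powr q" "s powr q \<le> \<Theta>" using mem[OF s] by auto
      have cM: "continuous_on {0..s powr q} M" by (rule continuous_on_subset[OF M]) auto
      have "norm (stretch_avg q (\<lambda>r. M r - P r) (s powr q)) \<le> e"
      proof (rule stretch_avg_norm_bound[OF q(1) sq(1)])
        show "continuous_on {0..s powr q} (\<lambda>r. M r - P r)" by (rule continuous_on_diff[OF cM cP])
        show "norm (M r - P r) \<le> e" if "r \<in> {0..s powr q}" for r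
          using PM[of r] that sq by auto
      qed
      hence "norm (stretch_avg q M (s powr q) - stretch_avg q P (s powr q)) \<le> e"
        unfolding stretch_avg_diff[OF q(1) sq(1) cM cP] .
      hence "norm (stretch_avg q M (s powr q) - stretch_avg q P (s powr q)) * k s \<le> e * k s"
        using knn by (intro mult_right_mono) auto
      thus "norm (stretch_avg q M (s powr q) * k s - stretch_avg q P (s powr q) * k s) \<le> e * k s"
        using knn[of s] by (simp only: left_diff_distrib[symmetric] norm_mult) simp
    qed
    hence 1: "\<bar>integral {0..t} (\<lambda>s. stretch_avg q M (s powr q) * k s) - integral {0..t} (\<lambda>s. stretch_avg q P (s powr q) * k s)\<bar> \<le> e * G"
      using ai[OF M] ai[OF cP] integral_unique[OF k0]
      by (simp add: absolutely_integrable_on_def Henstock_Kurzweil_Integration.integral_diff)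
    have "norm (integral {0..\<Theta>} (\<lambda>s. M s - P s)) \<le> integral {0..\<Theta>} (\<lambda>_. e)"
      by (rule integral_norm_bound_integral)
         (auto intro!: integrable_continuous_real continuous_intros M\<Theta> cP less_imp_le PM)
    hence "\<bar>integral {0..\<Theta>} M - integral {0..\<Theta>} P\<bar> \<le> \<Theta> * e"
      using \<Theta> by (simp add: Henstock_Kurzweil_Integration.integral_diff integrable_continuous_real M\<Theta> cP)
    hence "G * t powr (- q) * \<bar>integral {0..\<Theta>} M - integral {0..\<Theta>} P\<bar> \<le> G * t powr (- q) * (\<Theta> * e)"
      using G by (intro mult_left_mono) auto
    also have "\<dots> = e * G" using t by (simp add: \<Theta>_def powr_minus)
    finally have 2: "\<bar>G * t powr (- q) * integral {0..\<Theta>} M - G * t powr (- q) * integral {0..\<Theta>} P\<bar> \<le> e * G"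
      using G by (simp add: abs_mult right_diff_distrib[symmetric])
    show ?thesis using 1 2 poly[OF P'] unfolding D_def by linarith
  qed
  from this[of "e / (2 * G)" for e] have "\<bar>D\<bar> \<le> 0 + e" if "0 < e" for e
    using that G by simp
  hence "D = 0" using field_le_epsilon[of "\<bar>D\<bar>" 0] by simp
  thus "integral {0..t} (\<lambda>s. stretch_avg q M (s powr q) * k s)
      = Gamma (1 - q) * Gamma q * t powr (- q) * integral {0..t powr q} M"
    by (simp add: D_def G_def \<Theta>_def)
qed

text \<open>By the chain rule the Caputo integrand of U(t^q) is the kernel of
  \<open>Beta_kernel_stretch_avg\<close> times 1 / Gamma(q). Abel's inversion returns t^(-q) times
  the integral of M over [0, t^q], and M integrates to \<tau> H \<tau>.\<close>

lemma caputo_stretched: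
  fixes U W M H :: "real \<Rightarrow> real"
  assumes q: "0 < q" "q < 1"
    and dU: "\<And>\<tau>. \<tau> > 0 \<Longrightarrow> (U has_real_derivative W \<tau>) (at \<tau>)" and cU: "continuous_on {0..} U"
    and cM: "continuous_on {0..} M"
    and W: "\<And>\<tau>. \<tau> > 0 \<Longrightarrow> W \<tau> = stretch_avg q M \<tau> / Gamma (q + 1)"
    and MH: "\<And>\<tau>. 0 \<le> \<tau> \<Longrightarrow> (M has_integral \<tau> * H \<tau>) {0..\<tau>}"
  shows "caputo_regular q (\<lambda>t. U (t powr q))"
    and "t > 0 \<Longrightarrow> caputo_deriv q (\<lambda>t. U (t powr q)) t = H (t powr q)"
proof -
  let ?x = "\<lambda>t. U (t powr q)"
  have Gp: "Gamma q > 0" "Gamma (1 - q) > 0" using q by (auto intro!: Gamma_real_pos)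
  have G1: "Gamma (q + 1) = q * Gamma q" using q by (intro Gamma_plus1) (auto elim: nonpos_Ints_cases)
  have dx: "(?x has_real_derivative W (s powr q) * (q * s powr (q - 1))) (at s)" if "s > 0" for s
  proof -
    have p: "((\<lambda>t. t powr q) has_real_derivative q * s powr (q - 1)) (at s)"
      using has_real_derivative_powr[OF that] .
    have "(U has_real_derivative W (s powr q)) (at (s powr q))" using that by (intro dU) simp
    thus ?thesis by (rule DERIV_chain2[where f = U and g = "\<lambda>t. t powr q", OF _ p])
  qed
  note B = Beta_kernel_stretch_avg[OF q _ cM]
  have eq: "1 / Gamma q * (stretch_avg q M (s powr q) * ((t - s) powr (- q) * s powr (q - 1))) = (t - s) powr (- q) * deriv ?x s"
    if "s \<in> {0..t} - {0}" for s t
  proof -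
    have s: "s > 0" using that by auto
    hence "s powr q > 0" by simp
    have "deriv ?x s = stretch_avg q M (s powr q) / (q * Gamma q) * (q * s powr (q - 1))"
      unfolding DERIV_imp_deriv[OF dx[OF s]] W[OF \<open>s powr q > 0\<close>] G1 ..
    also have "\<dots> = 1 / Gamma q * (stretch_avg q M (s powr q) * s powr (q - 1))"
      using q by simp
    finally show ?thesis by (simp only: mult_ac)
  qed
  have "caputo_integrable q ?x t" if t: "t > 0" for t
    unfolding caputo_integrable_def
    by (rule absolutely_integrable_spike[where S = "{0}", OF set_integrable_mult_right[OF B(1)[OF t], of "1 / Gamma q"]])
       (simp, simp only: eq)
  moreover have "continuous_on {0..} ?x"
    by (rule continuous_on_compose2[OF cU]) (use q in \<open>auto intro!: powr_continuous_on_nonneg\<close>)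
  ultimately show "caputo_regular q ?x"
    unfolding caputo_regular_def using dx real_differentiable_def by blast
  assume t: "t > 0"
  have "integral {0..t} (\<lambda>s. (t - s) powr (- q) * deriv ?x s) =
      integral {0..t} (\<lambda>s. 1 / Gamma q * (stretch_avg q M (s powr q) * ((t - s) powr (- q) * s powr (q - 1))))"
    by (rule integral_spike[of "{0}"]) (simp, simp only: eq)
  also have "\<dots> = 1 / Gamma q * (Gamma (1 - q) * Gamma q * t powr (- q) * integral {0..t powr q} M)"
    by (simp only: integral_mult_right B(2)[OF t])
  also have "integral {0..t powr q} M = t powr q * H (t powr q)"
    using MH[of "t powr q"] by (simp add: integral_unique)
  also have "1 / Gamma q * (Gamma (1 - q) * Gamma q * t powr (- q) * (t powr q * H (t powr q)))
      = Gamma (1 - q) * H (t powr q)"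
    using t Gp(1) by (simp add: powr_minus)
  finally show "caputo_deriv q ?x t = H (t powr q)"
    using Gp(2) by (simp only: caputo_deriv_def) simp
qed

section \<open>Existence of solutions\<close>

text \<open>Differentiation under the integral: the derivative of \<tau> H(\<tau> \<omega>) in
  \<tau> is H(\<tau> \<omega>) + \<tau> \<omega> H'(\<tau> \<omega>), again a function of \<tau>
  \<omega> alone.\<close>

lemma stretch_avg_has_vector_derivative:
  fixes H :: "real \<Rightarrow> 'a::euclidean_space"
  assumes q: "0 < q" and dH: "\<And>s. 0 \<le> s \<Longrightarrow> (H has_vector_derivative H' s) (at s within {0..})"
    and cH': "continuous_on {0..} H'" and \<tau>: "0 \<le> \<tau>"
  shows "((\<lambda>\<tau>. \<tau> *\<^sub>R stretch_avg q H \<tau>) has_vector_derivative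
      stretch_avg q (\<lambda>s. H s + s *\<^sub>R H' s) \<tau>) (at \<tau> within {0..})"
proof -
  have cH: "continuous_on {0..} H"
    using dH by (auto simp: continuous_on_eq_continuous_within intro: has_vector_derivative_continuous)
  let ?f = "\<lambda>\<tau> p. \<tau> *\<^sub>R H (\<tau> * stretch q p)"
  let ?f' = "\<lambda>\<tau> p. H (\<tau> * stretch q p) + (\<tau> * stretch q p) *\<^sub>R H' (\<tau> * stretch q p)"
  have "((\<lambda>\<tau>. integral (cbox 0 1) (?f \<tau>)) has_vector_derivative integral (cbox 0 1) (?f' \<tau>)) (at \<tau> within {0..})"
  proof (rule leibniz_rule_vector_derivative)
    fix x p :: real assume x: "x \<in> {0..}" and p: "p \<in> cbox 0 1"
    have sub: "(\<lambda>\<tau>. \<tau> * stretch q p) ` {0..} \<subseteq> {0..}" using stretch_nonneg by auto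
    have "((\<lambda>\<tau>. \<tau> * stretch q p) has_vector_derivative stretch q p) (at x within {0..})"
      by (auto intro!: derivative_eq_intros simp: has_real_derivative_iff_has_vector_derivative[symmetric])
    moreover have "(H has_vector_derivative H' (x * stretch q p)) (at (x * stretch q p) within (\<lambda>\<tau>. \<tau> * stretch q p) ` {0..})"
      by (rule has_vector_derivative_within_subset[OF dH sub]) (use x stretch_nonneg in auto)
    ultimately have "((H \<circ> (\<lambda>\<tau>. \<tau> * stretch q p)) has_vector_derivative stretch q p *\<^sub>R H' (x * stretch q p)) (at x within {0..})"
      by (rule vector_diff_chain_within)
    from has_vector_derivative_scaleR[OF DERIV_ident this]
    show "((\<lambda>\<tau>. ?f \<tau> p) has_vector_derivative ?f' x p) (at x within {0..})"
      by (simp add: o_def add.commute)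
  next
    fix x :: real assume x: "x \<in> {0..}"
    show "?f x integrable_on cbox 0 1"
      using x stretch_comp_continuous[OF q, of x x H] continuous_on_subset[OF cH, of "{0..x}"]
      by (auto simp: cbox_interval intro!: integrable_continuous_real continuous_intros)
  next
    have c: "continuous_on ({0..} \<times> cbox 0 1) (\<lambda>(\<tau>, p). g (\<tau> * stretch q p))"
      if g: "continuous_on {0..} g" for g :: "real \<Rightarrow> 'a"
      unfolding split_beta
      by (rule continuous_on_compose2[OF g])
         (use stretch_nonneg in \<open>auto intro!: continuous_intros continuous_on_compose2[OF stretch_continuous[OF q]]\<close>)
    have "continuous_on {0..} (\<lambda>s. H s + s *\<^sub>R H' s)" by (intro continuous_intros cH cH')
    from c[OF this] show "continuous_on ({0..} \<times> cbox 0 1) (\<lambda>(\<tau>, p). ?f' \<tau> p)" .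
  qed (use \<tau> in auto)
  thus ?thesis by (simp add: stretch_avg_def cbox_interval)
qed

text \<open>Eventually \<open>X n\<close> is within 1 of U, so all values lie in one compact set,
  where G is uniformly continuous.\<close>

lemma uniform_limit_compose_compact:
  fixes G :: "real \<times> 'a::euclidean_space \<Rightarrow> 'b::metric_space"
  assumes G: "continuous_on ({0..\<Theta>} \<times> UNIV) G" and lim: "uniform_limit {0..\<Theta>} X U sequentially"
    and U: "continuous_on {0..\<Theta>} U"
  shows "uniform_limit {0..\<Theta>} (\<lambda>n s. G (s, X n s)) (\<lambda>s. G (s, U s)) sequentially"
proof -
  have "bounded (U ` {0..\<Theta>})" by (intro compact_imp_bounded compact_continuous_image U) auto
  then obtain R where R: "\<And>s. s \<in> {0..\<Theta>} \<Longrightarrow> norm (U s) \<le> R" unfolding bounded_iff by blast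
  have K: "compact ({0..\<Theta>} \<times> cball (0::'a) (R + 1))" by (intro compact_Times) auto
  have "continuous_on ({0..\<Theta>} \<times> cball 0 (R + 1)) G" by (rule continuous_on_subset[OF G]) auto
  hence uc: "uniformly_continuous_on ({0..\<Theta>} \<times> cball 0 (R + 1)) G"
    by (rule compact_uniformly_continuous[OF _ K])
  show ?thesis
  proof (rule uniform_limitI)
    fix e :: real assume "e > 0"
    then obtain d where d: "d > 0" "\<And>x y. x \<in> {0..\<Theta>} \<times> cball 0 (R + 1) \<Longrightarrow> y \<in> {0..\<Theta>} \<times> cball 0 (R + 1)
        \<Longrightarrow> dist y x < d \<Longrightarrow> dist (G y) (G x) < e"
      using uc unfolding uniformly_continuous_on_def by blast
    have "\<forall>\<^sub>F n in sequentially. \<forall>s\<in>{0..\<Theta>}. dist (X n s) (U s) < min d 1"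
      by (rule uniform_limitD[OF lim]) (use d in auto)
    thus "\<forall>\<^sub>F n in sequentially. \<forall>s\<in>{0..\<Theta>}. dist (G (s, X n s)) (G (s, U s)) < e"
    proof (rule eventually_mono, intro ballI)
      fix n s assume n: "\<forall>s\<in>{0..\<Theta>}. dist (X n s) (U s) < min d 1" and s: "s \<in> {0..\<Theta>}"
      have 1: "dist (X n s) (U s) < d" "norm (X n s - U s) < 1" using n s by (auto simp: dist_norm)
      have "norm (X n s) \<le> norm (U s) + norm (X n s - U s)" using norm_triangle_sub by blast
      hence "norm (X n s) \<le> R + 1" using 1 R[OF s] by linarith
      thus "dist (G (s, X n s)) (G (s, U s)) < e"
        using d(2)[of "(s, U s)" "(s, X n s)"] s 1 R[OF s] by (auto simp: dist_Pair_Pair)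
    qed
  qed
qed

text \<open>
  \<open>W\<close> solves the linearised equation along the fixed point \<open>U\<close>. The derivatives of the Picard
  iterates obey a recursion that is uniformly contracting towards \<open>W\<close>, hence \<open>U' = W\<close>; no
  modulus of continuity for \<open>F'\<close> is needed.
\<close>

theorem stretched_solution_exists:
  fixes F :: "real \<times> 'a::euclidean_space \<Rightarrow> 'a"
  assumes q: "0 < q" and c: "0 < c"
    and dF: "\<And>p. (F has_derivative F' p) (at p)"
    and cF': "continuous_on UNIV (\<lambda>(p, h). F' p h)"
    and lipF: "\<And>\<Theta>. 0 \<le> \<Theta> \<Longrightarrow> \<exists>L\<ge>0. \<forall>\<tau>\<in>{0..\<Theta>}. \<forall>u h. norm (F' (\<tau>, u) (0, h)) \<le> L * norm h"
  obtains U W where "continuous_on {0..} U" "continuous_on {0..} W" "U 0 = u0"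
    "\<And>\<tau>. 0 < \<tau> \<Longrightarrow> (U has_vector_derivative W \<tau>) (at \<tau>)"
    "\<And>\<tau>. 0 \<le> \<tau> \<Longrightarrow> W \<tau> = c *\<^sub>R stretch_avg q (\<lambda>s. F (s, U s) + s *\<^sub>R F' (s, U s) (1, W s)) \<tau>"
proof -
  have cF: "continuous_on A F" for A
    by (rule continuous_at_imp_continuous_on) (use dF has_derivative_continuous in blast)
  have cFU: "continuous_on A (\<lambda>s. F (s, U s))" if "continuous_on A U" for A U
    by (rule continuous_on_compose2[OF cF[of UNIV]]) (auto intro!: continuous_intros that)
  have cFUW: "continuous_on A (\<lambda>s. F' (s, U s) (h s))" if "continuous_on A U" "continuous_on A h" for A :: "real set" and U h
  proof -
    have "continuous_on A (\<lambda>s. ((s, U s), h s))" by (intro continuous_on_Pair continuous_on_id that)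
    from continuous_on_compose2[OF cF' this] show ?thesis by simp
  qed
  have lin: "linear (F' p)" for p using dF has_derivative_linear by blast
  have FLip: "norm (F (\<tau>, u) - F (\<tau>, v)) \<le> L * norm (u - v)"
    if "\<forall>\<tau>\<in>{0..\<Theta>}. \<forall>u h. norm (F' (\<tau>, u) (0, h)) \<le> L * norm h" "\<tau> \<in> {0..\<Theta>}" for L \<Theta> \<tau> u v
  proof (rule differentiable_bound[where S = UNIV and f' = "\<lambda>u h. F' (\<tau>, u) (0, h)"])
    fix u :: 'a
    have "((\<lambda>u. F (\<tau>, u)) has_derivative (\<lambda>h. F' (\<tau>, u) (0, h))) (at u)"
      by (rule has_derivative_compose[where f = "\<lambda>u. (\<tau>, u)", OF _ dF]) (auto intro!: derivative_eq_intros)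
    thus "((\<lambda>u. F (\<tau>, u)) has_derivative (\<lambda>h. F' (\<tau>, u) (0, h))) (at u within UNIV)" by simp
    show "onorm (\<lambda>h. F' (\<tau>, u) (0, h)) \<le> L" using that by (intro onorm_le) auto
  qed auto
  \<comment> \<open>\<Phi> is the Picard operator, and \<Psi> is its formal derivative: if U has
    derivative W, then \<Phi> U has derivative \<Psi> U W.\<close>
  define \<Phi> where "\<Phi> = (\<lambda>U \<tau>. u0 + c *\<^sub>R \<tau> *\<^sub>R stretch_avg q (\<lambda>s. F (s, U s)) \<tau>)"
  define \<Psi> where "\<Psi> = (\<lambda>U W \<tau>. c *\<^sub>R stretch_avg q (\<lambda>s. F (s, U s) + s *\<^sub>R F' (s, U s) (1, W s)) \<tau>)"
  have c\<Phi>: "continuous_on {0..} (\<Phi> U)" if "continuous_on {0..} U" for U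
    unfolding \<Phi>_def by (intro continuous_intros stretch_avg_continuous q cFU that)
  have c\<Psi>: "continuous_on {0..} (\<Psi> U W)" if "continuous_on {0..} U" "continuous_on {0..} W" for U W
    unfolding \<Psi>_def by (intro continuous_intros stretch_avg_continuous q cFU cFUW that)
  have lip\<Phi>: "\<exists>K\<ge>0. \<forall>U V. continuous_on {0..} U \<longrightarrow> continuous_on {0..} V \<longrightarrow>
       (\<forall>\<tau>\<in>{0..\<Theta>}. norm (\<Phi> U \<tau> - \<Phi> V \<tau>) \<le> K * \<tau> * stretch_avg q (\<lambda>s. norm (U s - V s)) \<tau>)"
    if \<Theta>: "0 \<le> \<Theta>" for \<Theta>
  proof -
    obtain L where L: "L \<ge> 0" "\<forall>\<tau>\<in>{0..\<Theta>}. \<forall>u h. norm (F' (\<tau>, u) (0, h)) \<le> L * norm h"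
      using lipF[OF \<Theta>] by blast
    show ?thesis
    proof (intro exI[of _ "c * L"] conjI allI impI ballI)
      fix U V :: "real \<Rightarrow> 'a" and \<tau> assume U: "continuous_on {0..} U" and V: "continuous_on {0..} V" and \<tau>: "\<tau> \<in> {0..\<Theta>}"
      have \<tau>0: "0 \<le> \<tau>" using \<tau> by simp
      have U': "continuous_on {0..\<tau>} U" and V': "continuous_on {0..\<tau>} V"
        by (rule continuous_on_subset[OF U] continuous_on_subset[OF V]; auto)+
      have "norm (\<Phi> U \<tau> - \<Phi> V \<tau>) = c * \<tau> * norm (stretch_avg q (\<lambda>s. F (s, U s)) \<tau> - stretch_avg q (\<lambda>s. F (s, V s)) \<tau>)"
        using c \<tau>0 by (simp add: \<Phi>_def scaleR_diff_right[symmetric])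
      also have "stretch_avg q (\<lambda>s. F (s, U s)) \<tau> - stretch_avg q (\<lambda>s. F (s, V s)) \<tau>
          = stretch_avg q (\<lambda>s. F (s, U s) - F (s, V s)) \<tau>"
        by (intro stretch_avg_diff q \<tau>0 cFU U' V')
      also have "c * \<tau> * norm \<dots> \<le> c * \<tau> * stretch_avg q (\<lambda>s. L * norm (U s - V s)) \<tau>"
        using \<tau> c by (intro mult_left_mono stretch_avg_norm_le q \<tau>0 continuous_intros cFU U' V' FLip[OF L(2)]) auto
      finally show "norm (\<Phi> U \<tau> - \<Phi> V \<tau>) \<le> c * L * \<tau> * stretch_avg q (\<lambda>s. norm (U s - V s)) \<tau>"
        by (simp add: stretch_avg_cmult mult_ac)
    qed (use c L in auto)
  qed
  \<comment> \<open>K is uniform in U, since the recursion for the derivatives uses the changing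
    iterates \<open>X n\<close> in that place.\<close>
  have lip\<Psi>: "\<exists>K\<ge>0. \<forall>U. continuous_on {0..} U \<longrightarrow> (\<forall>W V. continuous_on {0..} W \<longrightarrow> continuous_on {0..} V \<longrightarrow>
       (\<forall>\<tau>\<in>{0..\<Theta>}. norm (\<Psi> U W \<tau> - \<Psi> U V \<tau>) \<le> K * \<tau> * stretch_avg q (\<lambda>s. norm (W s - V s)) \<tau>))"
    if \<Theta>: "0 \<le> \<Theta>" for \<Theta>
  proof -
    obtain L where L: "L \<ge> 0" "\<forall>\<tau>\<in>{0..\<Theta>}. \<forall>u h. norm (F' (\<tau>, u) (0, h)) \<le> L * norm h"
      using lipF[OF \<Theta>] by blast
    show ?thesis
    proof (intro exI[of _ "c * L"] conjI allI impI ballI)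
      fix U W V :: "real \<Rightarrow> 'a" and \<tau> assume U: "continuous_on {0..} U" and W: "continuous_on {0..} W" and V: "continuous_on {0..} V"
        and \<tau>: "\<tau> \<in> {0..\<Theta>}"
      have \<tau>0: "0 \<le> \<tau>" using \<tau> by simp
      have U': "continuous_on {0..\<tau>} U" and V': "continuous_on {0..\<tau>} V" and W': "continuous_on {0..\<tau>} W"
        by (rule continuous_on_subset[OF U] continuous_on_subset[OF V] continuous_on_subset[OF W]; auto)+
      let ?g = "\<lambda>W s. F (s, U s) + s *\<^sub>R F' (s, U s) (1, W s)"
      have cg: "continuous_on {0..\<tau>} (?g W)" if "continuous_on {0..\<tau>} W" for W
        by (intro continuous_intros cFU cFUW U' that)
      have "norm (\<Psi> U W \<tau> - \<Psi> U V \<tau>) = c * norm (stretch_avg q (?g W) \<tau> - stretch_avg q (?g V) \<tau>)"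
        using c by (simp add: \<Psi>_def scaleR_diff_right[symmetric])
      also have "stretch_avg q (?g W) \<tau> - stretch_avg q (?g V) \<tau> = stretch_avg q (\<lambda>s. ?g W s - ?g V s) \<tau>"
        by (intro stretch_avg_diff q \<tau>0 cg V' W')
      also have "c * norm \<dots> \<le> c * stretch_avg q (\<lambda>s. \<tau> * L * norm (W s - V s)) \<tau>"
      proof (intro mult_left_mono stretch_avg_norm_le q \<tau>0)
        show "0 \<le> c" using c by simp
      next
        fix s assume s: "s \<in> {0..\<tau>}"
        have "F' (s, U s) (1, W s) - F' (s, U s) (1, V s) = F' (s, U s) (0, W s - V s)"
          by (simp add: linear_diff[OF lin, symmetric])
        hence "?g W s - ?g V s = s *\<^sub>R F' (s, U s) (0, W s - V s)" by (simp add: scaleR_diff_right[symmetric])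
        hence "norm (?g W s - ?g V s) = s * norm (F' (s, U s) (0, W s - V s))" using s by simp
        also have "\<dots> \<le> \<tau> * (L * norm (W s - V s))" using s \<tau> L by (intro mult_mono) auto
        finally show "norm (?g W s - ?g V s) \<le> \<tau> * L * norm (W s - V s)" by (simp add: mult_ac)
      next
        show "continuous_on {0..\<tau>} (\<lambda>s. ?g W s - ?g V s)" by (rule continuous_on_diff[OF cg[OF W'] cg[OF V']])
        show "continuous_on {0..\<tau>} (\<lambda>s. \<tau> * L * norm (W s - V s))" by (intro continuous_intros W' V')
      qed
      finally show "norm (\<Psi> U W \<tau> - \<Psi> U V \<tau>) \<le> c * L * \<tau> * stretch_avg q (\<lambda>s. norm (W s - V s)) \<tau>"
        by (simp add: stretch_avg_cmult mult_ac)
    qed (use c L in auto)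
  qed
  obtain U where U: "continuous_on {0..} U" and U\<Phi>: "\<And>\<tau>. 0 \<le> \<tau> \<Longrightarrow> \<Phi> U \<tau> = U \<tau>"
    and Ulim: "\<And>\<Theta>. 0 \<le> \<Theta> \<Longrightarrow> uniform_limit {0..\<Theta>} (\<lambda>n. (\<Phi> ^^ n) (\<lambda>_. u0)) U sequentially"
    using stretch_fixpoint[where T = \<Phi> and ?U0.0 = "\<lambda>_. u0", OF q c\<Phi> lip\<Phi> continuous_on_const] by blast
  have lip\<Psi>U: "\<exists>K\<ge>0. \<forall>W V. continuous_on {0..} W \<longrightarrow> continuous_on {0..} V \<longrightarrow>
       (\<forall>\<tau>\<in>{0..\<Theta>}. norm (\<Psi> U W \<tau> - \<Psi> U V \<tau>) \<le> K * \<tau> * stretch_avg q (\<lambda>s. norm (W s - V s)) \<tau>)"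
    if "0 \<le> \<Theta>" for \<Theta>
    using lip\<Psi>[OF that] U by blast
  obtain W where W: "continuous_on {0..} W" and W\<Psi>: "\<And>\<tau>. 0 \<le> \<tau> \<Longrightarrow> \<Psi> U W \<tau> = W \<tau>"
  proof (rule stretch_fixpoint[where T = "\<Psi> U" and ?U0.0 = "\<lambda>_. 0", OF q])
    show "continuous_on {0..} V \<Longrightarrow> continuous_on {0..} (\<Psi> U V)" for V by (rule c\<Psi>[OF U])
  qed (rule lip\<Psi>U continuous_on_const that; assumption)+
  define X where "X = (\<lambda>n. (\<Phi> ^^ n) (\<lambda>_. u0))"
  define Y where "Y = rec_nat (\<lambda>_. 0) (\<lambda>n Y. \<Psi> (X n) Y)"
  have XS: "X 0 = (\<lambda>_. u0)" "X (Suc n) = \<Phi> (X n)" and YS: "Y 0 = (\<lambda>_. 0)" "Y (Suc n) = \<Psi> (X n) (Y n)" for n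
    by (auto simp: X_def Y_def)
  have cX: "continuous_on {0..} (X n)" for n
    by (induction n) (auto simp: XS c\<Phi>)
  have cY: "continuous_on {0..} (Y n)" for n
    by (induction n) (auto simp: YS c\<Psi> cX)
  have dX: "0 \<le> \<tau> \<Longrightarrow> (X n has_vector_derivative Y n \<tau>) (at \<tau> within {0..})" for n \<tau>
  proof (induction n arbitrary: \<tau>)
    case (Suc n)
    have "((\<lambda>s. F (s, X n s)) has_vector_derivative F' (s, X n s) (1, Y n s)) (at s within {0..})" if "0 \<le> s" for s
    proof -
      have "((\<lambda>s. (s, X n s)) has_vector_derivative (1, Y n s)) (at s within {0..})"
        by (intro has_vector_derivative_Pair Suc.IH that) auto
      from vector_derivative_diff_chain_within[OF this has_derivative_at_withinI[OF dF]]
      show ?thesis by (simp add: o_def)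
    qed
    moreover have "continuous_on {0..} (\<lambda>s. F' (s, X n s) (1, Y n s))"
      by (intro cFUW cX continuous_on_Pair continuous_on_const cY)
    ultimately have "((\<lambda>\<tau>. \<tau> *\<^sub>R stretch_avg q (\<lambda>s. F (s, X n s)) \<tau>) has_vector_derivative
        stretch_avg q (\<lambda>s. F (s, X n s) + s *\<^sub>R F' (s, X n s) (1, Y n s)) \<tau>) (at \<tau> within {0..})"
      by (intro stretch_avg_has_vector_derivative q Suc.prems)
    from has_vector_derivative_add[OF has_vector_derivative_const
        bounded_linear.has_vector_derivative[OF bounded_linear_scaleR_right this], of u0 c]
    show ?case unfolding XS YS \<Phi>_def \<Psi>_def by simp
  qed (auto simp: XS YS)
  have Ylim: "uniform_limit {0..\<Theta>} Y W sequentially" if \<Theta>: "0 \<le> \<Theta>" for \<Theta>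
  proof (rule uniform_limitI)
    fix e :: real assume e: "e > 0"
    obtain K where K: "K \<ge> 0" and KL: "\<And>U W V \<tau>. continuous_on {0..} U \<Longrightarrow> continuous_on {0..} W \<Longrightarrow> continuous_on {0..} V \<Longrightarrow>
        \<tau> \<in> {0..\<Theta>} \<Longrightarrow> norm (\<Psi> U W \<tau> - \<Psi> U V \<tau>) \<le> K * \<tau> * stretch_avg q (\<lambda>s. norm (W s - V s)) \<tau>"
      using lip\<Psi>[OF \<Theta>] by blast
    let ?d = "\<lambda>n \<tau>. norm (Y n \<tau> - W \<tau>)"
    have "\<forall>\<^sub>F n in sequentially. \<forall>\<tau>\<in>{0..\<Theta>}. ?d n \<tau> < e"
    proof (rule stretch_gronwall_limit[OF q K \<Theta> _ _ e])
      show "continuous_on {0..\<Theta>} (?d n)" for n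
        by (intro continuous_intros continuous_on_subset[OF cY] continuous_on_subset[OF W]) auto
      fix e :: real assume e: "e > 0"
      let ?G = "\<lambda>(s, u). F (s, u) + s *\<^sub>R F' (s, u) (1, W s)"
      have "continuous_on ({0..\<Theta>} \<times> UNIV) (\<lambda>p. F' p (1, W (fst p)))"
      proof -
        have "continuous_on ({0..\<Theta>} \<times> UNIV) (\<lambda>p. (p, (1::real, W (fst p))))"
          by (intro continuous_on_Pair continuous_on_id continuous_on_const continuous_on_compose2[OF W] continuous_on_fst) auto
        from continuous_on_compose2[OF cF' this] show ?thesis by simp
      qed
      hence "continuous_on ({0..\<Theta>} \<times> UNIV) (\<lambda>p. F p + fst p *\<^sub>R F' p (1, W (fst p)))"
        by (intro continuous_intros cF)
      hence "continuous_on ({0..\<Theta>} \<times> UNIV) ?G" by (simp add: case_prod_unfold)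
      moreover have "uniform_limit {0..\<Theta>} X U sequentially" unfolding X_def by (rule Ulim[OF \<Theta>])
      moreover have "continuous_on {0..\<Theta>} U" by (rule continuous_on_subset[OF U]) auto
      ultimately have "uniform_limit {0..\<Theta>} (\<lambda>n s. ?G (s, X n s)) (\<lambda>s. ?G (s, U s)) sequentially"
        by (rule uniform_limit_compose_compact)
      from uniform_limitD[OF this, of "e / c"] e c
      have "\<forall>\<^sub>F n in sequentially. \<forall>s\<in>{0..\<Theta>}. dist (?G (s, X n s)) (?G (s, U s)) < e / c" by simp
      thus "\<forall>\<^sub>F n in sequentially. \<forall>\<tau>\<in>{0..\<Theta>}. ?d (Suc n) \<tau> \<le> K * \<tau> * stretch_avg q (?d n) \<tau> + e"
      proof (rule eventually_mono, intro ballI)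
        fix n \<tau> assume n: "\<forall>s\<in>{0..\<Theta>}. dist (?G (s, X n s)) (?G (s, U s)) < e / c" and \<tau>: "\<tau> \<in> {0..\<Theta>}"
        have \<tau>0: "0 \<le> \<tau>" using \<tau> by simp
        have sub: "{0..\<tau>} \<subseteq> {0..}" by auto
        note c' = continuous_on_subset[OF _ sub]
        let ?g = "\<lambda>U s. F (s, U s) + s *\<^sub>R F' (s, U s) (1, W s)"
        have cg: "continuous_on {0..\<tau>} (?g V)" if "continuous_on {0..} V" for V
          by (intro continuous_intros cFU cFUW c'[OF that] c'[OF W])
        have "norm (\<Psi> (X n) W \<tau> - \<Psi> U W \<tau>) = c * norm (stretch_avg q (?g (X n)) \<tau> - stretch_avg q (?g U) \<tau>)"
          using c by (simp add: \<Psi>_def scaleR_diff_right[symmetric])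
        also have "stretch_avg q (?g (X n)) \<tau> - stretch_avg q (?g U) \<tau> = stretch_avg q (\<lambda>s. ?g (X n) s - ?g U s) \<tau>"
          by (rule stretch_avg_diff[OF q \<tau>0 cg[OF cX] cg[OF U]])
        also have "c * norm \<dots> \<le> c * (e / c)"
        proof (intro mult_left_mono stretch_avg_norm_bound[OF q \<tau>0 continuous_on_diff[OF cg[OF cX] cg[OF U]]])
          fix s assume "s \<in> {0..\<tau>}"
          thus "norm (?g (X n) s - ?g U s) \<le> e / c" using n \<tau> by (force simp: dist_norm)
        qed (use c in simp)
        finally have 1: "norm (\<Psi> (X n) W \<tau> - \<Psi> U W \<tau>) \<le> e" using c by simp
        \<comment> \<open>The first difference contracts with \<open>X n\<close> fixed; the second
          is the error of replacing U by \<open>X n\<close>, which tends to 0 uniformly.\<close>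
        have "Y (Suc n) \<tau> - W \<tau> = (\<Psi> (X n) (Y n) \<tau> - \<Psi> (X n) W \<tau>) + (\<Psi> (X n) W \<tau> - \<Psi> U W \<tau>)"
          using W\<Psi>[OF \<tau>0] by (simp add: YS)
        hence "?d (Suc n) \<tau> \<le> norm (\<Psi> (X n) (Y n) \<tau> - \<Psi> (X n) W \<tau>) + norm (\<Psi> (X n) W \<tau> - \<Psi> U W \<tau>)"
          using norm_triangle_ineq by metis
        thus "?d (Suc n) \<tau> \<le> K * \<tau> * stretch_avg q (?d n) \<tau> + e"
          using KL[OF cX cY W \<tau>, of n n] 1 by linarith
      qed
    qed
    thus "\<forall>\<^sub>F n in sequentially. \<forall>\<tau>\<in>{0..\<Theta>}. dist (Y n \<tau>) (W \<tau>) < e" by (simp add: dist_norm)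
  qed
  \<comment> \<open>Obtained as the limit of the fundamental theorem for the pairs
    \<open>X n\<close>, \<open>Y n\<close>.\<close>
  have Wint: "(W has_integral U \<tau> - U 0) {0..\<tau>}" if \<tau>: "0 \<le> \<tau>" for \<tau>
  proof -
    obtain I J where I: "\<And>n. (Y n has_integral I n) {0..\<tau>}" and J: "(W has_integral J) {0..\<tau>}"
      and IJ: "I \<longlonglongrightarrow> J"
      by (rule uniform_limit_integral[OF Ylim[OF \<tau>]]) (auto intro: continuous_on_subset[OF cY])
    have "(Y n has_integral X n \<tau> - X n 0) {0..\<tau>}" for n
      by (rule fundamental_theorem_of_calculus[OF \<tau>])
         (auto intro: has_vector_derivative_within_subset[OF dX])
    hence "I = (\<lambda>n. X n \<tau> - X n 0)" using has_integral_unique[OF I] by blast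
    moreover have "(\<lambda>n. X n \<tau> - X n 0) \<longlonglongrightarrow> U \<tau> - U 0"
      using tendsto_uniform_limitI[OF Ulim[OF \<tau>]] \<tau> unfolding X_def by (intro tendsto_diff) auto
    ultimately have "J = U \<tau> - U 0" using LIMSEQ_unique[OF IJ] by simp
    thus ?thesis using J by simp
  qed
  have dU: "(U has_vector_derivative W \<tau>) (at \<tau>)" if \<tau>: "0 < \<tau>" for \<tau>
  proof -
    have "((\<lambda>u. integral {0..u} W) has_vector_derivative W \<tau>) (at \<tau> within {0..\<tau> + 1})"
      by (rule integral_has_vector_derivative) (use \<tau> in \<open>auto intro: continuous_on_subset[OF W]\<close>)
    hence "((\<lambda>u. U 0 + integral {0..u} W) has_vector_derivative W \<tau>) (at \<tau> within {0..\<tau> + 1})"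
      by (auto intro!: derivative_eq_intros)
    moreover have "at \<tau> within {0..\<tau> + 1} = at \<tau>" using \<tau> by (intro at_within_interior) auto
    ultimately have "((\<lambda>u. U 0 + integral {0..u} W) has_vector_derivative W \<tau>) (at \<tau>)" by simp
    thus ?thesis
      by (rule has_vector_derivative_transform_within_open[of _ _ _ "{0<..}"])
         (use \<tau> integral_unique[OF Wint] in auto)
  qed
  have "U 0 = u0" using U\<Phi>[of 0] by (simp add: \<Phi>_def)
  moreover have "W \<tau> = c *\<^sub>R stretch_avg q (\<lambda>s. F (s, U s) + s *\<^sub>R F' (s, U s) (1, W s)) \<tau>" if "0 \<le> \<tau>" for \<tau>
    using W\<Psi>[OF that] by (simp add: \<Psi>_def)
  ultimately show thesis using that[OF U W _ dU] by blast
qed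

text \<open>The solution is U(t^q) for the stretched fixed point U. The density M is the derivative
  of \<tau> F(\<tau>, U \<tau>), as \<open>caputo_stretched\<close> requires. The field receives t^q
  as an argument so that a cut-off radius may vary with time.\<close>

theorem caputo_solution_exists:
  fixes F :: "real \<times> (real^'n) \<Rightarrow> real^'n"
  assumes q: "0 < q" "q < 1"
    and dF: "\<And>p. (F has_derivative F' p) (at p)"
    and cF': "continuous_on UNIV (\<lambda>(p, h). F' p h)"
    and lipF: "\<And>\<Theta>. 0 \<le> \<Theta> \<Longrightarrow> \<exists>L\<ge>0. \<forall>\<tau>\<in>{0..\<Theta>}. \<forall>u h. norm (F' (\<tau>, u) (0, h)) \<le> L * norm h"
  obtains x where "x 0 = u0" "continuous_on {0..} x" "\<And>i. caputo_regular q (\<lambda>t. x t $ i)"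
    "\<And>t. 0 < t \<Longrightarrow> (\<chi> i. caputo_deriv q (\<lambda>s. x s $ i) t) = F (t powr q, x t)"
proof -
  have G: "Gamma (q + 1) > 0" using q by (intro Gamma_real_pos) auto
  have c: "0 < 1 / Gamma (q + 1)" using G by simp
  obtain U W where U: "continuous_on {0..} U" and W: "continuous_on {0..} W" and U0: "U 0 = u0"
    and dU: "\<And>\<tau>. 0 < \<tau> \<Longrightarrow> (U has_vector_derivative W \<tau>) (at \<tau>)"
    and WM: "\<And>\<tau>. 0 \<le> \<tau> \<Longrightarrow> W \<tau> = (1 / Gamma (q + 1)) *\<^sub>R stretch_avg q (\<lambda>s. F (s, U s) + s *\<^sub>R F' (s, U s) (1, W s)) \<tau>"
    using stretched_solution_exists[OF q(1) c dF cF' lipF, of u0] by blast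
  define M where "M = (\<lambda>s. F (s, U s) + s *\<^sub>R F' (s, U s) (1, W s))"
  have cF: "continuous_on A F" for A
    by (rule continuous_at_imp_continuous_on) (use dF has_derivative_continuous in blast)
  have cFU: "continuous_on {0..} (\<lambda>s. F (s, U s))"
    by (rule continuous_on_compose2[OF cF[of UNIV]]) (auto intro!: continuous_intros U)
  have "continuous_on {0..} (\<lambda>s. ((s, U s), (1::real, W s)))"
    by (intro continuous_on_Pair continuous_on_id continuous_on_const U W)
  from continuous_on_compose2[OF cF' this] have "continuous_on {0..} (\<lambda>s. F' (s, U s) (1, W s))" by simp
  hence cM: "continuous_on {0..} M" unfolding M_def by (intro continuous_intros cFU)
  have MH: "(M has_integral \<tau> *\<^sub>R F (\<tau>, U \<tau>)) {0..\<tau>}" if \<tau>: "0 \<le> \<tau>" for \<tau>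
  proof -
    have "(M has_integral \<tau> *\<^sub>R F (\<tau>, U \<tau>) - 0 *\<^sub>R F (0, U 0)) {0..\<tau>}"
    proof (rule fundamental_theorem_of_calculus_interior[OF \<tau>])
      show "continuous_on {0..\<tau>} (\<lambda>s. s *\<^sub>R F (s, U s))"
        by (intro continuous_intros continuous_on_subset[OF cFU]) auto
      fix s assume s: "s \<in> {0<..<\<tau>}"
      have "((\<lambda>s. (s, U s)) has_vector_derivative (1, W s)) (at s)"
        using s by (intro has_vector_derivative_Pair dU) auto
      from vector_derivative_diff_chain_within[OF this has_derivative_at_withinI[OF dF]]
      have "((\<lambda>s. F (s, U s)) has_vector_derivative F' (s, U s) (1, W s)) (at s)" by (simp add: o_def)
      from has_vector_derivative_scaleR[OF DERIV_ident this]
      show "((\<lambda>s. s *\<^sub>R F (s, U s)) has_vector_derivative M s) (at s)" by (simp add: M_def add.commute)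
    qed
    thus ?thesis by simp
  qed
  let ?x = "\<lambda>t. U (t powr q)"
  have comp: "stretch_avg q (\<lambda>s. M s $ i) \<tau> = stretch_avg q M \<tau> $ i" if "0 \<le> \<tau>" for \<tau> i
  proof -
    have "continuous_on {0..\<tau>} M" by (rule continuous_on_subset[OF cM]) auto
    hence "(\<lambda>p. M (\<tau> * stretch q p)) integrable_on {0..1}"
      using that by (intro integrable_continuous_real stretch_comp_continuous[OF q(1), of \<tau> \<tau>]) auto
    from integral_linear[OF this bounded_linear_vec_nth[of i]] show ?thesis by (simp add: stretch_avg_def o_def)
  qed
  have reg: "caputo_regular q (\<lambda>t. ?x t $ i)"
    and D: "t > 0 \<Longrightarrow> caputo_deriv q (\<lambda>t. ?x t $ i) t = F (t powr q, ?x t) $ i" for i t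
  proof -
    have 1: "((\<lambda>s. U s $ i) has_real_derivative W \<tau> $ i) (at \<tau>)" if "\<tau> > 0" for \<tau>
      using bounded_linear.has_vector_derivative[OF bounded_linear_vec_nth dU[OF that]]
      by (simp add: has_real_derivative_iff_has_vector_derivative)
    have 2: "continuous_on {0..} (\<lambda>s. U s $ i)" "continuous_on {0..} (\<lambda>s. M s $ i)"
      by (intro continuous_intros U cM)+
    have 3: "W \<tau> $ i = stretch_avg q (\<lambda>s. M s $ i) \<tau> / Gamma (q + 1)" if "\<tau> > 0" for \<tau>
      using WM[of \<tau>] that by (simp add: comp M_def[symmetric])
    have 4: "((\<lambda>s. M s $ i) has_integral \<tau> * (F (\<tau>, U \<tau>) $ i)) {0..\<tau>}" if "0 \<le> \<tau>" for \<tau>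
      using has_integral_linear[OF MH[OF that] bounded_linear_vec_nth[of i]] by (simp add: o_def)
    note C = caputo_stretched[where U = "\<lambda>s. U s $ i" and W = "\<lambda>s. W s $ i" and M = "\<lambda>s. M s $ i"
        and H = "\<lambda>\<tau>. F (\<tau>, U \<tau>) $ i", OF q 1 2 3 4]
    show "caputo_regular q (\<lambda>t. ?x t $ i)" by (rule C(1))
    show "t > 0 \<Longrightarrow> caputo_deriv q (\<lambda>t. ?x t $ i) t = F (t powr q, ?x t) $ i" by (rule C(2))
  qed
  show thesis
  proof (rule that[of ?x])
    show "?x 0 = u0" using U0 by simp
    show "continuous_on {0..} ?x"
      by (rule continuous_on_compose2[OF U]) (use q in \<open>auto intro!: powr_continuous_on_nonneg\<close>)
  qed (use reg D in \<open>auto simp: vec_eq_iff\<close>)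
qed

section \<open>Instability\<close>

definition stokes_lin :: "real \<Rightarrow> real \<Rightarrow> real \<Rightarrow> real^3 \<Rightarrow> real^3" where
  "stokes_lin b1 b3 k u = (k * u$1 - b3 * u$2) *\<^sub>R axis 1 1 + (b3 * u$1 - b1 * u$3) *\<^sub>R axis 2 1
     + (b1 * u$2 + k * u$3) *\<^sub>R axis 3 1"

text \<open>A bilinear map with the quadratic part of the field on its diagonal, which gives access
  to the product rules for \<open>bounded_bilinear\<close>.\<close>

definition stokes_quad :: "real \<Rightarrow> real \<Rightarrow> real \<Rightarrow> real^3 \<Rightarrow> real^3 \<Rightarrow> real^3" where
  "stokes_quad l1 l2 l3 u v = ((l2 - l3) * (u$2 * v$3)) *\<^sub>R axis 1 1 + ((l3 - l1) * (u$3 * v$1)) *\<^sub>R axis 2 1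
     + ((l1 - l2) * (u$1 * v$2)) *\<^sub>R axis 3 1"

lemma stokes_field_split:
  "stokes_field l1 l2 l3 b1 b3 k u = stokes_lin b1 b3 k u + stokes_quad l1 l2 l3 u u"
  by (simp add: stokes_field_def stokes_lin_def stokes_quad_def vec_eq_iff forall_3 axis_def)

lemma stokes_lin_inner: "u \<bullet> stokes_lin b1 b3 k u = k * ((u$1)\<^sup>2 + (u$3)\<^sup>2)"
  by (simp add: stokes_lin_def inner_vec_def sum_3 axis_def power2_eq_square algebra_simps)

text \<open>Any scalar multiple of the quadratic part remains orthogonal to u, so truncating this
  part alone preserves the energy identity.\<close>

lemma stokes_quad_inner: "u \<bullet> stokes_quad l1 l2 l3 u u = 0"
  by (simp add: stokes_quad_def inner_vec_def sum_3 axis_def algebra_simps)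

lemma stokes_lin_bounded: "bounded_linear (stokes_lin b1 b3 k)"
proof -
  have "linear (stokes_lin b1 b3 k)"
    by (rule linearI) (simp_all add: stokes_lin_def vec_eq_iff forall_3 axis_def algebra_simps)
  thus ?thesis by (simp add: linear_conv_bounded_linear)
qed

lemma stokes_quad_bilinear: "bounded_bilinear (stokes_quad l1 l2 l3)"
  unfolding bilinear_conv_bounded_bilinear[symmetric] bilinear_def
  by (auto intro!: linearI simp: stokes_quad_def vec_eq_iff forall_3 axis_def algebra_simps)

text \<open>The C^1 building block of the cut-off. At 0 the difference quotient in h is
  \<open>max 0 h\<close>.\<close>

lemma pos_part_square_derivative:
  "((\<lambda>s::real. (max 0 s)\<^sup>2) has_real_derivative 2 * max 0 s) (at s)"
proof -
  consider "s < 0" | "s > 0" | "s = 0" by linarith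
  thus ?thesis
  proof cases
    case 1
    have "((\<lambda>s::real. 0) has_real_derivative 2 * max 0 s) (at s)" using 1 by simp
    thus ?thesis by (rule has_field_derivative_transform_within_open[of _ _ _ "{..<0}"]) (use 1 in auto)
  next
    case 2
    have "((\<lambda>s::real. s\<^sup>2) has_real_derivative 2 * max 0 s) (at s)"
      using 2 by (auto intro!: derivative_eq_intros)
    thus ?thesis by (rule has_field_derivative_transform_within_open[of _ _ _ "{0<..}"]) (use 2 in auto)
  next
    case 3
    have "((\<lambda>h::real. max 0 h) \<longlongrightarrow> max 0 0) (at 0)" by (intro tendsto_intros)
    moreover have "\<forall>\<^sub>F h in at (0::real). max 0 h = (max 0 h)\<^sup>2 / h"
      by (auto simp: eventually_at_filter max_def power2_eq_square)
    ultimately have "((\<lambda>h::real. (max 0 h)\<^sup>2 / h) \<longlongrightarrow> 0) (at 0)"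
      using filterlim_cong[OF refl refl] by (force simp: tendsto_cong)
    thus ?thesis using 3 by (simp add: DERIV_def)
  qed
qed

text \<open>
  The scalar factor \<open>\<phi>\<close> is a \<open>C\<^sup>1\<close> function of \<open>|u|\<^sup>2 - R \<tau>\<close> that is 1 on the negative axis
  and vanishes beyond 1.
\<close>

lemma truncated_stokes_solution:
  fixes R R' :: "real \<Rightarrow> real" and u0 :: "real^3"
  assumes q: "0 < q" "q < 1"
    and dR: "\<And>s. (R has_real_derivative R' s) (at s)" and cR': "continuous_on UNIV R'"
    and mono: "\<And>a b. 0 \<le> a \<Longrightarrow> a \<le> b \<Longrightarrow> R a \<le> R b"
  obtains x \<phi> where "x 0 = u0" "continuous_on {0..} x" "\<And>i. caputo_regular q (\<lambda>t. x t $ i)"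
    "\<And>t. 0 < t \<Longrightarrow> (\<chi> i. caputo_deriv q (\<lambda>s. x s $ i) t)
        = stokes_lin b1 b3 k (x t) + \<phi> t *\<^sub>R stokes_quad l1 l2 l3 (x t) (x t)"
    "\<And>t. (norm (x t))\<^sup>2 \<le> R (t powr q) \<Longrightarrow> \<phi> t = 1"
proof -
  let ?L = "stokes_lin b1 b3 k" and ?B = "stokes_quad l1 l2 l3"
  interpret L: bounded_linear ?L by (rule stokes_lin_bounded)
  interpret B: bounded_bilinear ?B by (rule stokes_quad_bilinear)
  define a where "a = (\<lambda>s::real. (max 0 s)\<^sup>2)"
  define S where "S = (\<lambda>p::real \<times> (real^3). snd p \<bullet> snd p - R (fst p))"
  define S' where "S' = (\<lambda>(p::real \<times> (real^3)) h. (snd p \<bullet> snd h + snd h \<bullet> snd p) - fst h * R' (fst p))"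
  define \<phi> where "\<phi> = (\<lambda>p. a (1 - a (S p)))"
  define \<phi>' where "\<phi>' = (\<lambda>p h. - (S' p h * (2 * max 0 (S p))) * (2 * max 0 (1 - a (S p))))"
  define F where "F = (\<lambda>p::real \<times> (real^3). ?L (snd p) + \<phi> p *\<^sub>R ?B (snd p) (snd p))"
  define F' where "F' = (\<lambda>(p::real \<times> (real^3)) h. ?L (snd h) +
      (\<phi> p *\<^sub>R (?B (snd p) (snd h) + ?B (snd h) (snd p)) + \<phi>' p h *\<^sub>R ?B (snd p) (snd p)))"
  have da: "(a has_real_derivative 2 * max 0 s) (at s)" for s
    unfolding a_def by (rule pos_part_square_derivative)
  have cR: "continuous_on UNIV R" using dR by (auto intro!: DERIV_continuous_on)
  have dsnd: "(snd has_derivative snd) (at p)" for p :: "real \<times> (real^3)"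
    by (rule bounded_linear_imp_has_derivative[OF bounded_linear_snd])
  have dfst: "(fst has_derivative fst) (at p)" for p :: "real \<times> (real^3)"
    by (rule bounded_linear_imp_has_derivative[OF bounded_linear_fst])
  have dS: "(S has_derivative S' p) (at p)" for p
    unfolding S_def S'_def
    by (intro has_derivative_diff has_derivative_inner dsnd DERIV_compose_FDERIV[OF dR dfst])
  have d1: "((\<lambda>p. 1 - a (S p)) has_derivative (\<lambda>h. - (S' p h * (2 * max 0 (S p))))) (at p)" for p
    using has_derivative_diff[OF has_derivative_const DERIV_compose_FDERIV[OF da dS], of 1 p] by simp
  have d\<phi>: "(\<phi> has_derivative \<phi>' p) (at p)" for p
    unfolding \<phi>_def \<phi>'_def using DERIV_compose_FDERIV[OF da d1] .
  have dF: "(F has_derivative F' p) (at p)" for p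
    unfolding F_def F'_def
    by (intro has_derivative_add L.has_derivative has_derivative_scaleR d\<phi> B.FDERIV dsnd)
  have cS: "continuous_on A (\<lambda>x. S (f x))" if "continuous_on A f" for A :: "'z::topological_space set" and f
    unfolding S_def by (intro continuous_intros continuous_on_compose2[OF cR] that) auto
  have ca: "continuous_on A (\<lambda>x. a (f x))" if "continuous_on A f" for A :: "'z::topological_space set" and f
    unfolding a_def by (intro continuous_intros that)
  have cF': "continuous_on UNIV (\<lambda>(p, h). F' p h)"
    unfolding F'_def \<phi>_def \<phi>'_def S'_def case_prod_unfold
    by (intro continuous_intros L.continuous_on B.continuous_on cS ca continuous_on_compose2[OF cR']) auto
  have lipF: "\<exists>L\<ge>0. \<forall>\<tau>\<in>{0..\<Theta>}. \<forall>u h. norm (F' (\<tau>, u) (0, h)) \<le> L * norm h" if \<Theta>: "0 \<le> \<Theta>" for \<Theta>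
  proof -
    \<comment> \<open>For |u|^2 \<le> r the derivative is bounded by compactness and homogeneity in
      h. Beyond r the cut-off and its derivative vanish and only the linear part remains.\<close>
    define r where "r = R \<Theta> + 1"
    define K where "K = ({0..\<Theta>} \<times> cball (0::real^3) (sqrt \<bar>r\<bar>)) \<times> ({0::real} \<times> sphere (0::real^3) 1)"
    have "compact K" unfolding K_def by (intro compact_Times) auto
    hence "bounded ((\<lambda>(p, h). F' p h) ` K)"
      by (intro compact_imp_bounded compact_continuous_image continuous_on_subset[OF cF']) auto
    then obtain C where C: "C > 0" "\<And>z. z \<in> K \<Longrightarrow> norm ((\<lambda>(p, h). F' p h) z) \<le> C"
      unfolding bounded_pos by blast
    obtain D where D: "D > 0" "\<And>h. norm (?L h) \<le> norm h * D" using L.pos_bounded by blast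
    show ?thesis
    proof (intro exI[of _ "C + D"] conjI ballI allI)
      fix \<tau> u h assume \<tau>: "\<tau> \<in> {0..\<Theta>}"
      show "norm (F' (\<tau>, u) (0, h)) \<le> (C + D) * norm h"
      proof (cases "(norm u)\<^sup>2 \<le> r")
        case True
        hence r: "norm u \<le> sqrt \<bar>r\<bar>" by (intro real_le_rsqrt) auto
        show ?thesis
        proof (cases "h = 0")
          case True
          have "linear (F' (\<tau>, u))" using dF has_derivative_linear by blast
          from linear_0[OF this] have "F' (\<tau>, u) (0, 0) = 0" by (simp add: zero_prod_def)
          thus ?thesis using True by simp
        next
          case False
          define g where "g = h /\<^sub>R norm h"
          have "linear (F' (\<tau>, u))" using dF has_derivative_linear by blast
          from linear_scale[OF this, of "norm h" "(0, g)"]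
          have "F' (\<tau>, u) (0, h) = norm h *\<^sub>R F' (\<tau>, u) (0, g)" using False by (simp add: g_def)
          moreover have "norm (F' (\<tau>, u) (0, g)) \<le> C"
            using C(2)[of "((\<tau>, u), (0, g))"] \<tau> r False by (simp add: K_def g_def)
          ultimately have "norm (F' (\<tau>, u) (0, h)) \<le> norm h * C" by (simp add: mult_left_mono)
          thus ?thesis using D by (simp add: algebra_simps add_increasing2)
        qed
      next
        case False
        have "R \<tau> \<le> R \<Theta>" using \<tau> by (intro mono) auto
        hence S1: "S (\<tau>, u) > 1" using False by (simp add: S_def r_def power2_norm_eq_inner)
        hence "1 \<le> (S (\<tau>, u))\<^sup>2" by (intro one_le_power) simp
        hence "a (S (\<tau>, u)) \<ge> 1" using S1 by (simp add: a_def)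
        hence "F' (\<tau>, u) (0, h) = ?L h" by (simp add: F'_def \<phi>_def \<phi>'_def a_def)
        moreover have "0 \<le> C * norm h" using C by simp
        ultimately show ?thesis using D(2)[of h] by (simp add: algebra_simps)
      qed
    qed (use C D in simp)
  qed
  obtain x where x: "x 0 = u0" "continuous_on {0..} x" "\<And>i. caputo_regular q (\<lambda>t. x t $ i)"
    "\<And>t. 0 < t \<Longrightarrow> (\<chi> i. caputo_deriv q (\<lambda>s. x s $ i) t) = F (t powr q, x t)"
    using caputo_solution_exists[OF q dF cF' lipF, of u0] by blast
  show thesis
  proof (rule that[of x "\<lambda>t. \<phi> (t powr q, x t)"])
    fix t
    show "(norm (x t))\<^sup>2 \<le> R (t powr q) \<Longrightarrow> \<phi> (t powr q, x t) = 1"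
      by (simp add: \<phi>_def a_def S_def power2_norm_eq_inner)
    show "0 < t \<Longrightarrow> (\<chi> i. caputo_deriv q (\<lambda>s. x s $ i) t)
        = stokes_lin b1 b3 k (x t) + \<phi> (t powr q, x t) *\<^sub>R stokes_quad l1 l2 l3 (x t) (x t)"
      using x(4) by (simp add: F_def)
  qed (use x in auto)
qed

section \<open>Global solutions and growth along the eigenline\<close>

text \<open>The growth bound needs only the energy inequality, which the truncated system also
  satisfies. With a cut-off radius above that bound, the truncated solution solves the original
  system.\<close>

theorem stokes_solution_exists:
  fixes u0 :: "real^3"
  assumes q: "0 < q" "q < 1" and k: "0 < k" and u0: "u0 \<noteq> 0"
  obtains x where "caputo_solution q (stokes_field l1 l2 l3 b1 b3 k) x" "x 0 = u0"
proof -
  define m where "m = k powr (1 / q)"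
  have m: "m > 0" using k by (simp add: m_def)
  define c where "c = growth_const q * norm u0"
  \<comment> \<open>For n \<ge> 1/q one has t \<le> 1 + (t^q)^n, so a polynomial in \<tau> dominates
    t and R is differentiable on the whole line.\<close>
  obtain n :: nat where n: "1 / q \<le> real n" using real_arch_simple by blast
  define R where "R = (\<lambda>s. c\<^sup>2 * exp (2 * m * (1 + s ^ n)))"
  define R' where "R' = (\<lambda>s. c\<^sup>2 * (exp (2 * m * (1 + s ^ n)) * (2 * m * (real n * s ^ (n - 1)))))"
  have dR: "(R has_real_derivative R' s) (at s)" for s
    unfolding R_def R'_def by (auto intro!: derivative_eq_intros)
  have cR': "continuous_on UNIV R'" unfolding R'_def by (intro continuous_intros)
  have mono: "R a \<le> R b" if "0 \<le> a" "a \<le> b" for a b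
    unfolding R_def using that m by (intro mult_left_mono) (auto intro!: mult_left_mono power_mono)
  obtain x \<phi> where x: "x 0 = u0" "continuous_on {0..} x" "\<And>i. caputo_regular q (\<lambda>t. x t $ i)"
    and D: "\<And>t. 0 < t \<Longrightarrow> (\<chi> i. caputo_deriv q (\<lambda>s. x s $ i) t)
        = stokes_lin b1 b3 k (x t) + \<phi> t *\<^sub>R stokes_quad l1 l2 l3 (x t) (x t)"
    and one: "\<And>t. (norm (x t))\<^sup>2 \<le> R (t powr q) \<Longrightarrow> \<phi> t = 1"
    using truncated_stokes_solution[OF q dR cR' mono, of u0 b1 b3 k l1 l2 l3] by blast
  have diss: "x t \<bullet> (\<chi> i. caputo_deriv q (\<lambda>s. x s $ i) t) \<le> k * (norm (x t))\<^sup>2" if "t > 0" for t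
    unfolding D[OF that] using k by (simp add: inner_add_right stokes_lin_inner stokes_quad_inner norm_vec3)
  have sol: "(\<chi> i. caputo_deriv q (\<lambda>s. x s $ i) t) = stokes_field l1 l2 l3 b1 b3 k (x t)" if t: "t > 0" for t
  proof -
    have "norm (x t) \<le> c * exp (m * t)"
      unfolding c_def m_def
      by (rule caputo_growth_bound[OF q k _ x(3) diss]) (use u0 x(1) t in auto)
    hence "(norm (x t))\<^sup>2 \<le> (c * exp (m * t))\<^sup>2" by (intro power_mono) auto
    also have "\<dots> = c\<^sup>2 * exp (2 * m * t)" by (simp add: power_mult_distrib exp_double[symmetric] mult_ac)
    also have "\<dots> \<le> c\<^sup>2 * exp (2 * m * (1 + (t powr q) ^ n))"
    proof -
      have "t \<le> 1 + (t powr q) ^ n"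
      proof (cases "t \<le> 1")
        case True
        thus ?thesis by (simp add: add_increasing2)
      next
        case False
        have "1 \<le> q * real n" using n q by (simp add: field_simps)
        hence "t powr 1 \<le> t powr (q * real n)" using False by (intro powr_mono) auto
        also have "\<dots> = (t powr q) ^ n" using t by (simp add: powr_power mult.commute)
        finally show ?thesis using t by simp
      qed
      thus ?thesis using m by (intro mult_left_mono) auto
    qed
    finally have "\<phi> t = 1" by (intro one) (simp add: R_def)
    thus ?thesis using D[OF t] by (simp add: stokes_field_split)
  qed
  have "caputo_solution q (stokes_field l1 l2 l3 b1 b3 k) x"
    using x(2,3) sol unfolding caputo_solution_def caputo_regular_def by (auto simp: vec_eq_iff)
  thus thesis using that x(1) by blast
qed

theorem stokes_unstable:
  assumes q: "0 < q" "q < 1" and k: "0 < k" and b: "b1 \<noteq> 0"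
  shows "caputo_unstable q (stokes_field l1 l2 l3 b1 b3 k) 0"
proof -
  let ?F = "stokes_field l1 l2 l3 b1 b3 k"
  \<comment> \<open>An eigenvector for k of the linear part and of its transpose: w \<bullet> u
    satisfies a scalar equation with rate k up to quadratic terms.\<close>
  define w :: "real^3" where "w = vector [b1, 0, b3]"
  define \<beta> where "\<beta> = norm w"
  have "w \<noteq> 0" using b by (auto simp: w_def vec_eq_iff forall_3)
  hence \<beta>: "\<beta> > 0" by (simp add: \<beta>_def)
  define m where "m = k powr (1 / q)"
  have m: "m > 0" and mq: "m powr q = k" using k q by (auto simp: m_def powr_powr)
  have m2: "(2 * m) powr q = 2 powr q * k" using m by (simp add: powr_mult mq)
  have two: "2 powr q > (1::real)" using q by (intro gr_one_powr) auto
  define C where "C = growth_const q"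
  have C: "C > 2" using growth_const q by (simp add: C_def)
  define c where "c = \<bar>b1 * (l2 - l3)\<bar> + \<bar>b3 * (l1 - l2)\<bar> + 1"
  have c: "c > 0" by (simp add: c_def)
  have wF: "k * (w \<bullet> u) - c * (norm u)\<^sup>2 \<le> w \<bullet> ?F u" for u
  proof -
    have comp: "\<bar>u$i * u$j\<bar> \<le> (norm u)\<^sup>2" for i j
      unfolding abs_mult power2_eq_square by (intro mult_mono component_le_norm_cart) auto
    have "w \<bullet> ?F u = k * (w \<bullet> u) + (b1 * (l2 - l3) * (u$2 * u$3) + b3 * (l1 - l2) * (u$1 * u$2))"
      by (simp add: w_def stokes_field_def inner_vec_def sum_3 algebra_simps)
    moreover have "\<bar>b1 * (l2 - l3) * (u$2 * u$3)\<bar> \<le> \<bar>b1 * (l2 - l3)\<bar> * (norm u)\<^sup>2"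
      unfolding abs_mult[of "b1 * (l2 - l3)"] by (intro mult_left_mono comp) auto
    moreover have "\<bar>b3 * (l1 - l2) * (u$1 * u$2)\<bar> \<le> \<bar>b3 * (l1 - l2)\<bar> * (norm u)\<^sup>2"
      unfolding abs_mult[of "b3 * (l1 - l2)"] by (intro mult_left_mono comp) auto
    moreover have "0 \<le> (norm u)\<^sup>2" by simp
    ultimately show ?thesis unfolding c_def distrib_right by linarith
  qed
  \<comment> \<open>The term e^(2mt) grows at rate 2^q k. With b' = \<kappa> \<delta>^2 its excess
    (2^q - 1) k b' equals the coefficient c (C \<delta> \<beta>)^2 of the bound on the quadratic
    error.\<close>
  define \<kappa> where "\<kappa> = c * C\<^sup>2 * \<beta>\<^sup>2 / ((2 powr q - 1) * k)"
  have \<kappa>: "\<kappa> > 0" using c C \<beta> two k by (simp add: \<kappa>_def)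
  \<comment> \<open>The peak of the lower bound is y0^2 / (16 b'), from which \<delta> cancels;
    dividing it by \<beta> gives a height for the norm.\<close>
  define \<epsilon> where "\<epsilon> = \<beta> ^ 3 / (16 * \<kappa>)"
  have \<epsilon>: "\<epsilon> > 0" using \<kappa> \<beta> by (simp add: \<epsilon>_def)
  show ?thesis
    unfolding caputo_unstable_def
  proof
    assume "caputo_stable q ?F 0"
    then obtain d where d: "d > 0"
      and stab: "\<And>x t. caputo_solution q ?F x \<Longrightarrow> norm (x 0) < d \<Longrightarrow> t > 0 \<Longrightarrow> norm (x t) < \<epsilon>"
      using \<epsilon> unfolding caputo_stable_def by (metis diff_zero)
    \<comment> \<open>The first entry places x 0 within d of the origin; the second gives y0 \<ge> 8
      b', so that the peak occurs at a positive time.\<close>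
    define \<delta> where "\<delta> = min (d / (2 * \<beta>)) (\<beta>\<^sup>2 / (8 * \<kappa>))"
    have \<delta>: "\<delta> > 0" using d \<beta> \<kappa> by (simp add: \<delta>_def)
    have "\<delta> \<le> d / (2 * \<beta>)" by (simp add: \<delta>_def)
    hence "\<delta> * \<beta> \<le> d / 2" using \<beta> by (simp add: field_simps)
    hence \<delta>d: "\<delta> * \<beta> < d" using d by linarith
    have "\<delta> \<le> \<beta>\<^sup>2 / (8 * \<kappa>)" by (simp add: \<delta>_def)
    hence \<delta>\<kappa>: "8 * \<kappa> * \<delta> \<le> \<beta>\<^sup>2" using \<kappa> by (simp add: field_simps)
    obtain x where sol: "caputo_solution q ?F x" and x0: "x 0 = \<delta> *\<^sub>R w"
      using stokes_solution_exists[OF q k, of "\<delta> *\<^sub>R w" l1 l2 l3 b1 b3] \<delta> \<open>w \<noteq> 0\<close> by auto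
    have nx0: "norm (x 0) = \<delta> * \<beta>" using \<delta> by (simp add: x0 \<beta>_def)
    have growth: "norm (x t) \<le> C * (\<delta> * \<beta>) * exp (m * t)" if "0 \<le> t" for t
      unfolding C_def m_def
    proof (rule caputo_growth_bound[OF q k _ caputo_solution_regular(1)[OF sol] _ _ that])
      fix t :: real assume "t > 0"
      have "k * ((x t $ 1)\<^sup>2 + (x t $ 3)\<^sup>2) \<le> k * (norm (x t))\<^sup>2"
        using k by (intro mult_left_mono) (auto simp: norm_vec3)
      thus "x t \<bullet> (\<chi> i. caputo_deriv q (\<lambda>s. x s $ i) t) \<le> k * (norm (x t))\<^sup>2"
        unfolding caputo_solution_regular(2)[OF sol \<open>t > 0\<close>] by (simp add: stokes_energy)
    qed (use \<delta> \<beta> nx0 in auto)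
    define y0 where "y0 = \<delta> * \<beta>\<^sup>2"
    have y0: "y0 > 0" using \<delta> \<beta> by (simp add: y0_def)
    define b' where "b' = \<kappa> * \<delta>\<^sup>2"
    have b': "b' > 0" using \<kappa> \<delta> by (simp add: b'_def)
    have b'8: "8 * b' \<le> y0" using mult_right_mono[OF \<delta>\<kappa>, of \<delta>] \<delta>
      by (simp add: b'_def y0_def power2_eq_square mult_ac)
    have b'k: "b' * ((2 powr q - 1) * k) = c * (C * (\<delta> * \<beta>))\<^sup>2"
    proof -
      have "(2 powr q - 1) * k \<noteq> 0" using two k q by simp
      thus ?thesis by (simp add: b'_def \<kappa>_def power_mult_distrib)
    qed
    \<comment> \<open>The subsolution minus w \<bullet> x. Starting at half of y0 creates the gap at
      time 0 that the extremum principle exploits.\<close>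
    define f where "f = (\<lambda>s. (y0 / 2) * exp (m * s) + (- b') * exp (2 * m * s) + (- w) \<bullet> x s)"
    have m2p: "0 < 2 * m" using m by simp
    have e1: "caputo_regular q (\<lambda>s. exp (m * s))" and e2: "caputo_regular q (\<lambda>s. exp (2 * m * s))"
      by (rule caputo_deriv_exp(1)[OF q m] caputo_deriv_exp(1)[OF q m2p])+
    note r1 = caputo_regular_cmult(1)[OF e1, of "y0 / 2"] and r2 = caputo_regular_cmult(1)[OF e2, of "- b'"]
    note r12 = caputo_regular_add(1)[OF r1 r2] and r3 = caputo_solution_inner(1)[OF sol, of "- w"]
    have freg: "caputo_regular q f" unfolding f_def by (rule caputo_regular_add(1)[OF r12 r3])
    have w0: "w \<bullet> x 0 = y0" by (simp add: x0 y0_def \<beta>_def power2_norm_eq_inner)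
    have f0: "f 0 = - (y0 / 2) - b'" by (simp add: f_def w0)
    have f0neg: "f 0 < 0" using f0 y0 b' by simp
    have above: "f t \<le> 0" if t: "t > 0" for t
    proof (rule ccontr)
      assume "\<not> f t \<le> 0"
      hence ft: "f t > 0" by simp
      have "continuous_on {0..} f" using freg by (simp add: caputo_regular_def)
      from first_touch[OF this f0neg t ft]
      obtain r where r: "0 < r" "f r = 0" "\<And>s. 0 \<le> s \<Longrightarrow> s \<le> r \<Longrightarrow> f s \<le> 0"
        by blast
      define g where "g = r powr (- q) / Gamma (1 - q)"
      have g: "g > 0" using r q by (auto simp: g_def intro!: divide_pos_pos Gamma_real_pos)
      have "g * (f r - f 0) \<le> caputo_deriv q f r"
        unfolding g_def by (rule caputo_deriv_extremum[OF q r(1) freg]) (use r in auto)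
      also have "caputo_deriv q f r = (y0 / 2) * caputo_deriv q (\<lambda>s. exp (m * s)) r
          + (- b') * caputo_deriv q (\<lambda>s. exp (2 * m * s)) r + (- w) \<bullet> ?F (x r)"
        unfolding f_def
        by (simp only: caputo_regular_add(2)[OF r12 r3 r(1)] caputo_regular_add(2)[OF r1 r2 r(1)]
            caputo_regular_cmult(2)[OF e1 r(1)] caputo_regular_cmult(2)[OF e2 r(1)] caputo_solution_inner(2)[OF sol r(1)])
      finally have fin: "g * (f r - f 0) \<le> (y0 / 2) * caputo_deriv q (\<lambda>s. exp (m * s)) r
          + (- b') * caputo_deriv q (\<lambda>s. exp (2 * m * s)) r + (- w) \<bullet> ?F (x r)" .
      have A: "g * (y0 / 2 + b') \<le> (y0 / 2) * caputo_deriv q (\<lambda>s. exp (m * s)) r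
          - b' * caputo_deriv q (\<lambda>s. exp (2 * m * s)) r - w \<bullet> ?F (x r)"
      proof -
        have "f r - f 0 = y0 / 2 + b'" using r(2) f0 by simp
        from fin[unfolded this] show ?thesis by simp
      qed
      define E where "E = exp (m * r)"
      have E2: "exp (2 * m * r) = E\<^sup>2" by (simp add: E_def exp_double[symmetric] mult_ac)
      have "(y0 / 2) * caputo_deriv q (\<lambda>s. exp (m * s)) r \<le> (y0 / 2) * (k * E)"
        using caputo_deriv_exp(2)[OF q m r(1)] y0 mq unfolding E_def by (intro mult_left_mono) auto
      moreover have "b' * (2 powr q * k * E\<^sup>2 - g) \<le> b' * caputo_deriv q (\<lambda>s. exp (2 * m * s)) r"
        using caputo_deriv_exp(3)[OF q m2p r(1)] b' unfolding m2 E2 g_def by (intro mult_left_mono) auto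
      moreover have "w \<bullet> x r = (y0 / 2) * E - b' * E\<^sup>2" using r(2) by (simp add: f_def E2 E_def)
      hence "k * ((y0 / 2) * E - b' * E\<^sup>2) - c * (norm (x r))\<^sup>2 \<le> w \<bullet> ?F (x r)" using wF[of "x r"] by simp
      moreover have "(norm (x r))\<^sup>2 \<le> (C * (\<delta> * \<beta>) * E)\<^sup>2"
        using growth[of r] r(1) unfolding E_def by (intro power_mono) auto
      hence "c * (norm (x r))\<^sup>2 \<le> c * (C * (\<delta> * \<beta>))\<^sup>2 * E\<^sup>2"
        using c by (simp add: power_mult_distrib mult_left_mono mult.assoc)
      hence "c * (norm (x r))\<^sup>2 \<le> b' * ((2 powr q - 1) * k) * E\<^sup>2" unfolding b'k .
      \<comment> \<open>The part b' g of the gap pays for the defect of e^(2mt); what is left, g y0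
        / 2, is positive and gives the contradiction.\<close>
      ultimately have "g * (y0 / 2 + b') \<le> b' * g" using A by (simp add: algebra_simps)
      hence "g * (y0 / 2) \<le> 0" by (simp add: algebra_simps)
      thus False using g y0 by (simp add: mult_le_0_iff)
    qed
    \<comment> \<open>The time at which E = e^(mt) maximises
      \<open>(y0 / 2) * E - b' * E\<^sup>2\<close>.\<close>
    define t where "t = ln (y0 / (4 * b')) / m"
    have "y0 / (4 * b') > 1" using b'8 b' by (simp add: field_simps)
    hence t: "t > 0" and et: "exp (m * t) = y0 / (4 * b')" using m by (auto simp: t_def)
    have "exp (2 * m * t) = (exp (m * t))\<^sup>2" by (simp add: exp_double[symmetric] mult_ac)
    hence "(y0 / 2) * (y0 / (4 * b')) - b' * (y0 / (4 * b'))\<^sup>2 \<le> w \<bullet> x t"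
      using above[OF t] et by (simp add: f_def)
    moreover have "(y0 / 2) * (y0 / (4 * b')) - b' * (y0 / (4 * b'))\<^sup>2 = y0\<^sup>2 / (16 * b')"
      using b' by (simp add: power2_eq_square field_simps)
    moreover have "y0\<^sup>2 / (16 * b') = \<beta> * \<epsilon>"
      using \<delta> \<kappa> by (simp add: y0_def b'_def \<epsilon>_def power2_eq_square power3_eq_cube field_simps)
    moreover have "w \<bullet> x t \<le> \<beta> * norm (x t)" unfolding \<beta>_def by (rule norm_cauchy_schwarz)
    ultimately have "\<beta> * \<epsilon> \<le> \<beta> * norm (x t)" by linarith
    hence "\<epsilon> \<le> norm (x t)" using \<beta> by simp
    thus False using stab[OF sol _ t] nx0 \<delta>d by simp
  qed
qed

theorem theorem4p2:
  fixes l1 l2 l3 b1 b3 k3 q :: real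
  assumes "l1 \<noteq> l2" "l2 \<noteq> l3" "l1 \<noteq> l3"
    and "b1 \<noteq> 0" "b3 \<noteq> 0" "k3 \<noteq> 0"
    and "0 < q" "q < 1"
  defines "F \<equiv> stokes_field l1 l2 l3 b1 b3 k3"
    and "\<beta> \<equiv> sqrt (b1\<^sup>2 + b3\<^sup>2)"
    and "\<Delta> \<equiv> k3\<^sup>2 - 4 * (sqrt (b1\<^sup>2 + b3\<^sup>2))\<^sup>2"
  shows "equilibrium_state F 0 \<and>
    ((\<Delta> < 0 \<longrightarrow>
        (k3 < 0 \<longrightarrow> caputo_asymptotically_stable q F 0) \<and>
        (k3 > 0 \<longrightarrow> caputo_unstable q F 0)) \<and>
     (k3 \<in> {-2 * \<beta><..<0} \<longrightarrow> caputo_asymptotically_stable q F 0) \<and>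
     (k3 \<in> {0<..<2 * \<beta>} \<longrightarrow> caputo_unstable q F 0)) \<and>
    ((\<Delta> \<ge> 0 \<longrightarrow>
        (k3 < 0 \<longrightarrow> caputo_asymptotically_stable q F 0) \<and>
        (k3 > 0 \<longrightarrow> caputo_unstable q F 0)) \<and>
     (k3 \<in> {..-2 * \<beta>} \<longrightarrow> caputo_asymptotically_stable q F 0) \<and>
     (k3 \<in> {2 * \<beta>..} \<longrightarrow> caputo_unstable q F 0))"
proof -
  \<comment> \<open>Turns the conditions \<open>k3 \<le> -2 * \<beta>\<close> and
    \<open>2 * \<beta> \<le> k3\<close> into conditions on the sign of \<open>k3\<close>.\<close>
  have \<beta>: "\<beta> > 0" using assms(4) by (simp add: \<beta>_def sum_power2_gt_zero_iff)
  have "equilibrium_state F 0"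
    by (simp add: equilibrium_state_def F_def stokes_field_def forall_3)
  moreover have "caputo_asymptotically_stable q F 0" if "k3 < 0"
    unfolding F_def by (rule stokes_asymptotically_stable[OF assms(7,8) that assms(4)])
  moreover have "caputo_unstable q F 0" if "0 < k3"
    unfolding F_def by (rule stokes_unstable[OF assms(7,8) that assms(4)])
  ultimately show ?thesis using \<beta> by auto
qed

end
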